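(* Let $r$ be a positive integer or $r=\infty$ (with the convention $\min\{m,\infty\}=m$). Then $$\sum_{n\le x} a_r(n)=\Big\{\prod_{m=2}^{\infty}\zeta(m)^{\min\{m,r\}}\Big\}\,x+o(x)\qquad\text{as } x\to\infty.$$ More precisely, if $j$ and $k$ are positive integers with $(j,k)=1$, then $$\sum_{\substack{n\le x\\ n\equiv k\ (\mathrm{mod}\ j)}} a_r(n)=\frac{c_r(j)}{\phi(j)}\,x+o(x)\qquad\text{as } x\to\infty,$$ where $\phi$ is the Euler function and $c_r(j)$ is the constant $$c_r(j):=\prod_{m=1}^{\infty}\ \prod_{p\mid j}\,(1-p^{-m})^{\min\{m,r\}}\times\prod_{m=2}^{\infty}\zeta(m)^{\min\{m,r\}},$$ the product over $p\mid j$ being over the prime divisors $p$ of $j$.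
   Context: For an isomorphism class $G$ of finite Abelian groups, a group-partition of $G$ is a sequence $(G_1,G_2,G_3,\dots)$ of isomorphism classes of finite Abelian groups (all but finitely many trivial) such that $G=G_1\oplus G_2\oplus G_3\oplus\cdots$ and $G_1\supseteq G_2\supseteq G_3\supseteq\cdots$, where $G_i\supseteq G_{i+1}$ means that $G_{i+1}$ is isomorphic to a subgroup of $G_i$. For a positive integer $r$, $\pi_r(G)$ is the number of group-partitions of $G$ with at most $r$ factors (i.e. at most $r$ nontrivial $G_i$), and $\pi_\infty(G)$ is the number of all group-partitions of $G$. For $n\ge 1$ and $r\in\{1,2,3,\dots\}\cup\{\infty\}$, put $a_r(n):=\sum_{|G|=n}\pi_r(G)$, where $G$ runs over the isomorphism classes of Abelian groups of order $n$. $\zeta$ is the Riemann zeta function. *)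

theory Defs
  imports
    "HOL-Analysis.Infinite_Products"
    "HOL-Library.Landau_Symbols"
    "HOL-Library.Extended_Nat"
    "HOL-Number_Theory.Totient"
    "HOL-Algebra.Elementary_Groups"
    "HOL-Algebra.Product_Groups"
begin

text \<open>
  Every finite group is isomorphic to one whose carrier is a set of natural numbers, so the
  isomorphism classes of finite Abelian groups are represented by the classes of
  \<^typ>\<open>nat monoid\<close>s.  An element of \<open>fin_ab_classes\<close> is a nonempty set of groups, and a property
  or an invariant of a class is expressed through any of its representatives.
\<close>

definition fin_ab_groups :: "nat monoid set" where
  "fin_ab_groups = {G. comm_group G \<and> finite (carrier G)}"

definition fin_ab_iso_rel :: "(nat monoid \<times> nat monoid) set" where
  "fin_ab_iso_rel = {(G, H). G \<in> fin_ab_groups \<and> H \<in> fin_ab_groups \<and> G \<cong> H}"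

definition fin_ab_classes :: "nat monoid set set" where
  "fin_ab_classes = fin_ab_groups // fin_ab_iso_rel"

definition classes_of_order :: "nat \<Rightarrow> nat monoid set set" where
  "classes_of_order n = {C \<in> fin_ab_classes. \<exists>G\<in>C. order G = n}"

definition trivial_class :: "nat monoid set \<Rightarrow> bool" where
  "trivial_class C \<longleftrightarrow> (\<exists>G\<in>C. trivial_group G)"

definition embeds_in_class :: "nat monoid set \<Rightarrow> nat monoid set \<Rightarrow> bool" where
  "embeds_in_class D C \<longleftrightarrow>
     (\<exists>G\<in>C. \<exists>H\<in>D. \<exists>S. subgroup S G \<and> H \<cong> G\<lparr>carrier := S\<rparr>)"

text \<open>
  \<^const>\<open>sum_group\<close> is the external direct sum of a family (the finitely supported elements of the
  product), so it can be formed over the whole index set even though the sequence is infinite.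
\<close>

definition is_direct_sum :: "nat monoid set \<Rightarrow> (nat \<Rightarrow> nat monoid set) \<Rightarrow> bool" where
  "is_direct_sum C P \<longleftrightarrow>
     (\<exists>G\<in>C. \<exists>X. (\<forall>i. X i \<in> P i) \<and> G \<cong> sum_group UNIV X)"

text \<open>The term \<open>P i\<close> of the sequence is $G_{i+1}$: sequences are indexed from 0 here.\<close>

definition group_partition :: "nat monoid set \<Rightarrow> (nat \<Rightarrow> nat monoid set) \<Rightarrow> bool" where
  "group_partition C P \<longleftrightarrow>
     (\<forall>i. P i \<in> fin_ab_classes) \<and>
     finite {i. \<not> trivial_class (P i)} \<and>
     is_direct_sum C P \<and>
     (\<forall>i. embeds_in_class (P (Suc i)) (P i))"

text \<open>For \<open>r = \<infinity>\<close> the bound on the number of nontrivial factors is void.\<close>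

definition group_partition_count :: "enat \<Rightarrow> nat monoid set \<Rightarrow> nat" where
  "group_partition_count r C =
     card {P. group_partition C P \<and> enat (card {i. \<not> trivial_class (P i)}) \<le> r}"

definition partition_sum :: "enat \<Rightarrow> nat \<Rightarrow> nat" where
  "partition_sum r n = (\<Sum>C\<in>classes_of_order n. group_partition_count r C)"

definition min_exp :: "nat \<Rightarrow> enat \<Rightarrow> nat" where
  "min_exp m r = the_enat (min (enat m) r)"

text \<open>The Riemann zeta function on the half-line \<open>s > 1\<close>, where it is given by its Dirichlet series.\<close>

definition riemann_zeta :: "real \<Rightarrow> real" where
  "riemann_zeta s = (\<Sum>n. 1 / real (Suc n) powr s)"

text \<open>Factors of the infinite products, with \<open>m\<close> the index used in the mathematics.\<close>

definition zeta_factor :: "enat \<Rightarrow> nat \<Rightarrow> real" where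
  "zeta_factor r m = riemann_zeta (real m) ^ min_exp m r"

definition local_factor :: "enat \<Rightarrow> nat \<Rightarrow> nat \<Rightarrow> real" where
  "local_factor r j m = (\<Prod>p | prime p \<and> p dvd j. (1 - 1 / real p ^ m) ^ min_exp m r)"

definition zeta_const :: "enat \<Rightarrow> real" where
  "zeta_const r = (\<Prod>i. zeta_factor r (i + 2))"

definition progression_const :: "enat \<Rightarrow> nat \<Rightarrow> real" where
  "progression_const r j = (\<Prod>i. local_factor r j (i + 1)) * (\<Prod>i. zeta_factor r (i + 2))"

end

theory Submission
  imports Defs "HOL-Algebra.Multiplicative_Group"
begin

text \<open>
  A finite Abelian group is determined by its invariant factors, a chain of integers under
  divisibility, and one group embeds in another iff its invariant factors divide those of the other
  one by one. A group-partition of a group of order \<open>n\<close> is therefore an array of positive integers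
  with product \<open>n\<close>, decreasing under divisibility along rows and columns, with at most \<open>r\<close> nontrivial
  rows. The proof of MacMahon's theorem by toggling diagonals works in any lattice-ordered group; with
  gcd and lcm in place of min and max it turns these arrays into arbitrary arrays \<open>g\<close> with
  \<open>(\<Prod>i j. g i j ^ (i + j + 1)) = n\<close>, and there are \<open>min m r\<close> cells of weight \<open>m\<close>. No decomposition
  into prime powers is needed.

  Splitting off the only cell of weight 1 gives \<open>a\<^sub>r(n) = (\<Sum>d | d dvd n. b d)\<close>, where
  the sum of \<open>b d / d\<close> over the \<open>d\<close> coprime to \<open>j\<close> is the product over \<open>m \<ge> 2\<close> of
  \<open>(\<zeta>(m) (\<Prod>p | p dvd j. 1 - 1 / p ^ m)) ^ min m r\<close>. Counting the multiples of each \<open>d\<close> in the residue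
  class and passing to the limit by dominated convergence gives the asymptotics.
\<close>

section \<open>Toggling the diagonals of a divisibility array\<close>

text \<open>Equality of the weights alone would not survive an induction on the shape. What does is
  a finer statement: at every end of a diagonal, the product along the diagonal equals the product
  of the free array over the whole rectangle up to that end. The toggled diagonal telescopes because
  gcd times lcm is the product, and multiplying over the ends in the last row and column gives each
  cell its hook length as exponent.

  All infinite index sets shrink through powers of 2: in a group of order \<open>n\<close> a
  nontrivial entry in row or column \<open>i\<close> forces \<open>2 ^ Suc i \<le> n\<close>, and a
  free entry other than 1 in a cell of weight \<open>w\<close> forces \<open>2 ^ w \<le> n\<close>.
  Hence finite boxes also serve \<open>r = \<infinity>\<close>.

  The cell of weight 1 is kept apart because its series, the sum of \<open>1 / n\<close>, diverges;
  it is the source of the factor \<open>x\<close>, through the count of multiples of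
  \<open>d\<close> up to \<open>x\<close>. The other cells give a convergent sum of
  \<open>b d / d\<close>, which provides the majorant for the limit. The Euler function enters only
  through the local factor with \<open>m = 1\<close>, whose value is \<phi>(j)/j.\<close>

definition diagram :: "(nat \<times> nat) set \<Rightarrow> bool" where
  "diagram S \<longleftrightarrow> (\<forall>i j. (i, j) \<in> S \<longrightarrow> 1 \<le> i \<and> 1 \<le> j \<and>
     (\<forall>i' j'. 1 \<le> i' \<and> i' \<le> i \<and> 1 \<le> j' \<and> j' \<le> j \<longrightarrow> (i', j') \<in> S))"

definition fillings :: "(nat \<times> nat) set \<Rightarrow> (nat \<Rightarrow> nat \<Rightarrow> nat) set" where
  "fillings S = {g. \<forall>i j. g i j > 0 \<and> ((i, j) \<notin> S \<longrightarrow> g i j = 1)}"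

definition dvd_fillings :: "(nat \<times> nat) set \<Rightarrow> (nat \<Rightarrow> nat \<Rightarrow> nat) set" where
  "dvd_fillings S = {f \<in> fillings S. \<forall>i j.
     ((Suc i, j) \<in> S \<longrightarrow> f i j dvd f (Suc i) j) \<and>
     ((i, Suc j) \<in> S \<longrightarrow> f i j dvd f i (Suc j))}"

text \<open>Row 0 and column 0 are a border on which all fillings are 1, so every cell has an upper and a left
  neighbour.\<close>

definition toggled :: "(nat \<Rightarrow> nat \<Rightarrow> nat) \<Rightarrow> nat \<Rightarrow> nat \<Rightarrow> nat" where
  "toggled f i j = lcm (f (i - 1) j) (f i (j - 1)) * gcd (f (Suc i) j) (f i (Suc j)) div f i j"

text \<open>Cells of one diagonal are never neighbours, so all toggles read unchanged values and can
  be done at once. The corner itself is overwritten by \<open>x\<close>: a multiple of the lcm of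
  its neighbours when it is added, 1 when it is removed, the old value when a toggling is
  undone.\<close>

definition toggle_diag :: "nat \<Rightarrow> nat \<Rightarrow> nat \<Rightarrow> (nat \<Rightarrow> nat \<Rightarrow> nat) \<Rightarrow> nat \<Rightarrow> nat \<Rightarrow> nat" where
  "toggle_diag a b x f i j =
     (if i = Suc a \<and> j = Suc b then x
      else if 1 \<le> i \<and> 1 \<le> j \<and> i \<le> a \<and> i + b = j + a then toggled f i j else f i j)"

text \<open>The corner entry only has to be a multiple of the lcm of its neighbours, so its quotient
  by that lcm is an arbitrary positive number. This is how a constrained entry becomes a free
  one.\<close>

definition inserted :: "nat \<Rightarrow> nat \<Rightarrow> (nat \<Rightarrow> nat \<Rightarrow> nat) \<times> nat \<Rightarrow> nat \<Rightarrow> nat \<Rightarrow> nat" where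
  "inserted a b = (\<lambda>(f, t). toggle_diag a b (t * lcm (f a (Suc b)) (f (Suc a) b)) f)"

definition extracted :: "nat \<Rightarrow> nat \<Rightarrow> (nat \<Rightarrow> nat \<Rightarrow> nat) \<Rightarrow> (nat \<Rightarrow> nat \<Rightarrow> nat) \<times> nat" where
  "extracted a b f =
     (toggle_diag a b 1 f, f (Suc a) (Suc b) div lcm (f a (Suc b)) (f (Suc a) b))"

text \<open>With \<open>p = lcm n w * u\<close> one gets \<open>q * u = gcd s e\<close>: the
  division is exact and the new value lies between the same neighbours as the old one. The last
  conclusion makes toggling an involution.\<close>

lemma toggle_value:
  fixes n w s e p :: nat
  assumes "n dvd p" "w dvd p" "p dvd s" "p dvd e" "0 < p" "0 < s"
  defines "q \<equiv> lcm n w * gcd s e div p"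
  shows "q * p = lcm n w * gcd s e" "n dvd q" "w dvd q" "q dvd s" "q dvd e" "0 < q"
    "lcm n w * gcd s e div q = p"
proof -
  have p: "p dvd gcd s e" using assms by simp
  have l: "lcm n w dvd p" using assms by simp
  have g: "0 < gcd s e" using assms by simp
  have n: "0 < lcm n w" using l \<open>0 < p\<close> by (metis dvd_0_left_iff neq0_conv)
  show *: "q * p = lcm n w * gcd s e" unfolding q_def using p by simp
  have q1: "q = lcm n w * (gcd s e div p)" unfolding q_def using p by (simp add: div_mult_swap)
  show q0: "0 < q" using * g n by (cases "q = 0") auto
  show "n dvd q" "w dvd q" unfolding q1 by auto
  obtain u where u: "p = lcm n w * u" using l by blast
  have "lcm n w * (q * u) = lcm n w * gcd s e" using * unfolding u by (simp only: mult.assoc mult.left_commute)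
  hence "q * u = gcd s e" using n by (metis mult_cancel1 less_irrefl)
  hence "q dvd gcd s e" by (metis dvd_triv_left)
  thus "q dvd s" "q dvd e" by auto
  show "lcm n w * gcd s e div q = p" unfolding *[symmetric] using q0 by simp
qed

fun diag_prod :: "(nat \<Rightarrow> nat \<Rightarrow> nat) \<Rightarrow> nat \<Rightarrow> nat \<Rightarrow> nat" where
  "diag_prod f (Suc i) (Suc j) = f (Suc i) (Suc j) * diag_prod f i j"
| "diag_prod f 0 j = 1"
| "diag_prod f (Suc i) 0 = 1"

lemma diag_prod_0 [simp]: "diag_prod f i 0 = 1"
  by (cases i) auto

definition rect_prod :: "(nat \<Rightarrow> nat \<Rightarrow> nat) \<Rightarrow> nat \<Rightarrow> nat \<Rightarrow> nat" where
  "rect_prod g i j = (\<Prod>i'\<in>{1..i}. \<Prod>j'\<in>{1..j}. g i' j')"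


locale corner =
  fixes S :: "(nat \<times> nat) set" and a b :: nat
  assumes diagram: "diagram S" and diagram_insert: "diagram (insert (Suc a, Suc b) S)"
    and new: "(Suc a, Suc b) \<notin> S"
begin

lemma below_corner:
  assumes "1 \<le> i" "i \<le> Suc a" "1 \<le> j" "j \<le> Suc b" "i \<noteq> Suc a \<or> j \<noteq> Suc b"
  shows "(i, j) \<in> S"
proof -
  have "(i, j) \<in> insert (Suc a, Suc b) S"
    using diagram_insert assms unfolding diagram_def by blast
  thus ?thesis using assms by auto
qed

lemma not_beyond_corner:
  assumes "(i, j) \<in> S" shows "i \<le> a \<or> j \<le> b"
proof (rule ccontr)
  assume "\<not> ?thesis"
  moreover have "\<forall>i' j'. 1 \<le> i' \<and> i' \<le> i \<and> 1 \<le> j' \<and> j' \<le> j \<longrightarrow> (i', j') \<in> S"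
    using diagram assms unfolding diagram_def by blast
  ultimately have "(Suc a, Suc b) \<in> S" by simp
  thus False using new by blast
qed

lemma toggle_bounds:
  assumes f: "f \<in> dvd_fillings S \<or> f \<in> dvd_fillings (insert (Suc a, Suc b) S)"
    and ij: "1 \<le> i" "1 \<le> j" "i \<le> a" "i + b = j + a"
  shows "f (i - 1) j dvd f i j" "f i (j - 1) dvd f i j" "f i j dvd f (Suc i) j"
    "f i j dvd f i (Suc j)" "0 < f i j" "0 < f (Suc i) j"
proof -
  have m: "(i, j) \<in> S" "(Suc i, j) \<in> S" "(i, Suc j) \<in> S" using ij by (auto intro!: below_corner)
  obtain i' j' where "i = Suc i'" "j = Suc j'" using ij by (cases i; cases j) auto
  with m f show "f (i - 1) j dvd f i j" "f i (j - 1) dvd f i j" "f i j dvd f (Suc i) j"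
    "f i j dvd f i (Suc j)" "0 < f i j" "0 < f (Suc i) j"
    unfolding dvd_fillings_def fillings_def by auto
qed

lemma toggle_props:
  assumes f: "f \<in> dvd_fillings S \<or> f \<in> dvd_fillings (insert (Suc a, Suc b) S)"
    and ij: "1 \<le> i" "1 \<le> j" "i \<le> a" "i + b = j + a"
  shows "toggled f i j * f i j = lcm (f (i - 1) j) (f i (j - 1)) * gcd (f (Suc i) j) (f i (Suc j))"
    "f (i - 1) j dvd toggled f i j" "f i (j - 1) dvd toggled f i j"
    "toggled f i j dvd f (Suc i) j" "toggled f i j dvd f i (Suc j)" "0 < toggled f i j"
    "lcm (f (i - 1) j) (f i (j - 1)) * gcd (f (Suc i) j) (f i (Suc j)) div toggled f i j = f i j"
  using toggle_value[OF toggle_bounds[OF assms], folded toggled_def] by - assumption+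

text \<open>One statement for both directions: \<open>T = S\<close> with corner value 1 removes the
  corner, the other choice of \<open>T\<close> adds it. A divisibility condition never joins two
  cells of the same diagonal, so each condition involves at most one changed value.\<close>

lemma toggled_dvd_fillings:
  assumes f: "f \<in> dvd_fillings S \<or> f \<in> dvd_fillings (insert (Suc a, Suc b) S)"
    and x: "0 < x" and T: "T = S \<and> x = 1 \<or> T = insert (Suc a, Suc b) S \<and> lcm (f a (Suc b)) (f (Suc a) b) dvd x"
  shows "toggle_diag a b x f \<in> dvd_fillings T"
proof -
  have pos: "0 < f i j" for i j using f unfolding dvd_fillings_def fillings_def by auto
  have out: "(i, j) \<notin> insert (Suc a, Suc b) S \<Longrightarrow> f i j = 1" for i j
    using f unfolding dvd_fillings_def fillings_def by auto
  have v: "(Suc i, j) \<in> S \<Longrightarrow> f i j dvd f (Suc i) j" for i j using f unfolding dvd_fillings_def by auto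
  have h: "(i, Suc j) \<in> S \<Longrightarrow> f i j dvd f i (Suc j)" for i j using f unfolding dvd_fillings_def by auto
  define D where "D i j \<longleftrightarrow> 1 \<le> i \<and> 1 \<le> j \<and> i \<le> a \<and> i + b = j + a" for i j
  define F where "F = toggle_diag a b x f"
  have Fx: "F (Suc a) (Suc b) = x" by (simp add: F_def toggle_diag_def)
  have FD: "D i j \<Longrightarrow> F i j = toggled f i j" for i j by (simp add: F_def D_def toggle_diag_def)
  have Fo: "\<not> D i j \<Longrightarrow> i \<noteq> Suc a \<or> j \<noteq> Suc b \<Longrightarrow> F i j = f i j" for i j
    unfolding F_def D_def toggle_diag_def by auto
  have tog: "D i j \<Longrightarrow> f (i - 1) j dvd F i j" "D i j \<Longrightarrow> f i (j - 1) dvd F i j"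
    "D i j \<Longrightarrow> F i j dvd f (Suc i) j" "D i j \<Longrightarrow> F i j dvd f i (Suc j)" "D i j \<Longrightarrow> 0 < F i j"
    for i j using FD toggle_props[OF f, of i j] unfolding D_def by auto
  have DS: "D i j \<Longrightarrow> (i, j) \<in> S" for i j unfolding D_def by (intro below_corner) auto
  have fill: "F \<in> fillings T" unfolding fillings_def mem_Collect_eq
  proof (intro allI conjI impI)
    show "0 < F i j" for i j
      using x Fx pos[of i j] tog(5)[of i j] Fo[of i j] by (cases "D i j"; cases "i = Suc a \<and> j = Suc b") auto
    fix i j assume o: "(i, j) \<notin> T"
    show "F i j = 1"
    proof (cases "i = Suc a \<and> j = Suc b")
      case True thus ?thesis using o T Fx by auto
    next
      case False
      moreover have "\<not> D i j" using DS o T by auto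
      ultimately show ?thesis using o T out[of i j] Fo[of i j] by auto
    qed
  qed
  have x': "f a (Suc b) dvd x" "f (Suc a) b dvd x" if "(Suc a, Suc b) \<in> T"
    using that T new by (metis dvd_lcm1 dvd_lcm2 dvd_trans)+
  have "F i j dvd F (Suc i) j" if ij: "(Suc i, j) \<in> T" for i j
  proof (cases "Suc i = Suc a \<and> j = Suc b")
    case True
    hence "\<not> D i j" unfolding D_def by auto
    thus ?thesis using True Fo[of i j] Fx x'(1) ij by auto
  next
    case False
    hence S: "(Suc i, j) \<in> S" using ij T by auto
    hence n: "i \<noteq> Suc a \<or> j \<noteq> Suc b" using not_beyond_corner[OF S] by auto
    consider "D i j" "\<not> D (Suc i) j" | "\<not> D i j" "D (Suc i) j" | "\<not> D i j" "\<not> D (Suc i) j"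
      unfolding D_def by fastforce
    thus ?thesis
    proof cases
      case 1 thus ?thesis using Fo[of "Suc i" j] False tog(3)[of i j] by auto
    next
      case 2 thus ?thesis using Fo[of i j] n tog(1)[of "Suc i" j] by auto
    next
      case 3 thus ?thesis using Fo[of "Suc i" j] Fo[of i j] n False v[OF S] by auto
    qed
  qed
  moreover have "F i j dvd F i (Suc j)" if ij: "(i, Suc j) \<in> T" for i j
  proof (cases "i = Suc a \<and> Suc j = Suc b")
    case True
    hence "\<not> D i j" unfolding D_def by auto
    thus ?thesis using True Fo[of i j] Fx x'(2) ij by auto
  next
    case False
    hence S: "(i, Suc j) \<in> S" using ij T by auto
    hence n: "i \<noteq> Suc a \<or> j \<noteq> Suc b" using not_beyond_corner[OF S] by auto
    consider "D i j" "\<not> D i (Suc j)" | "\<not> D i j" "D i (Suc j)" | "\<not> D i j" "\<not> D i (Suc j)"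
      unfolding D_def by fastforce
    thus ?thesis
    proof cases
      case 1 thus ?thesis using Fo[of i "Suc j"] False tog(4)[of i j] by auto
    next
      case 2 thus ?thesis using Fo[of i j] n tog(2)[of i "Suc j"] by auto
    next
      case 3 thus ?thesis using Fo[of i "Suc j"] Fo[of i j] n False h[OF S] by auto
    qed
  qed
  ultimately have "F \<in> dvd_fillings T" using fill unfolding dvd_fillings_def by auto
  thus ?thesis unfolding F_def .
qed

text \<open>The neighbours that a toggle reads lie off the diagonal and keep their values, so the
  second toggle divides the same numerator by the result of the first. The corner, overwritten by
  \<open>x\<close>, has to be restored explicitly.\<close>

lemma toggle_diag_twice:
  assumes f: "f \<in> dvd_fillings S \<or> f \<in> dvd_fillings (insert (Suc a, Suc b) S)"
  shows "toggle_diag a b (f (Suc a) (Suc b)) (toggle_diag a b x f) = f"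
proof (intro ext)
  fix i j
  show "toggle_diag a b (f (Suc a) (Suc b)) (toggle_diag a b x f) i j = f i j"
  proof (cases "1 \<le> i \<and> 1 \<le> j \<and> i \<le> a \<and> i + b = j + a")
    case True
    hence d: "1 \<le> i" "1 \<le> j" "i \<le> a" "i + b = j + a" by auto
    have "toggle_diag a b x f (i - 1) j = f (i - 1) j" "toggle_diag a b x f i (j - 1) = f i (j - 1)"
      "toggle_diag a b x f (Suc i) j = f (Suc i) j" "toggle_diag a b x f i (Suc j) = f i (Suc j)"
      "toggle_diag a b x f i j = toggled f i j"
      using d by (auto simp add: toggle_diag_def)
    hence "toggled (toggle_diag a b x f) i j =
        lcm (f (i - 1) j) (f i (j - 1)) * gcd (f (Suc i) j) (f i (Suc j)) div toggled f i j"
      unfolding toggled_def[of "toggle_diag a b x f"] by simp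
    also have "\<dots> = f i j" using toggle_props(7)[OF f d] .
    finally show ?thesis using d by (simp add: toggle_diag_def[of a b "f (Suc a) (Suc b)"])
  next
    case False
    thus ?thesis unfolding toggle_diag_def by auto
  qed
qed

lemma bij_betw_inserted:
  "bij_betw (inserted a b) (dvd_fillings S \<times> {0<..}) (dvd_fillings (insert (Suc a, Suc b) S))"
proof (rule bij_betw_byWitness[where f' = "extracted a b"])
  have pos: "0 < f i j" if "f \<in> dvd_fillings T" for f T i j
    using that by (auto simp: dvd_fillings_def fillings_def)
  have lp: "0 < lcm (f a (Suc b)) (f (Suc a) b)" if "f \<in> dvd_fillings T" for f T
    using pos[OF that] by (auto intro: lcm_pos_nat)
  have "inserted a b (f, t) \<in> dvd_fillings (insert (Suc a, Suc b) S)"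
    if f: "f \<in> dvd_fillings S" and t: "0 < t" for f t
  proof -
    have "0 < t * lcm (f a (Suc b)) (f (Suc a) b)" using t lp[OF f] by simp
    from toggled_dvd_fillings[OF disjI1[OF f] this, of "insert (Suc a, Suc b) S"]
    show ?thesis unfolding inserted_def prod.case by simp
  qed
  thus "inserted a b ` (dvd_fillings S \<times> {0<..}) \<subseteq> dvd_fillings (insert (Suc a, Suc b) S)"
    by auto
  have l: "lcm (f a (Suc b)) (f (Suc a) b) dvd f (Suc a) (Suc b)"
    if "f \<in> dvd_fillings (insert (Suc a, Suc b) S)" for f
    using that by (auto simp: dvd_fillings_def)
  show "extracted a b ` dvd_fillings (insert (Suc a, Suc b) S) \<subseteq> dvd_fillings S \<times> {0<..}"
  proof (rule image_subsetI)
    fix f assume f: "f \<in> dvd_fillings (insert (Suc a, Suc b) S)"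
    have "0 < f (Suc a) (Suc b) div lcm (f a (Suc b)) (f (Suc a) b)"
      using dvd_imp_le[OF l[OF f] pos[OF f]] lp[OF f] by (simp add: div_greater_zero_iff)
    thus "extracted a b f \<in> dvd_fillings S \<times> {0<..}"
      using toggled_dvd_fillings[OF disjI2[OF f], of 1 S] unfolding extracted_def by simp
  qed
  have "extracted a b (inserted a b (f, t)) = (f, t)" if f: "f \<in> dvd_fillings S" for f t
  proof -
    have x: "f (Suc a) (Suc b) = 1" using f new unfolding dvd_fillings_def fillings_def by auto
    have "toggle_diag a b 1 (inserted a b (f, t)) = f"
      using toggle_diag_twice[OF disjI1[OF f]] x unfolding inserted_def by simp
    moreover have "inserted a b (f, t) (Suc a) (Suc b) = t * lcm (f a (Suc b)) (f (Suc a) b)"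
      "inserted a b (f, t) a (Suc b) = f a (Suc b)" "inserted a b (f, t) (Suc a) b = f (Suc a) b"
      unfolding inserted_def toggle_diag_def by auto
    ultimately show ?thesis using lp[OF f] unfolding extracted_def by simp
  qed
  thus "\<forall>y\<in>dvd_fillings S \<times> {0<..}. extracted a b (inserted a b y) = y" by auto
  show "\<forall>y\<in>dvd_fillings (insert (Suc a, Suc b) S). inserted a b (extracted a b y) = y"
  proof (rule ballI)
    fix f assume f: "f \<in> dvd_fillings (insert (Suc a, Suc b) S)"
    have "toggle_diag a b 1 f a (Suc b) = f a (Suc b)" "toggle_diag a b 1 f (Suc a) b = f (Suc a) b"
      unfolding toggle_diag_def by auto
    thus "inserted a b (extracted a b f) = f"
      using toggle_diag_twice[OF disjI2[OF f], of 1] l[OF f] unfolding inserted_def extracted_def by simp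
  qed
qed

lemma dvd_fillings_border:
  assumes "f \<in> dvd_fillings S" shows "f 0 j = 1" "f i 0 = 1"
proof -
  have "(0, j) \<notin> S" "(i, 0) \<notin> S" using diagram unfolding diagram_def by fastforce+
  thus "f 0 j = 1" "f i 0 = 1" using assms unfolding dvd_fillings_def fillings_def by blast+
qed

text \<open>Telescoping along the diagonal: a toggle trades the lcm of the upper and left neighbours
  for the gcd of the lower and right ones, and gcd times lcm is the product of the latter two. The
  lcm left over at the end is the one that the corner value brings in.\<close>

lemma diag_prod_inserted_below:
  assumes f: "f \<in> dvd_fillings S" and "i \<le> a" "i + b = j + a"
  shows "diag_prod (inserted a b (f, t)) i j * diag_prod f i j * lcm (f i (Suc j)) (f (Suc i) j)
    = diag_prod f i (Suc j) * diag_prod f (Suc i) j"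
  using assms(2,3)
proof (induction i arbitrary: j)
  case 0
  show ?case using dvd_fillings_border[OF f] by (cases j) auto
next
  case (Suc i)
  show ?case
  proof (cases j)
    case 0 thus ?thesis using dvd_fillings_border[OF f] by auto
  next
    case (Suc j')
    have IH: "diag_prod (inserted a b (f, t)) i j' * diag_prod f i j' * lcm (f i (Suc j')) (f (Suc i) j')
        = diag_prod f i (Suc j') * diag_prod f (Suc i) j'"
      using Suc.IH[of j'] Suc.prems Suc by auto
    have v: "inserted a b (f, t) (Suc i) (Suc j') = toggled f (Suc i) (Suc j')"
      using Suc Suc.prems unfolding inserted_def toggle_diag_def by auto
    have t: "toggled f (Suc i) (Suc j') * f (Suc i) (Suc j') =
       lcm (f i (Suc j')) (f (Suc i) j') * gcd (f (Suc (Suc i)) (Suc j')) (f (Suc i) (Suc (Suc j')))"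
      using toggle_props(1)[OF disjI1[OF f], of "Suc i" "Suc j'"] Suc Suc.prems by simp
    have p: "gcd (f (Suc (Suc i)) (Suc j')) (f (Suc i) (Suc (Suc j'))) *
       lcm (f (Suc i) (Suc (Suc j'))) (f (Suc (Suc i)) (Suc j')) = f (Suc i) (Suc (Suc j')) * f (Suc (Suc i)) (Suc j')"
      by (metis gcd.commute prod_gcd_lcm_nat)
    have "diag_prod (inserted a b (f, t)) (Suc i) j * diag_prod f (Suc i) j *
        lcm (f (Suc i) (Suc j)) (f (Suc (Suc i)) j)
      = (toggled f (Suc i) (Suc j') * f (Suc i) (Suc j')) * (diag_prod (inserted a b (f, t)) i j' * diag_prod f i j')
        * lcm (f (Suc i) (Suc (Suc j'))) (f (Suc (Suc i)) (Suc j'))"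
      unfolding Suc using v by (simp add: mult_ac)
    also have "\<dots> = (diag_prod (inserted a b (f, t)) i j' * diag_prod f i j' * lcm (f i (Suc j')) (f (Suc i) j'))
       * (gcd (f (Suc (Suc i)) (Suc j')) (f (Suc i) (Suc (Suc j'))) *
       lcm (f (Suc i) (Suc (Suc j'))) (f (Suc (Suc i)) (Suc j')))"
      unfolding t by (simp only: mult_ac)
    also have "\<dots> = diag_prod f (Suc i) (Suc j) * diag_prod f (Suc (Suc i)) j"
      unfolding IH p Suc by (simp add: mult_ac)
    finally show ?thesis .
  qed
qed

text \<open>This recursion has the shape of \<open>rect_prod_corner\<close>, with \<open>t\<close>
  in the place of the new entry.\<close>

lemma diag_prod_inserted_corner:
  assumes f: "f \<in> dvd_fillings S"
  shows "diag_prod (inserted a b (f, t)) (Suc a) (Suc b) * diag_prod f a b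
    = t * diag_prod f a (Suc b) * diag_prod f (Suc a) b"
proof -
  have "inserted a b (f, t) (Suc a) (Suc b) = t * lcm (f a (Suc b)) (f (Suc a) b)"
    unfolding inserted_def toggle_diag_def by auto
  hence "diag_prod (inserted a b (f, t)) (Suc a) (Suc b) * diag_prod f a b
    = t * (diag_prod (inserted a b (f, t)) a b * diag_prod f a b * lcm (f a (Suc b)) (f (Suc a) b))"
    by (simp add: mult_ac)
  also have "\<dots> = t * (diag_prod f a (Suc b) * diag_prod f (Suc a) b)"
    using diag_prod_inserted_below[OF f, of a b t] by simp
  finally show ?thesis by (simp add: mult_ac)
qed

lemma diag_prod_inserted_off:
  "i + b \<noteq> j + a \<Longrightarrow> diag_prod (inserted a b (f, t)) i j = diag_prod f i j"
proof (induction f i j rule: diag_prod.induct)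
  case (1 f i j)
  thus ?case unfolding inserted_def toggle_diag_def by auto
qed auto

text \<open>The corner is the only end on its own diagonal. Any other end lies on a diagonal that is
  not toggled, was an end already before the corner was added, and has a rectangle that avoids the
  corner.\<close>

lemma ends_insert:
  assumes "(i, j) \<in> insert (Suc a, Suc b) S \<or> i = 0 \<or> j = 0"
    "(Suc i, Suc j) \<notin> insert (Suc a, Suc b) S" "i \<noteq> Suc a \<or> j \<noteq> Suc b"
  shows "(i, j) \<in> S \<or> i = 0 \<or> j = 0" "(Suc i, Suc j) \<notin> S" "i + b \<noteq> j + a" "i < Suc a \<or> j < Suc b"
proof -
  show 1: "(i, j) \<in> S \<or> i = 0 \<or> j = 0" "(Suc i, Suc j) \<notin> S" using assms by auto
  show 2: "i < Suc a \<or> j < Suc b" using 1 not_beyond_corner[of i j] by auto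
  show "i + b \<noteq> j + a"
  proof
    assume e: "i + b = j + a"
    hence "Suc i \<le> Suc a" "Suc j \<le> Suc b" using 2 by auto
    hence "(Suc i, Suc j) \<in> insert (Suc a, Suc b) S" using below_corner[of "Suc i" "Suc j"] by auto
    thus False using assms by auto
  qed
qed

end

section \<open>The trace bijection, built up corner by corner\<close>

lemma rect_prod_corner:
  "rect_prod g (Suc a) (Suc b) * rect_prod g a b = g (Suc a) (Suc b) * rect_prod g a (Suc b) * rect_prod g (Suc a) b"
  unfolding rect_prod_def by (simp add: prod.distrib mult_ac)

lemma rect_prod_cong:
  "(\<And>i' j'. i' \<le> i \<Longrightarrow> j' \<le> j \<Longrightarrow> g i' j' = h i' j') \<Longrightarrow> rect_prod g i j = rect_prod h i j"
  unfolding rect_prod_def by (intro prod.cong) auto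

text \<open>The condition on \<open>(i, j)\<close> says that it is the last cell of its diagonal, possibly on the border.
  The diagonal products are what makes the induction on the diagram close up: adding a corner changes
  both sides by inclusion-exclusion for rectangles.\<close>

definition trace_bij :: "(nat \<times> nat) set \<Rightarrow> ((nat \<Rightarrow> nat \<Rightarrow> nat) \<Rightarrow> (nat \<Rightarrow> nat \<Rightarrow> nat)) \<Rightarrow> bool" where
  "trace_bij S \<Phi> \<longleftrightarrow> bij_betw \<Phi> (fillings S) (dvd_fillings S) \<and>
     (\<forall>g\<in>fillings S. \<forall>i j. ((i, j) \<in> S \<or> i = 0 \<or> j = 0) \<and> (Suc i, Suc j) \<notin> S \<longrightarrow>
        diag_prod (\<Phi> g) i j = rect_prod g i j)"

lemma trace_bij_empty: "trace_bij {} id"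
proof -
  have "fillings {} = {\<lambda>i j. 1}" "dvd_fillings {} = {\<lambda>i j. 1}"
    unfolding dvd_fillings_def fillings_def by (auto simp: fun_eq_iff)
  moreover have "diag_prod (\<lambda>i j. 1) i j = 1" for i j
    by (induction "\<lambda>(i::nat) (j::nat). 1::nat" i j rule: diag_prod.induct) auto
  ultimately show ?thesis unfolding trace_bij_def rect_prod_def by auto
qed

lemma (in corner) trace_bij_insert:
  assumes \<Phi>: "trace_bij S \<Phi>"
  shows "\<exists>\<Phi>'. trace_bij (insert (Suc a, Suc b) S) \<Phi>'"
proof -
  let ?T = "insert (Suc a, Suc b) S"
  define split where "split g = (\<lambda>i j. if i = Suc a \<and> j = Suc b then 1 else g i j, g (Suc a) (Suc b))"
    for g :: "nat \<Rightarrow> nat \<Rightarrow> nat"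
  define join where "join p = (\<lambda>i j. if i = Suc a \<and> j = Suc b then snd p else fst p i j)"
    for p :: "(nat \<Rightarrow> nat \<Rightarrow> nat) \<times> nat"
  define \<Phi>' where "\<Phi>' = inserted a b \<circ> (map_prod \<Phi> id \<circ> split)"
  have split: "bij_betw split (fillings ?T) (fillings S \<times> {0<..})"
  proof (rule bij_betw_byWitness[where f' = join])
    show "\<forall>g\<in>fillings ?T. join (split g) = g" by (auto simp: join_def split_def fun_eq_iff)
    show "\<forall>p\<in>fillings S \<times> {0<..}. split (join p) = p"
      using new by (auto simp: join_def split_def fun_eq_iff fillings_def)
    show "split ` fillings ?T \<subseteq> fillings S \<times> {0<..}"
      using new by (auto simp: split_def fillings_def)
    show "join ` (fillings S \<times> {0<..}) \<subseteq> fillings ?T"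
      using new by (auto simp: join_def fillings_def)
  qed
  have b: "bij_betw \<Phi> (fillings S) (dvd_fillings S)" using \<Phi> unfolding trace_bij_def by blast
  have "bij_betw (map_prod \<Phi> id) (fillings S \<times> {0<..}) (dvd_fillings S \<times> ({0<..} :: nat set))"
    using bij_betw_map_prod[OF b bij_betw_id] .
  from bij_betw_trans[OF bij_betw_trans[OF split this] bij_betw_inserted]
  have bij: "bij_betw \<Phi>' (fillings ?T) (dvd_fillings ?T)" unfolding \<Phi>'_def .
  have "diag_prod (\<Phi>' g) i j = rect_prod g i j"
    if g: "g \<in> fillings ?T" and ij: "(i, j) \<in> ?T \<or> i = 0 \<or> j = 0" "(Suc i, Suc j) \<notin> ?T" for g i j
  proof -
    let ?h = "fst (split g)"
    have h: "?h \<in> fillings S" using bij_betwE[OF split] g by (metis mem_Times_iff)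
    hence fh: "\<Phi> ?h \<in> dvd_fillings S" using bij_betwE[OF b] by blast
    have e: "\<Phi>' g = inserted a b (\<Phi> ?h, g (Suc a) (Suc b))" unfolding \<Phi>'_def split_def by simp
    have tr: "(i, j) \<in> S \<or> i = 0 \<or> j = 0 \<Longrightarrow> (Suc i, Suc j) \<notin> S \<Longrightarrow> diag_prod (\<Phi> ?h) i j = rect_prod ?h i j" for i j
      using \<Phi> h unfolding trace_bij_def by blast
    have rh: "i < Suc a \<or> j < Suc b \<Longrightarrow> rect_prod ?h i j = rect_prod g i j" for i j
      by (intro rect_prod_cong) (auto simp: split_def)
    show ?thesis
    proof (cases "i = Suc a \<and> j = Suc b")
      case True
      \<comment> \<open>The cells above, left of and diagonally before the corner were ends of their
        diagonals in \<open>S\<close>, or lie on the border; so the hypothesis on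
        \<open>\<Phi>\<close> gives all three traces in the recursion.\<close>
      have S1: "(Suc a, Suc (Suc b)) \<notin> S" "(Suc (Suc a), Suc b) \<notin> S"
        using not_beyond_corner[of "Suc a" "Suc (Suc b)"] not_beyond_corner[of "Suc (Suc a)" "Suc b"] by auto
      have m: "(a, Suc b) \<in> S \<or> a = 0" "(Suc a, b) \<in> S \<or> b = 0" "(a, b) \<in> S \<or> a = 0 \<or> b = 0"
        using below_corner[of a "Suc b"] below_corner[of "Suc a" b] below_corner[of a b]
        by (cases a; cases b; auto)+
      have t1: "diag_prod (\<Phi> ?h) a (Suc b) = rect_prod g a (Suc b)"
        using tr[of a "Suc b"] S1(2) S1(1) new m(1) rh[of a "Suc b"] by auto
      have t2: "diag_prod (\<Phi> ?h) (Suc a) b = rect_prod g (Suc a) b"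
        using tr[of "Suc a" b] S1 new m(2) rh[of "Suc a" b] by auto
      have t3: "diag_prod (\<Phi> ?h) a b = rect_prod g a b"
        using tr[of a b] new m(3) rh[of a b] by auto
      note t = t1 t2 t3
      \<comment> \<open>Both recursions carry the factor \<open>rect_prod g a b\<close>, which is
        cancelled.\<close>
      have "0 < rect_prod g a b" using g unfolding rect_prod_def fillings_def by (auto intro!: prod_pos)
      moreover have "diag_prod (\<Phi>' g) (Suc a) (Suc b) * rect_prod g a b = rect_prod g (Suc a) (Suc b) * rect_prod g a b"
        using diag_prod_inserted_corner[OF fh, of "g (Suc a) (Suc b)"] rect_prod_corner[of g a b]
        unfolding e t by simp
      ultimately show ?thesis using True by simp
    next
      case False
      hence nc: "i \<noteq> Suc a \<or> j \<noteq> Suc b" by blast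
      note en = ends_insert[OF ij]
      show ?thesis unfolding e diag_prod_inserted_off[OF en(3)[OF nc]] tr[OF en(1,2)[OF nc]] by (rule rh[OF en(4)[OF nc]])
    qed
  qed
  thus ?thesis using bij unfolding trace_bij_def by blast
qed

lemma trace_bij_rectangle: "\<exists>\<Phi>. trace_bij ({1..R} \<times> {1..C}) \<Phi>"
proof (induction R)
  case 0
  show ?case using trace_bij_empty by auto
next
  case (Suc R)
  \<comment> \<open>The new row is filled from left to right, so that every intermediate shape is a
    diagram.\<close>
  have "\<exists>\<Phi>. trace_bij ({1..R} \<times> {1..C} \<union> {Suc R} \<times> {1..c}) \<Phi>" if "c \<le> C" for c
    using that
  proof (induction c)
    case 0
    show ?case using Suc.IH by simp
  next
    case (Suc c)
    let ?S = "{1..R} \<times> {1..C} \<union> {Suc R} \<times> {1..c}"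
    have e: "insert (Suc R, Suc c) ?S = {1..R} \<times> {1..C} \<union> {Suc R} \<times> {1..Suc c}" by auto
    interpret corner ?S R c
    proof
      show "diagram ?S" using Suc.prems unfolding diagram_def by auto
      show "diagram (insert (Suc R, Suc c) ?S)" unfolding e using Suc.prems unfolding diagram_def by auto
      show "(Suc R, Suc c) \<notin> ?S" by auto
    qed
    show ?case using Suc trace_bij_insert unfolding e by fastforce
  qed
  from this[OF order_refl] show ?case
    by (simp add: atLeastAtMostSuc_conv Sigma_Un_distrib1[symmetric] Un_commute)
qed

text \<open>Each cell of the rectangle lies on exactly one diagonal, and that diagonal ends in the
  last row or, above it, in the last column.\<close>

lemma prod_diag_prod:
  "(\<Prod>j\<in>{1..C}. diag_prod f R j) * (\<Prod>i\<in>{1..<R}. diag_prod f i C) = (\<Prod>i\<in>{1..R}. \<Prod>j\<in>{1..C}. f i j)"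
proof (induction R)
  case 0
  show ?case by simp
next
  case (Suc R)
  have s: "(\<Prod>j\<in>{1..C}. diag_prod f (Suc R) j) = (\<Prod>j\<in>{1..C}. f (Suc R) j) * (\<Prod>j<C. diag_prod f R j)"
    for C by (induction C) (simp_all add: mult_ac)
  have t: "(\<Prod>j<C. diag_prod f R j) * diag_prod f R C = (\<Prod>j\<in>{1..C}. diag_prod f R j)"
    for C by (induction C) (simp_all)
  have u: "(\<Prod>i\<in>{1..<Suc R}. diag_prod f i C) = (\<Prod>i\<in>{1..<R}. diag_prod f i C) * diag_prod f R C"
    by (cases R) auto
  have "(\<Prod>j\<in>{1..C}. diag_prod f (Suc R) j) * (\<Prod>i\<in>{1..<Suc R}. diag_prod f i C)
    = (\<Prod>j\<in>{1..C}. f (Suc R) j) * (((\<Prod>j<C. diag_prod f R j) * diag_prod f R C) * (\<Prod>i\<in>{1..<R}. diag_prod f i C))"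
    unfolding s u by (simp only: mult_ac)
  also have "\<dots> = (\<Prod>i\<in>{1..Suc R}. \<Prod>j\<in>{1..C}. f i j)" unfolding t Suc.IH by simp
  finally show ?case .
qed

lemma prod_prefix_prod:
  fixes h :: "nat \<Rightarrow> nat"
  shows "(\<Prod>j\<in>{1..C}. \<Prod>j'\<in>{1..j}. h j') = (\<Prod>j\<in>{1..C}. h j ^ (Suc C - j))"
proof (induction C)
  case 0
  show ?case by simp
next
  case (Suc C)
  have "(\<Prod>j\<in>{1..Suc C}. h j ^ (Suc (Suc C) - j)) = (\<Prod>j\<in>{1..C}. h j ^ (Suc C - j) * h j) * h (Suc C)"
  proof -
    have "h j ^ (Suc (Suc C) - j) = h j ^ (Suc C - j) * h j" if "j \<in> {1..C}" for j
      using that by (auto simp: Suc_diff_le)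
    thus ?thesis by simp
  qed
  hence "(\<Prod>j\<in>{1..Suc C}. h j ^ (Suc (Suc C) - j)) = (\<Prod>j\<in>{1..C}. h j ^ (Suc C - j)) * (\<Prod>j\<in>{1..Suc C}. h j)"
    by (simp only: prod.distrib) simp
  also have "\<dots> = (\<Prod>j\<in>{1..Suc C}. \<Prod>j'\<in>{1..j}. h j')" using Suc by simp
  finally show ?case ..
qed

lemma prod_prefix_prod_less:
  fixes h :: "nat \<Rightarrow> nat"
  shows "(\<Prod>i\<in>{1..<R}. \<Prod>i'\<in>{1..i}. h i') = (\<Prod>i\<in>{1..R}. h i ^ (R - i))"
  using prod_prefix_prod[of h "R - 1"] by (cases R) (simp_all add: atLeastLessThanSuc_atLeastAtMost)

text \<open>The cell \<open>(i, j)\<close> belongs to \<open>C - j + 1\<close> of the rectangles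
  that end in row \<open>R\<close> and to \<open>R - i\<close> of those that end in column
  \<open>C\<close> above row \<open>R\<close>. The total is its hook length in the
  rectangle.\<close>

lemma prod_rect_prod:
  "(\<Prod>j\<in>{1..C}. rect_prod g R j) * (\<Prod>i\<in>{1..<R}. rect_prod g i C)
    = (\<Prod>i\<in>{1..R}. \<Prod>j\<in>{1..C}. g i j ^ ((R - i) + (C - j) + 1))"
proof -
  have "(\<Prod>j\<in>{1..C}. rect_prod g R j) = (\<Prod>i\<in>{1..R}. \<Prod>j\<in>{1..C}. \<Prod>j'\<in>{1..j}. g i j')"
    unfolding rect_prod_def by (rule prod.swap)
  moreover have "(\<Prod>i\<in>{1..<R}. rect_prod g i C) = (\<Prod>i\<in>{1..R}. \<Prod>j\<in>{1..C}. g i j ^ (R - i))"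
  proof -
    have "(\<Prod>i\<in>{1..<R}. rect_prod g i C) = (\<Prod>i\<in>{1..<R}. \<Prod>j\<in>{1..C}. \<Prod>i'\<in>{1..i}. g i' j)"
      unfolding rect_prod_def by (intro prod.cong refl prod.swap)
    also have "\<dots> = (\<Prod>j\<in>{1..C}. \<Prod>i\<in>{1..<R}. \<Prod>i'\<in>{1..i}. g i' j)" by (rule prod.swap)
    also have "\<dots> = (\<Prod>i\<in>{1..R}. \<Prod>j\<in>{1..C}. g i j ^ (R - i))"
      unfolding prod_prefix_prod_less by (rule prod.swap)
    finally show ?thesis .
  qed
  moreover have "g i j ^ (Suc C - j) * g i j ^ (R - i) = g i j ^ ((R - i) + (C - j) + 1)"
    if "j \<in> {1..C}" for i j
    using that by (simp add: power_add[symmetric] Suc_diff_le add_ac)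
  ultimately show ?thesis unfolding prod_prefix_prod by (simp add: prod.distrib[symmetric] del: power_Suc)
qed

section \<open>From fillings of a rectangle to decreasing arrays\<close>

text \<open>Arrays are indexed from 0 and decrease under divisibility, fillings are indexed from 1 and increase.\<close>

definition arrays :: "nat \<Rightarrow> nat \<Rightarrow> (nat \<Rightarrow> nat \<Rightarrow> nat) set" where
  "arrays R C = {D. \<forall>i j. 0 < D i j \<and> (R \<le> i \<or> C \<le> j \<longrightarrow> D i j = 1)}"

definition plane_arrays :: "nat \<Rightarrow> nat \<Rightarrow> (nat \<Rightarrow> nat \<Rightarrow> nat) set" where
  "plane_arrays R C = {D \<in> arrays R C. \<forall>i j. D (Suc i) j dvd D i j \<and> D i (Suc j) dvd D i j}"

definition reversal :: "nat \<Rightarrow> nat \<Rightarrow> (nat \<Rightarrow> nat \<Rightarrow> nat) \<Rightarrow> nat \<Rightarrow> nat \<Rightarrow> nat" where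
  "reversal R C f i j = (if i < R \<and> j < C then f (R - i) (C - j) else 1)"

definition unreversal :: "nat \<Rightarrow> nat \<Rightarrow> (nat \<Rightarrow> nat \<Rightarrow> nat) \<Rightarrow> nat \<Rightarrow> nat \<Rightarrow> nat" where
  "unreversal R C D i j = (if (i, j) \<in> {1..R} \<times> {1..C} then D (R - i) (C - j) else 1)"

lemma unreversal_reversal: "f \<in> fillings ({1..R} \<times> {1..C}) \<Longrightarrow> unreversal R C (reversal R C f) = f"
  unfolding fillings_def unreversal_def reversal_def by (auto simp: fun_eq_iff)

lemma reversal_unreversal: "D \<in> arrays R C \<Longrightarrow> reversal R C (unreversal R C D) = D"
  unfolding arrays_def unreversal_def reversal_def by (auto simp: fun_eq_iff)

lemma bij_betw_reversal: "bij_betw (reversal R C) (fillings ({1..R} \<times> {1..C})) (arrays R C)"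
proof (rule bij_betw_byWitness[where f' = "unreversal R C"])
  show "reversal R C ` fillings ({1..R} \<times> {1..C}) \<subseteq> arrays R C"
    unfolding fillings_def arrays_def reversal_def by auto
  show "unreversal R C ` arrays R C \<subseteq> fillings ({1..R} \<times> {1..C})"
    unfolding fillings_def arrays_def unreversal_def by auto
qed (auto simp: unreversal_reversal reversal_unreversal)

lemma bij_betw_reversal_dvd: "bij_betw (reversal R C) (dvd_fillings ({1..R} \<times> {1..C})) (plane_arrays R C)"
proof (rule bij_betw_byWitness[where f' = "unreversal R C"])
  show "reversal R C ` dvd_fillings ({1..R} \<times> {1..C}) \<subseteq> plane_arrays R C"
  proof (rule image_subsetI)
    fix f assume f: "f \<in> dvd_fillings ({1..R} \<times> {1..C})"
    have 1: "f i j dvd f (Suc i) j" if "i < R" "j \<in> {1..C}" for i j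
      using f that unfolding dvd_fillings_def by auto
    have 2: "f i j dvd f i (Suc j)" if "j < C" "i \<in> {1..R}" for i j
      using f that unfolding dvd_fillings_def by auto
    have "reversal R C f (Suc i) j dvd reversal R C f i j" for i j
    proof (cases "Suc i < R \<and> j < C")
      case True
      hence "R - i = Suc (R - Suc i)" "R - Suc i < R" "C - j \<in> {1..C}" by auto
      thus ?thesis using 1[of "R - Suc i" "C - j"] True unfolding reversal_def by simp
    qed (auto simp: reversal_def)
    moreover have "reversal R C f i (Suc j) dvd reversal R C f i j" for i j
    proof (cases "i < R \<and> Suc j < C")
      case True
      hence "C - j = Suc (C - Suc j)" "C - Suc j < C" "R - i \<in> {1..R}" by auto
      thus ?thesis using 2[of "C - Suc j" "R - i"] True unfolding reversal_def by simp
    qed (auto simp: reversal_def)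
    moreover have "reversal R C f \<in> arrays R C"
      using f bij_betwE[OF bij_betw_reversal] unfolding dvd_fillings_def by blast
    ultimately show "reversal R C f \<in> plane_arrays R C" unfolding plane_arrays_def by blast
  qed
  show "unreversal R C ` plane_arrays R C \<subseteq> dvd_fillings ({1..R} \<times> {1..C})"
  proof (rule image_subsetI)
    fix D assume D: "D \<in> plane_arrays R C"
    have f: "unreversal R C D \<in> fillings ({1..R} \<times> {1..C})"
      using D unfolding plane_arrays_def arrays_def fillings_def unreversal_def by auto
    have 1: "D (Suc i) j dvd D i j" "D i (Suc j) dvd D i j" for i j
      using D unfolding plane_arrays_def by auto
    have "unreversal R C D i j dvd unreversal R C D (Suc i) j" if "(Suc i, j) \<in> {1..R} \<times> {1..C}" for i j
    proof (cases "i = 0")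
      case False
      have "R - i = Suc (R - Suc i)" using that by auto
      thus ?thesis using that False 1(1)[of "R - Suc i" "C - j"] unfolding unreversal_def by simp
    qed (simp add: unreversal_def)
    moreover have "unreversal R C D i j dvd unreversal R C D i (Suc j)" if "(i, Suc j) \<in> {1..R} \<times> {1..C}" for i j
    proof (cases "j = 0")
      case False
      have "C - j = Suc (C - Suc j)" using that by auto
      thus ?thesis using that False 1(2)[of "R - i" "C - Suc j"] unfolding unreversal_def by simp
    qed (simp add: unreversal_def)
    ultimately show "unreversal R C D \<in> dvd_fillings ({1..R} \<times> {1..C})"
      using f unfolding dvd_fillings_def by blast
  qed
qed (auto simp: unreversal_reversal reversal_unreversal dvd_fillings_def plane_arrays_def)

lemma prod_reversal:
  fixes e :: "nat \<Rightarrow> nat \<Rightarrow> nat"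
  shows "(\<Prod>i<R. \<Prod>j<C. reversal R C f i j ^ e i j) = (\<Prod>i\<in>{1..R}. \<Prod>j\<in>{1..C}. f i j ^ e (R - i) (C - j))"
proof -
  have b: "bij_betw (\<lambda>i. R - i) {1..R} {..<R}" for R :: nat
    by (rule bij_betw_byWitness[where f' = "\<lambda>i. R - i"]) auto
  have "(\<Prod>i<R. \<Prod>j<C. reversal R C f i j ^ e i j) =
      (\<Prod>i\<in>{1..R}. \<Prod>j\<in>{1..C}. reversal R C f (R - i) (C - j) ^ e (R - i) (C - j))"
    by (rule trans[OF prod.reindex_bij_betw[OF b[of R], symmetric]
          prod.cong[OF refl prod.reindex_bij_betw[OF b[of C], symmetric]]])
  also have "\<dots> = (\<Prod>i\<in>{1..R}. \<Prod>j\<in>{1..C}. f i j ^ e (R - i) (C - j))"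
    by (intro prod.cong refl arg_cong2[where f = power]) (auto simp: reversal_def)
  finally show ?thesis .
qed

text \<open>The trace identity is used at the ends in the last row and column: for the divisibility
  array these diagonals exhaust the rectangle, for the free array each cell receives its hook length
  as exponent. Reversal moves the origin to the opposite corner, where that hook length reads
  \<open>i + j + 1\<close>.\<close>

theorem card_plane_arrays:
  "card {D \<in> plane_arrays R C. (\<Prod>i<R. \<Prod>j<C. D i j) = n} =
   card {g \<in> arrays R C. (\<Prod>i<R. \<Prod>j<C. g i j ^ (i + j + 1)) = n}"
proof -
  let ?S = "{1..R} \<times> {1..C}"
  obtain \<Phi> where \<Phi>: "trace_bij ?S \<Phi>" using trace_bij_rectangle by blast
  hence b: "bij_betw \<Phi> (fillings ?S) (dvd_fillings ?S)" unfolding trace_bij_def by blast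
  have p: "(\<Prod>i\<in>{1..R}. \<Prod>j\<in>{1..C}. \<Phi> g i j) = (\<Prod>i\<in>{1..R}. \<Prod>j\<in>{1..C}. g i j ^ ((R - i) + (C - j) + 1))"
    if g: "g \<in> fillings ?S" for g
  proof -
    have tr: "((i, j) \<in> ?S \<or> i = 0 \<or> j = 0) \<Longrightarrow> (Suc i, Suc j) \<notin> ?S \<Longrightarrow> diag_prod (\<Phi> g) i j = rect_prod g i j" for i j
      using \<Phi> g unfolding trace_bij_def by blast
    have "diag_prod (\<Phi> g) R j = rect_prod g R j" if "j \<in> {1..C}" for j
      using tr[of R j] that by (cases R) auto
    moreover have "diag_prod (\<Phi> g) i C = rect_prod g i C" if "i \<in> {1..<R}" for i
      using tr[of i C] that by (cases C) auto
    ultimately show ?thesis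
      unfolding prod_rect_prod[symmetric] prod_diag_prod[of "\<Phi> g" R C, symmetric] by simp
  qed
  have r1: "(\<Prod>i<R. \<Prod>j<C. reversal R C f i j) = (\<Prod>i\<in>{1..R}. \<Prod>j\<in>{1..C}. f i j)" for f
    using prod_reversal[of R C f "\<lambda>_ _. 1"] by simp
  have card_eq: "card {y \<in> B. q y} = card {x \<in> A. q (h x)}" if h: "bij_betw h A B"
    for A :: "(nat \<Rightarrow> nat \<Rightarrow> nat) set" and B :: "(nat \<Rightarrow> nat \<Rightarrow> nat) set" and q h
  proof -
    have "{y \<in> B. q y} = h ` {x \<in> A. q (h x)}" using h unfolding bij_betw_def by auto
    moreover have "inj_on h {x \<in> A. q (h x)}" using h unfolding bij_betw_def by (auto intro: inj_on_subset)
    ultimately show ?thesis by (simp add: card_image)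
  qed
  have "card {D \<in> plane_arrays R C. (\<Prod>i<R. \<Prod>j<C. D i j) = n}
    = card {f \<in> dvd_fillings ?S. (\<Prod>i\<in>{1..R}. \<Prod>j\<in>{1..C}. f i j) = n}"
    using card_eq[OF bij_betw_reversal_dvd[of R C], where q="\<lambda>D. (\<Prod>i<R. \<Prod>j<C. D i j) = n"] unfolding r1 .
  also have "\<dots> = card {g \<in> fillings ?S. (\<Prod>i\<in>{1..R}. \<Prod>j\<in>{1..C}. \<Phi> g i j) = n}"
    by (rule card_eq[OF b])
  also have "\<dots> = card {g \<in> fillings ?S. (\<Prod>i\<in>{1..R}. \<Prod>j\<in>{1..C}. g i j ^ ((R - i) + (C - j) + 1)) = n}"
    using p by (intro arg_cong[where f = card] Collect_cong) auto
  also have "\<dots> = card {g \<in> arrays R C. (\<Prod>i<R. \<Prod>j<C. g i j ^ (i + j + 1)) = n}"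
    using card_eq[OF bij_betw_reversal[of R C], where q="\<lambda>g. (\<Prod>i<R. \<Prod>j<C. g i j ^ (i + j + 1)) = n"]
    unfolding prod_reversal by simp
  finally show ?thesis .
qed

section \<open>Finite Abelian groups\<close>

lemma (in comm_group) ord_mult_coprime:
  assumes x: "x \<in> carrier G" and y: "y \<in> carrier G" and c: "coprime (ord x) (ord y)"
  shows "ord (x \<otimes> y) = ord x * ord y"
proof (rule dvd_antisym)
  show "ord (x \<otimes> y) dvd ord x * ord y" by (rule abelian_ord_mul_divides[OF x y])
  have *: "ord x dvd ord (x \<otimes> y)"
    if x: "x \<in> carrier G" and y: "y \<in> carrier G" and c: "coprime (ord x) (ord y)" for x y
  proof -
    let ?n = "ord (x \<otimes> y)"
    have "\<one> = ((x \<otimes> y) [^] ?n) [^] ord y" using x y by simp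
    also have "\<dots> = x [^] (?n * ord y) \<otimes> y [^] (?n * ord y)"
      using x y by (simp add: nat_pow_distrib nat_pow_pow del: pow_ord_eq_1)
    also have "y [^] (?n * ord y) = \<one>" using y by (simp add: pow_eq_id)
    finally have "x [^] (?n * ord y) = \<one>" using x by simp
    hence "ord x dvd ?n * ord y" using x by (simp add: pow_eq_id)
    thus ?thesis using c by (simp add: coprime_dvd_mult_left_iff)
  qed
  have "ord y dvd ord (x \<otimes> y)" using *[OF y x] c x y by (simp add: m_comm coprime_commute)
  thus "ord x * ord y dvd ord (x \<otimes> y)" using *[OF x y c] c by (simp add: divides_mult)
qed

text \<open>An element \<open>x\<close> of maximal order works. If a prime \<open>p\<close> had a
  higher power in \<open>ord y\<close> than in \<open>ord x\<close>, then the \<open>p\<close>-part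
  of \<open>y\<close> times the part of \<open>x\<close> prime to \<open>p\<close> would have larger
  order.\<close>

lemma (in comm_group) exists_ord_eq_exponent:
  assumes fin: "finite (carrier G)"
  obtains x where "x \<in> carrier G" "\<And>y. y \<in> carrier G \<Longrightarrow> ord y dvd ord x"
proof -
  have "\<exists>x\<in>carrier G. \<forall>y\<in>carrier G. ord y \<le> ord x"
  proof -
    have ne: "ord ` carrier G \<noteq> {}" and f: "finite (ord ` carrier G)" using fin by auto
    from Max_in[OF f ne] obtain x where "x \<in> carrier G" "Max (ord ` carrier G) = ord x" by auto
    thus ?thesis using f by (metis Max_ge imageI)
  qed
  then obtain x where x: "x \<in> carrier G" and max: "\<And>y. y \<in> carrier G \<Longrightarrow> ord y \<le> ord x" by blast
  have x0: "0 < ord x" using ord_ge_1[OF fin x] by simp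
  have "ord y dvd ord x" if y: "y \<in> carrier G" for y
  proof (rule multiplicity_le_imp_dvd)
    have y0: "0 < ord y" using ord_ge_1[OF fin y] by simp
    thus "ord y \<noteq> 0" by simp
    fix p :: nat assume p: "prime p"
    show "multiplicity p (ord y) \<le> multiplicity p (ord x)"
    proof (rule ccontr)
      assume less: "\<not> ?thesis"
      define a where "a = multiplicity p (ord x)"
      define b where "b = multiplicity p (ord y)"
      obtain u where u: "ord x = p ^ a * u" "\<not> p dvd u"
        using multiplicity_decompose'[of "ord x" p] x0 p unfolding a_def
        by (metis not_prime_unit less_numeral_extra(3))
      obtain v where v: "ord y = p ^ b * v"
        using multiplicity_dvd[of p "ord y"] unfolding b_def by blast
      have p0: "0 < p" using p prime_gt_0_nat by blast
      have v0: "v \<noteq> 0" using v y0 by (cases v) auto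
      have 1: "ord (x [^] (p ^ a)) = u" using ord_pow[OF x, of "p ^ a"] u p0 by simp
      have 2: "ord (y [^] v) = p ^ b" using ord_pow[OF y, of v] v v0 by simp
      have "coprime u (p ^ b)" using u(2) p by (metis coprime_commute coprime_power_right_iff prime_imp_coprime)
      hence "ord (x [^] (p ^ a) \<otimes> y [^] v) = u * p ^ b"
        using ord_mult_coprime[of "x [^] (p ^ a)" "y [^] v"] x y 1 2 by simp
      moreover have "ord (x [^] (p ^ a) \<otimes> y [^] v) \<le> ord x" using max x y by simp
      ultimately have "p ^ b * u \<le> p ^ a * u" using u by (simp add: mult.commute)
      moreover have "0 < u" using u x0 by (cases u) auto
      ultimately have "p ^ b \<le> p ^ a" by simp
      hence "b \<le> a" using p prime_gt_1_nat by (metis power_le_imp_le_exp)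
      thus False using less unfolding a_def b_def by simp
    qed
  qed
  thus ?thesis using that x by blast
qed

lemma (in comm_group) subgroup_powers_times:
  assumes K: "subgroup K G" and z: "z \<in> carrier G"
  shows "subgroup {z [^] (t::int) \<otimes> k |t k. k \<in> K} G" (is "subgroup ?H G")
proof (rule subgroupI)
  have Kc: "k \<in> K \<Longrightarrow> k \<in> carrier G" for k using subgroup.mem_carrier[OF K] .
  show "?H \<subseteq> carrier G" using z Kc by auto
  show "?H \<noteq> {}" using subgroup.one_closed[OF K] by blast
  show "inv h \<in> ?H" if "h \<in> ?H" for h
  proof -
    from that obtain t k where "h = z [^] (t::int) \<otimes> k" "k \<in> K" by blast
    hence "inv h = z [^] (- t) \<otimes> inv k" "inv k \<in> K"
      using z Kc K by (simp_all add: inv_mult int_pow_neg subgroup.m_inv_closed)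
    thus ?thesis by blast
  qed
  show "h \<otimes> h' \<in> ?H" if hh: "h \<in> ?H" "h' \<in> ?H" for h h'
  proof -
    from hh obtain t k t' k' where h: "h = z [^] (t::int) \<otimes> k" "k \<in> K" and h': "h' = z [^] (t'::int) \<otimes> k'" "k' \<in> K"
      by blast
    have "h \<otimes> h' = z [^] (t + t') \<otimes> (k \<otimes> k')"
      unfolding h(1) h'(1) using z Kc[OF h(2)] Kc[OF h'(2)] by (simp add: int_pow_mult m_ac)
    moreover have "k \<otimes> k' \<in> K" using subgroup.m_closed[OF K] h h' by blast
    ultimately show ?thesis by blast
  qed
qed

lemma (in group) coprime_pow_mem_subgroup:
  assumes H: "subgroup H G" and y: "y \<in> carrier G" and c: "coprime s t"
    and "y [^] (s::int) \<in> H" "y [^] (t::int) \<in> H"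
  shows "y \<in> H"
proof -
  obtain u v where uv: "u * s + v * t = 1"
    using bezout_int[of s t] c by (metis coprime_imp_gcd_eq_1)
  have "y = y [^] (s * u + t * v)" using uv y by (simp add: mult.commute)
  also have "\<dots> = (y [^] s) [^] u \<otimes> (y [^] t) [^] v" using y by (simp add: int_pow_mult int_pow_pow)
  also have "\<dots> \<in> H" using assms subgroup.m_closed[OF H] subgroup_int_pow_closed[OF H] by blast
  finally show ?thesis .
qed

text \<open>A subgroup maximal among those meeting the powers of \<open>x\<close> trivially is a complement.\<close>

lemma (in comm_group) cyclic_complement:
  assumes fin: "finite (carrier G)" and x: "x \<in> carrier G"
    and ex: "\<And>y. y \<in> carrier G \<Longrightarrow> ord y dvd ord x"
  obtains K where "subgroup K G" "\<And>t::int. x [^] t \<in> K \<Longrightarrow> x [^] t = \<one>"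
    "\<And>y. y \<in> carrier G \<Longrightarrow> \<exists>t::int. \<exists>k\<in>K. y = x [^] t \<otimes> k"
proof -
  define \<K> where "\<K> = {K. subgroup K G \<and> (\<forall>t::int. x [^] t \<in> K \<longrightarrow> x [^] t = \<one>)}"
  have "finite \<K>" using fin by (intro finite_subset[of \<K> "Pow (carrier G)"]) (auto simp: \<K>_def dest: subgroup.subset)
  moreover have "{\<one>} \<in> \<K>" unfolding \<K>_def using triv_subgroup by auto
  ultimately obtain K where "K \<in> \<K>" and max: "\<And>K'. K' \<in> \<K> \<Longrightarrow> K \<subseteq> K' \<Longrightarrow> K = K'"
    using finite_has_maximal[of \<K>] by auto
  hence K: "subgroup K G" and triv: "\<And>t::int. x [^] t \<in> K \<Longrightarrow> x [^] t = \<one>" unfolding \<K>_def by auto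
  have Kc: "k \<in> K \<Longrightarrow> k \<in> carrier G" for k using subgroup.mem_carrier[OF K] .
  define H where "H = {x [^] (t::int) \<otimes> k |t k. k \<in> K}"
  have H: "subgroup H G" unfolding H_def by (rule subgroup_powers_times[OF K x])
  have KH: "k \<in> K \<Longrightarrow> k \<in> H" for k
    unfolding H_def by (rule CollectI, rule exI[of _ 0], rule exI[of _ k]) (simp add: Kc)
  have xH: "x [^] (t::int) \<in> H" for t
    unfolding H_def using subgroup.one_closed[OF K] x by force
  have "y0 \<in> H" if y0: "y0 \<in> carrier G" for y0
  proof (rule ccontr)
    assume n: "y0 \<notin> H"
    \<comment> \<open>The least exponent that leads into \<open>H\<close>, divided by one of its
      primes \<open>p\<close>, yields an element \<open>y\<close> outside \<open>H\<close> whose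
      \<open>p\<close>-th power is inside.\<close>
    define m where "m = (LEAST m::nat. 0 < m \<and> y0 [^] m \<in> H)"
    have "0 < ord y0 \<and> y0 [^] ord y0 \<in> H"
      using ord_ge_1[OF fin y0] subgroup.one_closed[OF H] y0 by simp
    hence m: "0 < m \<and> y0 [^] m \<in> H" unfolding m_def by (rule LeastI)
    have "m \<noteq> 1" using m n y0 by auto
    then obtain p where p: "prime p" "p dvd m" using prime_factor_nat by blast
    then obtain m' where m': "m = m' * p" by (metis dvd_def mult.commute)
    have "m' < m" "0 < m'" using m' m p(1) prime_gt_1_nat by auto
    hence ny: "y0 [^] m' \<notin> H" using not_less_Least[of m'] unfolding m_def by blast
    define y where "y = y0 [^] m'"
    have y: "y \<in> carrier G" "y \<notin> H" and ypn: "y [^] p \<in> H"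
      unfolding y_def using y0 ny m m' by (simp_all add: nat_pow_pow)
    hence yp: "y [^] int p \<in> H" by (simp add: int_pow_int)
    define d where "d = ord x"
    have yd: "y [^] d = \<one>" unfolding d_def using ex[OF y(1)] y by (simp add: pow_eq_id)
    \<comment> \<open>Otherwise the powers of \<open>y\<close> with the coprime exponents
      \<open>p\<close> and \<open>d\<close> would both lie in \<open>H\<close>, and \<open>y\<close>
      with them.\<close>
    have "p dvd d"
    proof (rule ccontr)
      assume "\<not> p dvd d"
      hence "coprime (int p) (int d)" using p(1) by (simp add: prime_imp_coprime)
      moreover have "y [^] int d \<in> H" using yd subgroup.one_closed[OF H] by (simp add: int_pow_int)
      ultimately show False using coprime_pow_mem_subgroup[OF H y(1)] yp y(2) by blast
    qed
    then obtain q where q: "d = p * q" by blast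
    have q0: "q \<noteq> 0" using q ord_ge_1[OF fin x] unfolding d_def by (cases q) auto
    obtain a k where ak: "y [^] p = x [^] (a::int) \<otimes> k" "k \<in> K" using ypn unfolding H_def by blast
    \<comment> \<open>Raising to the power \<open>q = d div p\<close> annihilates \<open>y\<close>,
      so \<open>x [^] (a * q)\<close> lies in \<open>K\<close> and is trivial. Hence
      \<open>p\<close> divides \<open>a\<close>, which permits the correction of \<open>y\<close> by
      a power of \<open>x\<close>.\<close>
    have "\<one> = (y [^] p) [^] q" using yd q y by (simp add: nat_pow_pow)
    also have "\<dots> = (x [^] a) [^] int q \<otimes> k [^] q"
      unfolding ak using x Kc[OF ak(2)] by (simp add: nat_pow_distrib int_pow_int)
    finally have "x [^] (a * int q) \<otimes> k [^] q = \<one>" using x by (simp add: int_pow_pow)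
    hence "x [^] (a * int q) = inv (k [^] q)" using x Kc[OF ak(2)] by (simp add: inv_equality)
    moreover have "k [^] q \<in> K"
      using subgroup_int_pow_closed[OF K ak(2), of "int q"] by (simp add: int_pow_int)
    ultimately have "x [^] (a * int q) \<in> K" using subgroup.m_inv_closed[OF K] by simp
    hence "x [^] (a * int q) = \<one>" by (rule triv)
    hence "int d dvd a * int q" using x unfolding d_def by (simp add: int_pow_eq_id)
    hence "int p dvd a" using q0 unfolding q by simp
    then obtain c where c: "a = int p * c" by blast
    \<comment> \<open>The corrected element still lies outside \<open>H\<close>, but its
      \<open>p\<close>-th power is \<open>k\<close>, an element of \<open>K\<close> and not merely
      of \<open>H\<close>.\<close>
    define z where "z = y \<otimes> x [^] (- c)"
    have z: "z \<in> carrier G" unfolding z_def using x y by simp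
    have "z [^] int p = y [^] int p \<otimes> x [^] (- a)"
      unfolding z_def c using x y by (simp add: int_pow_distrib int_pow_pow mult.commute)
    also have "\<dots> = k \<otimes> (x [^] a \<otimes> x [^] (- a))"
      using ak x Kc[OF ak(2)] by (simp add: int_pow_int m_ac)
    also have "\<dots> = k" using x Kc[OF ak(2)] by (simp add: int_pow_mult[symmetric])
    finally have zp: "z [^] int p = k" .
    have zH: "z \<notin> H"
    proof
      assume "z \<in> H"
      hence "z \<otimes> x [^] c \<in> H" using subgroup.m_closed[OF H] xH by blast
      also have "z \<otimes> x [^] c = y \<otimes> (x [^] (- c) \<otimes> x [^] c)" unfolding z_def using x y by (simp add: m_assoc)
      also have "\<dots> = y" using x y by (simp add: int_pow_mult[symmetric])
      finally show False using y by blast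
    qed
    \<comment> \<open>This subgroup is larger than \<open>K\<close>, so by maximality it contains a
      nontrivial power of \<open>x\<close>, written with \<open>z [^] s\<close>. If \<open>p\<close>
      divides \<open>s\<close>, that power lies in \<open>K\<close>; if not, Bezout puts
      \<open>z\<close> into \<open>H\<close>. Both are contradictions.\<close>
    define K' where "K' = {z [^] (t::int) \<otimes> k |t k. k \<in> K}"
    have K': "subgroup K' G" unfolding K'_def by (rule subgroup_powers_times[OF K z])
    have "K \<subseteq> K'"
    proof
      fix k assume "k \<in> K"
      thus "k \<in> K'" unfolding K'_def by (intro CollectI exI[of _ 0] exI[of _ k]) (simp add: Kc)
    qed
    moreover have "z \<in> K'" unfolding K'_def using z subgroup.one_closed[OF K]
      by (intro CollectI exI[of _ 1] exI[of _ \<one>]) simp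
    moreover have "z \<notin> K" using zH KH by blast
    ultimately have "K' \<notin> \<K>" using max by blast
    then obtain t where t: "x [^] (t::int) \<in> K'" "x [^] t \<noteq> \<one>" using K' unfolding \<K>_def by blast
    then obtain s k' where s: "x [^] t = z [^] (s::int) \<otimes> k'" "k' \<in> K" unfolding K'_def by blast
    show False
    proof (cases "int p dvd s")
      case True
      then obtain s' where "s = int p * s'" by blast
      hence "z [^] s = k [^] s'" using z zp by (simp add: int_pow_pow[symmetric])
      hence "z [^] s \<in> K" using subgroup_int_pow_closed[OF K ak(2)] by simp
      hence "x [^] t \<in> K" using s subgroup.m_closed[OF K] by simp
      thus False using triv t(2) by blast
    next
      case False
      have "z [^] s = x [^] t \<otimes> inv k'" unfolding s(1) using z Kc[OF s(2)] by (simp add: m_assoc)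
      hence "z [^] s \<in> H"
        using xH KH subgroup.m_inv_closed[OF K s(2)] subgroup.m_closed[OF H] by simp
      moreover have "z [^] int p \<in> H" using zp KH ak(2) by simp
      moreover have "coprime (int p) s" using False p(1) by (simp add: prime_imp_coprime)
      ultimately show False using coprime_pow_mem_subgroup[OF H z, of "int p" s] zH by blast
    qed
  qed
  thus ?thesis using that[OF K triv] unfolding H_def by blast
qed

section \<open>Decomposition into a divisor chain of cyclic groups\<close>

definition cyclic_sum :: "(nat \<Rightarrow> nat) \<Rightarrow> (nat \<Rightarrow> int) monoid" where
  "cyclic_sum d = product_group UNIV (\<lambda>j. integer_mod_group (d j))"

text \<open>Trailing ones replace a length parameter: all but finitely many factors of
  \<open>cyclic_sum d\<close> are then trivial, and the chain is determined by the group. Positivity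
  excludes \<open>integer_mod_group 0\<close>, which is infinite.\<close>

definition divisor_chain :: "(nat \<Rightarrow> nat) \<Rightarrow> bool" where
  "divisor_chain d \<longleftrightarrow> (\<forall>j. 0 < d j \<and> d (Suc j) dvd d j) \<and> (\<exists>L. \<forall>j\<ge>L. d j = 1)"

lemma divisor_chain_pos: "divisor_chain d \<Longrightarrow> 0 < d j"
  unfolding divisor_chain_def by blast

lemma divisor_chain_dvd: "divisor_chain d \<Longrightarrow> i \<le> j \<Longrightarrow> d j dvd d i"
  by (rotate_tac 1, induction j rule: dec_induct) (auto simp: divisor_chain_def intro: dvd_trans)

lemma carrier_cyclic_sum:
  "(\<And>j. 0 < d j) \<Longrightarrow> carrier (cyclic_sum d) = (\<Pi>\<^sub>E j\<in>UNIV. {0..<int (d j)})"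
  unfolding cyclic_sum_def by (auto simp: carrier_integer_mod_group neq0_conv[symmetric] simp del: neq0_conv)

lemma mult_cyclic_sum: "f \<otimes>\<^bsub>cyclic_sum d\<^esub> g = (\<lambda>j. (f j + g j) mod int (d j))"
  unfolding cyclic_sum_def by (simp add: restrict_def)

lemma one_cyclic_sum: "\<one>\<^bsub>cyclic_sum d\<^esub> = (\<lambda>j. 0)"
  unfolding cyclic_sum_def by (simp add: restrict_def)

lemma comm_group_product_group:
  assumes "\<And>i. i \<in> I \<Longrightarrow> comm_group (G i)"
  shows "comm_group (product_group I G)"
proof -
  have g: "group (product_group I G)" using assms by (simp add: comm_group.axioms(2))
  show ?thesis
  proof (rule group.group_comm_groupI[OF g])
    fix x y assume "x \<in> carrier (product_group I G)" "y \<in> carrier (product_group I G)"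
    thus "x \<otimes>\<^bsub>product_group I G\<^esub> y = y \<otimes>\<^bsub>product_group I G\<^esub> x"
      using assms by (auto simp: fun_eq_iff restrict_def comm_group_def comm_monoid.m_comm PiE_iff)
  qed
qed

lemma comm_group_cyclic_sum: "comm_group (cyclic_sum d)"
  unfolding cyclic_sum_def by (rule comm_group_product_group) simp

lemma nat_pow_cyclic_sum:
  assumes "\<And>j. 0 < d j" "f \<in> carrier (cyclic_sum d)"
  shows "f [^]\<^bsub>cyclic_sum d\<^esub> (n::nat) = (\<lambda>j. (int n * f j) mod int (d j))"
proof (induction n)
  case 0
  show ?case by (simp add: one_cyclic_sum)
next
  case (Suc n)
  show ?case
    unfolding nat_pow_Suc Suc.IH mult_cyclic_sum by (auto simp: algebra_simps mod_simps)
qed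

text \<open>The coordinates from \<open>L\<close> on are forced, so restriction to the first
  \<open>L\<close> coordinates is a bijection onto a finite product.\<close>

lemma card_PiE_UNIV_nat:
  assumes "\<And>j. L \<le> j \<Longrightarrow> card (B j) = 1" "\<And>j. finite (B j)"
  shows "card (\<Pi>\<^sub>E j\<in>(UNIV::nat set). B j) = (\<Prod>j<L. card (B j))" "finite (\<Pi>\<^sub>E j\<in>(UNIV::nat set). B j)"
proof -
  define c where "c j = (THE x. x \<in> B j)" for j
  have c: "B j = {c j}" if "L \<le> j" for j
  proof -
    from assms(1)[OF that] obtain x where "B j = {x}" by (metis card_1_singletonE)
    thus ?thesis unfolding c_def by simp
  qed
  have b: "bij_betw (\<lambda>f. restrict f {..<L}) (\<Pi>\<^sub>E j\<in>UNIV. B j) (\<Pi>\<^sub>E j\<in>{..<L}. B j)"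
  proof (rule bij_betw_byWitness[where f' = "\<lambda>f j. if j < L then f j else c j"])
    show "\<forall>a\<in>\<Pi>\<^sub>E j\<in>UNIV. B j. (\<lambda>j. if j < L then restrict a {..<L} j else c j) = a"
    proof (intro ballI ext)
      fix a j assume "a \<in> (\<Pi>\<^sub>E j\<in>UNIV. B j)"
      hence "a j \<in> B j" by auto
      thus "(if j < L then restrict a {..<L} j else c j) = a j" using c[of j] by auto
    qed
    show "\<forall>a\<in>\<Pi>\<^sub>E j\<in>{..<L}. B j. restrict (\<lambda>j. if j < L then a j else c j) {..<L} = a"
      by (auto simp: PiE_def extensional_def fun_eq_iff)
    show "(\<lambda>f. restrict f {..<L}) ` (\<Pi>\<^sub>E j\<in>UNIV. B j) \<subseteq> (\<Pi>\<^sub>E j\<in>{..<L}. B j)"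
      by (auto simp: PiE_iff extensional_def split: if_splits)
    show "(\<lambda>f j. if j < L then f j else c j) ` (\<Pi>\<^sub>E j\<in>{..<L}. B j) \<subseteq> (\<Pi>\<^sub>E j\<in>UNIV. B j)"
      using c by (auto simp: PiE_iff not_less)
  qed
  have "card (\<Pi>\<^sub>E j\<in>{..<L}. B j) = (\<Prod>j<L. card (B j))" by (simp add: card_PiE)
  thus "card (\<Pi>\<^sub>E j\<in>UNIV. B j) = (\<Prod>j<L. card (B j))" using bij_betw_same_card[OF b] by simp
  have "finite (\<Pi>\<^sub>E j\<in>{..<L}. B j)" by (intro finite_PiE) (auto simp: assms(2))
  thus "finite (\<Pi>\<^sub>E j\<in>UNIV. B j)" using bij_betw_finite[OF b] by simp
qed

lemma order_cyclic_sum: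
  assumes "divisor_chain d" "\<And>j. L \<le> j \<Longrightarrow> d j = 1"
  shows "order (cyclic_sum d) = (\<Prod>j<L. d j)"
  using card_PiE_UNIV_nat(1)[of L "\<lambda>j. {0..<int (d j)}"] assms divisor_chain_pos[OF assms(1)]
  unfolding order_def by (simp add: carrier_cyclic_sum)

lemma finite_cyclic_sum:
  assumes "divisor_chain d" shows "finite (carrier (cyclic_sum d))"
proof -
  obtain L where "\<forall>j\<ge>L. d j = 1" using assms unfolding divisor_chain_def by blast
  thus ?thesis using card_PiE_UNIV_nat(2)[of L "\<lambda>j. {0..<int (d j)}"] assms divisor_chain_pos[OF assms(1)]
    by (simp add: carrier_cyclic_sum)
qed

lemma trivial_cyclic_sum: "trivial_group (cyclic_sum d) \<longleftrightarrow> (\<forall>j. d j = 1)"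
  unfolding cyclic_sum_def by (simp add: trivial_product_group trivial_integer_mod_group)

lemma (in comm_group) subgroup_is_comm_group:
  assumes "subgroup K G" shows "comm_group (G\<lparr>carrier := K\<rparr>)"
proof (rule group.group_comm_groupI)
  show "group (G\<lparr>carrier := K\<rparr>)" using assms by (rule subgroup_imp_group)
  fix x y assume "x \<in> carrier (G\<lparr>carrier := K\<rparr>)" "y \<in> carrier (G\<lparr>carrier := K\<rparr>)"
  thus "x \<otimes>\<^bsub>G\<lparr>carrier := K\<rparr>\<^esub> y = y \<otimes>\<^bsub>G\<lparr>carrier := K\<rparr>\<^esub> x"
    using subgroup.mem_carrier[OF assms] by (simp add: m_comm)
qed

lemma (in comm_group) mult_eq_mult_imp:
  assumes eq: "a \<otimes> k = b \<otimes> l" and c: "a \<in> carrier G" "b \<in> carrier G" "k \<in> carrier G" "l \<in> carrier G"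
  shows "a \<otimes> inv b = l \<otimes> inv k"
proof -
  have "a \<otimes> inv b = a \<otimes> ((k \<otimes> inv k) \<otimes> inv b)" using c by simp
  also have "\<dots> = (a \<otimes> k) \<otimes> (inv k \<otimes> inv b)" using c by (simp add: m_assoc del: r_inv Units_r_inv)
  also have "\<dots> = (l \<otimes> b) \<otimes> (inv k \<otimes> inv b)" unfolding eq using c by (simp add: m_comm)
  also have "\<dots> = l \<otimes> ((b \<otimes> inv b) \<otimes> inv k)" using c by (simp add: m_ac del: r_inv Units_r_inv)
  also have "\<dots> = l \<otimes> inv k" using c by simp
  finally show ?thesis .
qed

text \<open>An element \<open>x\<close> whose order is the exponent generates a cyclic factor. Its
  complement \<open>K\<close> has a chain \<open>e\<close> by hypothesis, and \<open>ord x\<close>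
  is put in front of it; this is again a chain because every order divides the exponent.\<close>

lemma (in comm_group) iso_cyclic_sum_step:
  assumes fin: "finite (carrier G)"
    and IH: "\<And>K. subgroup K G \<Longrightarrow> K \<noteq> carrier G \<Longrightarrow> \<exists>e. divisor_chain e \<and> G\<lparr>carrier := K\<rparr> \<cong> cyclic_sum e"
  shows "\<exists>d. divisor_chain d \<and> G \<cong> cyclic_sum d"
proof -
  show ?thesis
  proof (cases "trivial_group G")
    case True
    have "divisor_chain (\<lambda>j. 1)" unfolding divisor_chain_def by auto
    moreover have "G \<cong> cyclic_sum (\<lambda>j. 1)"
    proof (rule is_isoI)
      have "carrier G = {\<one>}" using True unfolding trivial_group_def by blast
      moreover have "carrier (cyclic_sum (\<lambda>j. 1)) = {\<lambda>j. 0}"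
      proof -
        have "{0..<int 1} = {0}" by auto
        thus ?thesis by (auto simp: carrier_cyclic_sum PiE_iff fun_eq_iff)
      qed
      ultimately show "(\<lambda>x j. 0) \<in> iso G (cyclic_sum (\<lambda>j. 1))"
        unfolding iso_iff hom_def by (auto simp: mult_cyclic_sum)
    qed
    ultimately show ?thesis by blast
  next
    case False
    obtain x where x: "x \<in> carrier G" and ex: "\<And>y. y \<in> carrier G \<Longrightarrow> ord y dvd ord x"
      using exists_ord_eq_exponent[OF fin] by blast
    obtain K where K: "subgroup K G" and triv: "\<And>t::int. x [^] t \<in> K \<Longrightarrow> x [^] t = \<one>"
      and span: "\<And>y. y \<in> carrier G \<Longrightarrow> \<exists>t::int. \<exists>k\<in>K. y = x [^] t \<otimes> k"
      using cyclic_complement[OF fin x ex] by blast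
    define n where "n = ord x"
    have n0: "0 < n" using ord_ge_1[OF fin x] unfolding n_def by simp
    have "x \<noteq> \<one>"
    proof
      assume "x = \<one>"
      hence "y = \<one>" if "y \<in> carrier G" for y using ex[OF that] ord_eq_1[OF that] by simp
      hence "carrier G = {\<one>}" using one_closed by blast
      thus False using False is_group unfolding trivial_group_def by blast
    qed
    hence "x \<notin> K" using triv[of 1] x by auto
    then obtain e where e: "divisor_chain e" "G\<lparr>carrier := K\<rparr> \<cong> cyclic_sum e"
      using IH[OF K] x by blast
    have cK: "comm_group (G\<lparr>carrier := K\<rparr>)" using subgroup_is_comm_group[OF K] .
    from e(2) have "cyclic_sum e \<cong> G\<lparr>carrier := K\<rparr>" using group.iso_sym comm_group.axioms(2)[OF cK] by blast
    then obtain \<phi> where "\<phi> \<in> iso (cyclic_sum e) (G\<lparr>carrier := K\<rparr>)" unfolding is_iso_def by blast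
    hence \<phi>_hom: "\<And>u v. u \<in> carrier (cyclic_sum e) \<Longrightarrow> v \<in> carrier (cyclic_sum e) \<Longrightarrow>
        \<phi> (u \<otimes>\<^bsub>cyclic_sum e\<^esub> v) = \<phi> u \<otimes> \<phi> v"
      and \<phi>_img: "\<phi> ` carrier (cyclic_sum e) = K" and \<phi>_inj: "inj_on \<phi> (carrier (cyclic_sum e))"
      unfolding iso_iff hom_def by auto
    define d where "d = case_nat n e"
    have dpos: "0 < d j" for j using n0 divisor_chain_pos[OF e(1)] unfolding d_def by (cases j) auto
    note epos = divisor_chain_pos[OF e(1)]
    have "e 0 dvd n"
    proof (cases "e 0 = 1")
      case False
      \<comment> \<open>The generator of the first factor of \<open>K\<close>; 1 is a reduced
        residue only for \<open>e 0 \<noteq> 1\<close>. Its \<open>n\<close>-th power is trivial, so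
        \<open>e 0\<close> divides \<open>n\<close>.\<close>
      define u where "u = (\<lambda>j::nat. if j = 0 then 1 else 0 :: int)"
      have u: "u \<in> carrier (cyclic_sum e)"
      proof -
        have "1 < e 0" using epos[of 0] False by linarith
        thus ?thesis using epos by (auto simp: carrier_cyclic_sum u_def PiE_iff)
      qed
      have "\<phi> (u [^]\<^bsub>cyclic_sum e\<^esub> m) = \<phi> u [^] m" for m :: nat
      proof (induction m)
        case 0
        interpret E: comm_group "cyclic_sum e" by (rule comm_group_cyclic_sum)
        have "\<phi> \<one>\<^bsub>cyclic_sum e\<^esub> \<in> carrier G" using \<phi>_img subgroup.subset[OF K] by (metis E.one_closed image_subset_iff)
        moreover have "\<phi> \<one>\<^bsub>cyclic_sum e\<^esub> \<otimes> \<phi> \<one>\<^bsub>cyclic_sum e\<^esub> = \<phi> \<one>\<^bsub>cyclic_sum e\<^esub>"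
          using \<phi>_hom[of "\<one>\<^bsub>cyclic_sum e\<^esub>" "\<one>\<^bsub>cyclic_sum e\<^esub>"] by simp
        ultimately show ?case by simp
      next
        case (Suc m)
        interpret E: comm_group "cyclic_sum e" by (rule comm_group_cyclic_sum)
        show ?case using Suc u \<phi>_hom by simp
      qed
      note pw = this
      have uc: "\<phi> u \<in> carrier G" using \<phi>_img u subgroup.subset[OF K] by blast
      have "\<phi> u [^] n = \<one>" using ex[OF uc] uc unfolding n_def by (simp add: pow_eq_id)
      hence "\<phi> (u [^]\<^bsub>cyclic_sum e\<^esub> n) = \<phi> (u [^]\<^bsub>cyclic_sum e\<^esub> (0::nat))" unfolding pw by simp
      moreover have "u [^]\<^bsub>cyclic_sum e\<^esub> (m::nat) \<in> carrier (cyclic_sum e)" for m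
      proof -
        interpret E: comm_group "cyclic_sum e" by (rule comm_group_cyclic_sum)
        show ?thesis using u by simp
      qed
      ultimately have "u [^]\<^bsub>cyclic_sum e\<^esub> n = u [^]\<^bsub>cyclic_sum e\<^esub> (0::nat)" using inj_onD[OF \<phi>_inj] by blast
      hence "(int n * u 0) mod int (e 0) = 0"
        unfolding nat_pow_cyclic_sum[OF epos u] by (metis mult_zero_left mod_0 of_nat_0)
      thus ?thesis unfolding u_def by (simp add: mod_eq_0_iff_dvd)
    qed auto
    hence dc: "divisor_chain d"
    proof -
      obtain L where "\<forall>j\<ge>L. e j = 1" using e(1) unfolding divisor_chain_def by blast
      hence "\<forall>j\<ge>Suc L. d j = 1" unfolding d_def by (auto split: nat.split)
      moreover have "d (Suc j) dvd d j" for j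
        using \<open>e 0 dvd n\<close> e(1) unfolding d_def divisor_chain_def by (cases j) auto
      ultimately show ?thesis using dpos unfolding divisor_chain_def by blast
    qed
    \<comment> \<open>Coordinate 0 is the exponent of \<open>x\<close>, the shifted rest describes
      the component in \<open>K\<close>. Injectivity comes from \<open>triv\<close>, surjectivity
      from \<open>span\<close>.\<close>
    define h where "h f = x [^] (f 0 :: int) \<otimes> \<phi> (\<lambda>j. f (Suc j))" for f
    have d_simps: "d 0 = n" "d (Suc j) = e j" for j unfolding d_def by simp_all
    have car_d: "f \<in> carrier (cyclic_sum d) \<longleftrightarrow> (\<forall>j. f j \<in> {0..<int (d j)})" for f
      unfolding carrier_cyclic_sum[OF dpos] by (simp add: PiE_iff)
    have car_e: "f \<in> carrier (cyclic_sum e) \<longleftrightarrow> (\<forall>j. f j \<in> {0..<int (e j)})" for f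
      unfolding carrier_cyclic_sum[OF epos] by (simp add: PiE_iff)
    have tl: "(\<lambda>j. f (Suc j)) \<in> carrier (cyclic_sum e)" if "f \<in> carrier (cyclic_sum d)" for f
      using that unfolding car_d car_e by (metis d_simps(2))
    have hd: "f 0 \<in> {0..<int n}" if "f \<in> carrier (cyclic_sum d)" for f
      using that unfolding car_d by (metis d_simps(1))
    have \<phi>K: "\<phi> u \<in> K" if "u \<in> carrier (cyclic_sum e)" for u using \<phi>_img that by blast
    have Kc: "k \<in> K \<Longrightarrow> k \<in> carrier G" for k using subgroup.mem_carrier[OF K] .
    have "h \<in> iso (cyclic_sum d) G"
      unfolding iso_iff
    proof (intro conjI)
      show "h \<in> hom (cyclic_sum d) G"
      proof (rule homI)
        fix f assume "f \<in> carrier (cyclic_sum d)"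
        thus "h f \<in> carrier G" unfolding h_def using x Kc[OF \<phi>K[OF tl]] by simp
      next
        fix f g assume f: "f \<in> carrier (cyclic_sum d)" and g: "g \<in> carrier (cyclic_sum d)"
        have "x [^] ((f 0 + g 0) mod int n) = x [^] (f 0 + g 0)"
          using x unfolding int_pow_eq[OF x] n_def by (simp add: mod_eq_dvd_iff[symmetric] dvd_minus_mod)
        moreover have "(\<lambda>j. (f (Suc j) + g (Suc j)) mod int (e j)) = (\<lambda>j. f (Suc j)) \<otimes>\<^bsub>cyclic_sum e\<^esub> (\<lambda>j. g (Suc j))"
          unfolding mult_cyclic_sum ..
        ultimately have "h (f \<otimes>\<^bsub>cyclic_sum d\<^esub> g) = x [^] (f 0 + g 0) \<otimes> (\<phi> (\<lambda>j. f (Suc j)) \<otimes> \<phi> (\<lambda>j. g (Suc j)))"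
          unfolding h_def mult_cyclic_sum using \<phi>_hom[OF tl[OF f] tl[OF g]]
          by (simp add: d_simps mult_cyclic_sum)
        also have "\<dots> = h f \<otimes> h g"
          unfolding h_def using x Kc[OF \<phi>K[OF tl[OF f]]] Kc[OF \<phi>K[OF tl[OF g]]] by (simp add: int_pow_mult m_ac)
        finally show "h (f \<otimes>\<^bsub>cyclic_sum d\<^esub> g) = h f \<otimes> h g" .
      qed
      show "inj_on h (carrier (cyclic_sum d))"
      proof (rule inj_onI)
        fix f g assume f: "f \<in> carrier (cyclic_sum d)" and g: "g \<in> carrier (cyclic_sum d)" and eq: "h f = h g"
        let ?k = "\<phi> (\<lambda>j. f (Suc j))" and ?l = "\<phi> (\<lambda>j. g (Suc j))"
        have k: "?k \<in> K" "?l \<in> K" using \<phi>K tl f g by auto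
        have kc: "?k \<in> carrier G" "?l \<in> carrier G" using k Kc by auto
        have "x [^] f 0 \<otimes> inv (x [^] g 0) = ?l \<otimes> inv ?k"
          using eq x kc unfolding h_def by (intro mult_eq_mult_imp) auto
        hence xe: "x [^] (f 0 - g 0) = ?l \<otimes> inv ?k" using x by (simp add: int_pow_diff)
        also have "\<dots> \<in> K" using k K by (simp add: subgroup.m_closed subgroup.m_inv_closed)
        finally have "x [^] (f 0 - g 0) = \<one>" by (rule triv)
        hence "int n dvd f 0 - g 0" and l: "?l \<otimes> inv ?k = \<one>" using xe x unfolding n_def by (simp_all add: int_pow_eq_id)
        hence 0: "f 0 = g 0" using hd[OF f] hd[OF g]
          by (metis atLeastLessThan_iff mod_eq_dvd_iff mod_pos_pos_trivial)
        have "?l = ?k" using l kc by (metis inv_closed inv_equality inv_inv)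
        hence "(\<lambda>j. g (Suc j)) = (\<lambda>j. f (Suc j))" using \<phi>_inj tl f g by (simp add: inj_on_eq_iff)
        hence "f j = g j" for j using 0 by (cases j) (auto simp: fun_eq_iff)
        thus "f = g" by blast
      qed
      show "h ` carrier (cyclic_sum d) = carrier G"
      proof
        show "h ` carrier (cyclic_sum d) \<subseteq> carrier G"
          unfolding h_def using x Kc[OF \<phi>K[OF tl]] by auto
        show "carrier G \<subseteq> h ` carrier (cyclic_sum d)"
        proof
          fix y assume "y \<in> carrier G"
          then obtain t k where tk: "y = x [^] (t::int) \<otimes> k" "k \<in> K" using span by blast
          then obtain u where u: "u \<in> carrier (cyclic_sum e)" "k = \<phi> u" using \<phi>_img by blast
          define f where "f = case_nat (t mod int n) u"
          have "f j \<in> {0..<int (d j)}" for j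
            using u(1) n0 unfolding car_e f_def by (cases j) (auto simp: d_simps)
          hence "f \<in> carrier (cyclic_sum d)" unfolding car_d by blast
          moreover have "x [^] (t mod int n) = x [^] t"
            using x unfolding int_pow_eq[OF x] n_def by (simp add: dvd_minus_mod)
          hence "h f = y" unfolding h_def f_def tk u(2) by simp
          ultimately show "y \<in> h ` carrier (cyclic_sum d)" by blast
        qed
      qed
    qed
    hence "cyclic_sum d \<cong> G" by (rule is_isoI)
    hence "G \<cong> cyclic_sum d" using group.iso_sym comm_group.axioms(2)[OF comm_group_cyclic_sum] by blast
    thus ?thesis using dc by blast
  qed
qed


theorem comm_group_iso_cyclic_sum:
  assumes "comm_group G" "finite (carrier G)"
  shows "\<exists>d. divisor_chain d \<and> G \<cong> cyclic_sum d"
  using assms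
proof (induction "card (carrier G)" arbitrary: G rule: less_induct)
  case (less G)
  interpret comm_group G by (rule less.prems)
  show ?case
  proof (rule iso_cyclic_sum_step[OF less.prems(2)])
    fix K assume K: "subgroup K G" "K \<noteq> carrier G"
    have "K \<subset> carrier G" using K subgroup.subset[OF K(1)] by blast
    hence "card (carrier (G\<lparr>carrier := K\<rparr>)) < card (carrier G)" "finite (carrier (G\<lparr>carrier := K\<rparr>))"
      using less.prems(2) by (auto simp: psubset_card_mono intro: finite_subset)
    thus "\<exists>e. divisor_chain e \<and> G\<lparr>carrier := K\<rparr> \<cong> cyclic_sum e"
      using less.hyps subgroup_is_comm_group[OF K(1)] by blast
  qed
qed

section \<open>Embeddings read off from invariant factors\<close>

text \<open>The cardinality of this set grows along embeddings and counts the invariant factors divisible by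
  \<open>p ^ Suc k\<close>. As the invariant factors form a chain, these counts determine which of them are.\<close>

definition divisible_torsion :: "nat \<Rightarrow> nat \<Rightarrow> ('a, 'b) monoid_scheme \<Rightarrow> 'a set" where
  "divisible_torsion p k G =
     {x \<in> carrier G. (\<exists>y\<in>carrier G. x = y [^]\<^bsub>G\<^esub> (p ^ k)) \<and> x [^]\<^bsub>G\<^esub> p = \<one>\<^bsub>G\<^esub>}"

lemma card_divisible_torsion_mono:
  assumes "group H" "group G" "f \<in> mon H G" "finite (carrier G)"
  shows "card (divisible_torsion p k H) \<le> card (divisible_torsion p k G)"
proof -
  interpret group_hom H G f
    using assms by (simp add: group_hom_def group_hom_axioms_def mon_def)
  have inj: "inj_on f (carrier H)" using assms(3) by (simp add: mon_def)
  have "f ` divisible_torsion p k H \<subseteq> divisible_torsion p k G"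
  proof (rule image_subsetI)
    fix x assume "x \<in> divisible_torsion p k H"
    then obtain y where x: "x \<in> carrier H" "y \<in> carrier H" "x = y [^]\<^bsub>H\<^esub> (p ^ k)" "x [^]\<^bsub>H\<^esub> p = \<one>\<^bsub>H\<^esub>"
      unfolding divisible_torsion_def by blast
    have "f x = f y [^]\<^bsub>G\<^esub> (p ^ k)" "f x [^]\<^bsub>G\<^esub> p = \<one>\<^bsub>G\<^esub>"
      using x hom_nat_pow[of y "p ^ k"] hom_nat_pow[of x p] by simp_all
    moreover have "f x \<in> carrier G" "f y \<in> carrier G" using x by simp_all
    ultimately show "f x \<in> divisible_torsion p k G" unfolding divisible_torsion_def by blast
  qed
  moreover have "finite (divisible_torsion p k G)" using assms(4) unfolding divisible_torsion_def by simp
  moreover have "inj_on f (divisible_torsion p k H)"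
    using inj by (rule inj_on_subset) (auto simp: divisible_torsion_def)
  ultimately show ?thesis by (meson card_inj_on_le)
qed

text \<open>If \<open>n = p ^ Suc k * m\<close>, the \<open>p\<close>-torsion consists of the
  \<open>p\<close> multiples of \<open>p ^ k * m\<close>, and all of them are multiples of
  \<open>p ^ k\<close>. Otherwise the exponent of \<open>p\<close> in \<open>n\<close> is at most
  \<open>k\<close>: a multiple of \<open>p ^ k\<close> is divisible by the \<open>p\<close>-part of
  \<open>n\<close>, being \<open>p\<close>-torsion adds the rest of \<open>n\<close>, and only 0
  remains.\<close>

lemma card_divisible_torsion_mod:
  fixes n p k :: nat
  assumes p: "prime p" and n: "0 < n"
  defines "W \<equiv> {a \<in> {0..<int n}. (\<exists>b\<in>{0..<int n}. a = (int (p ^ k) * b) mod int n) \<and> (int p * a) mod int n = 0}"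
  shows "card W = (if p ^ Suc k dvd n then p else 1)"
proof (cases "p ^ Suc k dvd n")
  case True
  then obtain m where m: "n = p ^ Suc k * m" by blast
  have p0: "0 < p" using p prime_gt_0_nat by blast
  have m0: "0 < m" using n m by (cases m) auto
  have nn: "int n = int p * (int p ^ k * int m)" unfolding m by simp
  define c where "c = int p ^ k * int m"
  have c0: "0 < c" unfolding c_def using p0 m0 by simp
  have n': "int n = int p * c" unfolding nn c_def ..
  have "W = (\<lambda>t. c * t) ` {0..<int p}"
  proof
    show "W \<subseteq> (\<lambda>t. c * t) ` {0..<int p}"
    proof
      fix a assume a: "a \<in> W"
      hence "int n dvd int p * a" unfolding W_def by auto
      then obtain s where "int p * a = int p * c * s" unfolding n' by blast
      hence s: "a = c * s" using p0 by simp
      have "0 \<le> c * s" "c * s < c * int p" using a s unfolding W_def n' by (auto simp: mult.commute)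
      hence "s \<in> {0..<int p}" using c0 by (auto simp: zero_le_mult_iff)
      thus "a \<in> (\<lambda>t. c * t) ` {0..<int p}" using s by blast
    qed
    show "(\<lambda>t. c * t) ` {0..<int p} \<subseteq> W"
    proof (rule image_subsetI)
      fix t assume t: "t \<in> {0..<int p}"
      have r: "c * t \<in> {0..<int n}" using t c0 unfolding n' by (simp add: mult.commute)
      have pk: "1 \<le> int p ^ k" using p0 by simp
      have "int m * t < int m * int p" using t m0 by simp
      also have "\<dots> \<le> int p ^ k * (int m * int p)" using mult_right_mono[OF pk, of "int m * int p"] by simp
      finally have b: "int m * t \<in> {0..<int n}" using t unfolding nn by (simp add: mult_ac)
      have "c * t = (int (p ^ k) * (int m * t)) mod int n"
        using r unfolding c_def by (simp add: mult.assoc)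
      moreover have "(int p * (c * t)) mod int n = 0" unfolding n' by simp
      ultimately show "c * t \<in> W" unfolding W_def using r b by blast
    qed
  qed
  moreover have "inj_on (\<lambda>t. c * t) {0..<int p}" using c0 by (auto simp: inj_on_def)
  ultimately show ?thesis using True by (simp add: card_image)
next
  case False
  obtain v m where vm: "n = p ^ v * m" "\<not> p dvd m"
    using multiplicity_decompose'[of n p] n p by (metis not_prime_unit less_numeral_extra(3))
  have "v \<le> k"
  proof (rule ccontr)
    assume "\<not> v \<le> k"
    hence "p ^ Suc k dvd p ^ v" by (intro le_imp_power_dvd) simp
    thus False using False vm by (metis dvd_mult2)
  qed
  have "W = {0}"
  proof
    show "{0} \<subseteq> W" unfolding W_def using n by (auto intro!: bexI[of _ 0])
    show "W \<subseteq> {0}"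
    proof
      fix a assume a: "a \<in> W"
      then obtain b where b: "a = (int (p ^ k) * b) mod int n" unfolding W_def by blast
      have "int n dvd int p * a" using a unfolding W_def by auto
      hence "int m dvd int p * a" using vm(1) by (metis dvd_mult_right of_nat_mult)
      moreover have cop: "coprime (int p) (int m)" using vm(2) p by (simp add: prime_imp_coprime)
      ultimately have ma: "int m dvd a" by (simp add: coprime_dvd_mult_right_iff coprime_commute)
      have "int (p ^ v) dvd int (p ^ k) * b"
        using \<open>v \<le> k\<close> by (simp add: le_imp_power_dvd)
      moreover have "int (p ^ v) dvd int n" unfolding vm(1) by simp
      ultimately have "int (p ^ v) dvd a" unfolding b by (simp add: dvd_mod_iff)
      moreover have "coprime (int (p ^ v)) (int m)" using cop by simp
      ultimately have "int n dvd a" using ma unfolding vm(1) by (simp add: divides_mult)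
      moreover have "0 \<le> a" "a < int n" using a unfolding W_def by auto
      ultimately have "a = 0" by (metis dvd_imp_mod_0 mod_pos_pos_trivial)
      thus "a \<in> {0}" by simp
    qed
  qed
  thus ?thesis using False by simp
qed

lemma card_divisible_torsion_cyclic_sum:
  assumes d: "divisor_chain d" "\<And>j. L \<le> j \<Longrightarrow> d j = 1" and p: "prime p"
  shows "card (divisible_torsion p k (cyclic_sum d)) = p ^ card {j. j < L \<and> p ^ Suc k dvd d j}"
proof -
  define W where "W n = {a \<in> {0..<int n}. (\<exists>b\<in>{0..<int n}. a = (int (p ^ k) * b) mod int n) \<and> (int p * a) mod int n = 0}" for n
  note pos = divisor_chain_pos[OF d(1)]
  have car: "f \<in> carrier (cyclic_sum d) \<longleftrightarrow> (\<forall>j. f j \<in> {0..<int (d j)})" for f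
    unfolding carrier_cyclic_sum[OF pos] by (simp add: PiE_iff)
  have "divisible_torsion p k (cyclic_sum d) = (\<Pi>\<^sub>E j\<in>UNIV. W (d j))"
  proof (rule Set.set_eqI, rule iffI)
    fix x assume "x \<in> divisible_torsion p k (cyclic_sum d)"
    then obtain y where x: "x \<in> carrier (cyclic_sum d)" and y: "y \<in> carrier (cyclic_sum d)"
      and xy: "x = y [^]\<^bsub>cyclic_sum d\<^esub> (p ^ k)" and o: "x [^]\<^bsub>cyclic_sum d\<^esub> p = \<one>\<^bsub>cyclic_sum d\<^esub>"
      unfolding divisible_torsion_def by blast
    have "x j = (int (p ^ k) * y j) mod int (d j)" for j
      using xy unfolding nat_pow_cyclic_sum[OF pos y] by metis
    moreover have "(int p * x j) mod int (d j) = 0" for j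
      using o unfolding nat_pow_cyclic_sum[OF pos x] one_cyclic_sum by metis
    ultimately have "x j \<in> W (d j)" for j using x y unfolding W_def car by blast
    thus "x \<in> (\<Pi>\<^sub>E j\<in>UNIV. W (d j))" by (simp add: PiE_iff)
  next
    fix x assume "x \<in> (\<Pi>\<^sub>E j\<in>UNIV. W (d j))"
    hence x: "x j \<in> W (d j)" for j by (simp add: PiE_iff)
    hence xc: "x \<in> carrier (cyclic_sum d)" unfolding car W_def by blast
    have "\<forall>j. \<exists>b\<in>{0..<int (d j)}. x j = (int (p ^ k) * b) mod int (d j)" using x unfolding W_def by blast
    then obtain y where y: "\<And>j. y j \<in> {0..<int (d j)}" "\<And>j. x j = (int (p ^ k) * y j) mod int (d j)" by metis
    hence yc: "y \<in> carrier (cyclic_sum d)" unfolding car by blast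
    have "x = y [^]\<^bsub>cyclic_sum d\<^esub> (p ^ k)" unfolding nat_pow_cyclic_sum[OF pos yc] using y(2) by blast
    moreover have "(int p * x j) mod int (d j) = 0" for j using x[of j] unfolding W_def by blast
    hence "x [^]\<^bsub>cyclic_sum d\<^esub> p = \<one>\<^bsub>cyclic_sum d\<^esub>" unfolding nat_pow_cyclic_sum[OF pos xc] one_cyclic_sum by blast
    ultimately show "x \<in> divisible_torsion p k (cyclic_sum d)" using xc yc unfolding divisible_torsion_def by blast
  qed
  moreover have cW: "card (W (d j)) = (if p ^ Suc k dvd d j then p else 1)" for j
    unfolding W_def by (rule card_divisible_torsion_mod[OF p pos])
  have "\<not> p ^ Suc k dvd 1" using p by (metis is_unit_power_iff nat.distinct(1) not_prime_unit)
  hence "card (W (d j)) = 1" if "L \<le> j" for j using cW[of j] d(2)[OF that] by simp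
  moreover have "finite (W (d j))" for j unfolding W_def by simp
  ultimately have "card (divisible_torsion p k (cyclic_sum d)) = (\<Prod>j<L. card (W (d j)))"
    using card_PiE_UNIV_nat(1)[of L "\<lambda>j. W (d j)"] by simp
  also have "\<dots> = (\<Prod>j<L. if p ^ Suc k dvd d j then p else 1)" unfolding cW ..
  also have "\<dots> = (\<Prod>j\<in>{j \<in> {..<L}. p ^ Suc k dvd d j}. p)" by (subst prod.inter_filter) auto
  finally show ?thesis by simp
qed

text \<open>If \<open>p ^ Suc k\<close> divided \<open>e j\<close> but not \<open>d j\<close>, then
  by the chain conditions it would divide at least \<open>j + 1\<close> terms of \<open>e\<close>
  and at most \<open>j\<close> terms of \<open>d\<close>, against the monotonicity of the torsion
  count. Conversely, multiplying coordinate \<open>j\<close> by \<open>d j div e j\<close> is an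
  embedding.\<close>

theorem mon_cyclic_sum_iff:
  assumes e: "divisor_chain e" and d: "divisor_chain d"
  shows "mon (cyclic_sum e) (cyclic_sum d) \<noteq> {} \<longleftrightarrow> (\<forall>j. e j dvd d j)"
proof
  assume "mon (cyclic_sum e) (cyclic_sum d) \<noteq> {}"
  then obtain f where f: "f \<in> mon (cyclic_sum e) (cyclic_sum d)" by blast
  obtain L1 L2 where L: "\<forall>j\<ge>L1. e j = 1" "\<forall>j\<ge>L2. d j = 1" using e d unfolding divisor_chain_def by blast
  define L where "L = max L1 L2"
  have Le: "\<And>j. L \<le> j \<Longrightarrow> e j = 1" and Ld: "\<And>j. L \<le> j \<Longrightarrow> d j = 1" using L unfolding L_def by auto
  have g: "group (cyclic_sum d)" for d using comm_group_cyclic_sum by (rule comm_group.axioms(2))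
  have pp: "p ^ Suc k dvd d j" if p: "prime p" and dv: "p ^ Suc k dvd e j" for p k j
  proof (rule ccontr)
    assume nd: "\<not> p ^ Suc k dvd d j"
    have c: "card (divisible_torsion p k (cyclic_sum e)) = p ^ card {j. j < L \<and> p ^ Suc k dvd e j}"
      "card (divisible_torsion p k (cyclic_sum d)) = p ^ card {j. j < L \<and> p ^ Suc k dvd d j}"
      by (rule card_divisible_torsion_cyclic_sum[OF e Le p] card_divisible_torsion_cyclic_sum[OF d Ld p], assumption)+
    have "p ^ card {j. j < L \<and> p ^ Suc k dvd e j} \<le> p ^ card {j. j < L \<and> p ^ Suc k dvd d j}"
      using card_divisible_torsion_mono[OF g g f finite_cyclic_sum[OF d], of p k]
      by (simp only: c)
    hence "card {j. j < L \<and> p ^ Suc k dvd e j} \<le> card {j. j < L \<and> p ^ Suc k dvd d j}"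
      using prime_gt_1_nat[OF p] power_le_imp_le_exp by blast
    moreover have "j < L"
    proof (rule ccontr)
      assume "\<not> j < L"
      hence "p ^ Suc k dvd 1" using Le dv by (metis not_less)
      thus False using p by (metis is_unit_power_iff nat.distinct(1) not_prime_unit)
    qed
    hence "{..j} \<subseteq> {j. j < L \<and> p ^ Suc k dvd e j}" using dv divisor_chain_dvd[OF e] by (auto intro: dvd_trans)
    hence "card {..j} \<le> card {j. j < L \<and> p ^ Suc k dvd e j}" by (intro card_mono) auto
    moreover have "{j. j < L \<and> p ^ Suc k dvd d j} \<subseteq> {..<j}"
      using nd divisor_chain_dvd[OF d] by (metis (mono_tags, lifting) dvd_trans lessThan_iff linorder_not_le mem_Collect_eq subsetI)
    hence "card {j. j < L \<and> p ^ Suc k dvd d j} \<le> card {..<j}" by (intro card_mono) auto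
    ultimately show False by simp
  qed
  show "\<forall>j. e j dvd d j"
  proof
    fix j
    show "e j dvd d j"
    proof (rule multiplicity_le_imp_dvd)
      show "e j \<noteq> 0" using divisor_chain_pos[OF e, of j] by simp
      fix p :: nat assume p: "prime p"
      show "multiplicity p (e j) \<le> multiplicity p (d j)"
      proof (cases "multiplicity p (e j)")
        case (Suc k)
        have "p ^ Suc k dvd d j" using pp[OF p] multiplicity_dvd[of p "e j"] unfolding Suc by blast
        thus ?thesis unfolding Suc using divisor_chain_pos[OF d, of j] p
          by (intro multiplicity_geI) (auto dest: not_prime_unit)
      qed simp
    qed
  qed
next
  assume dv: "\<forall>j. e j dvd d j"
  define c where "c j = int (d j div e j)" for j
  have c: "int (d j) = int (e j) * c j" for j using dv unfolding c_def by (metis dvd_mult_div_cancel of_nat_mult)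
  have c0: "0 < c j" for j using c[of j] divisor_chain_pos[OF d, of j] divisor_chain_pos[OF e, of j]
    by (metis of_nat_0_less_iff zero_less_mult_pos)
  note cars = carrier_cyclic_sum[OF divisor_chain_pos[OF e]] carrier_cyclic_sum[OF divisor_chain_pos[OF d]]
  have "(\<lambda>f j. f j * c j) \<in> mon (cyclic_sum e) (cyclic_sum d)" unfolding mon_def mem_Collect_eq
  proof (intro conjI homI)
    fix f assume "f \<in> carrier (cyclic_sum e)"
    thus "(\<lambda>j. f j * c j) \<in> carrier (cyclic_sum d)" using c0 unfolding cars c
      by (auto simp: PiE_iff intro!: mult_nonneg_nonneg intro: less_imp_le)
  next
    fix f g
    show "(\<lambda>j. (f \<otimes>\<^bsub>cyclic_sum e\<^esub> g) j * c j) = (\<lambda>j. f j * c j) \<otimes>\<^bsub>cyclic_sum d\<^esub> (\<lambda>j. g j * c j)"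
      unfolding mult_cyclic_sum c by (simp add: mod_mult_mult2 distrib_right[symmetric])
  next
    show "inj_on (\<lambda>f j. f j * c j) (carrier (cyclic_sum e))"
    proof (rule inj_onI)
      fix f g :: "nat \<Rightarrow> int" assume "(\<lambda>j. f j * c j) = (\<lambda>j. g j * c j)"
      hence "f j * c j = g j * c j" for j by metis
      hence "f j = g j" for j using c0[of j] by (metis less_irrefl mult_cancel_right)
      thus "f = g" by blast
    qed
  qed
  thus "mon (cyclic_sum e) (cyclic_sum d) \<noteq> {}" by blast
qed

lemma mon_iso_trans:
  assumes "group H" "H' \<cong> H" "G \<cong> G'" "mon H G \<noteq> {}"
  shows "mon H' G' \<noteq> {}"
proof -
  obtain a b f where "a \<in> iso H' H" "b \<in> iso G G'" "f \<in> mon H G" using assms unfolding is_iso_def by blast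
  hence "b \<circ> (f \<circ> a) \<in> mon H' G'" by (intro mon_compose) (auto simp: iso_iff_mon_epi)
  thus ?thesis by blast
qed

lemma cyclic_sum_iso_imp_eq:
  assumes "divisor_chain e" "divisor_chain d" "cyclic_sum e \<cong> cyclic_sum d"
  shows "e = d"
proof
  fix j
  have g: "group (cyclic_sum d)" "group (cyclic_sum e)" using comm_group_cyclic_sum comm_group.axioms(2) by auto
  have "mon (cyclic_sum e) (cyclic_sum d) \<noteq> {}" using assms(3) unfolding is_iso_def by (auto simp: iso_iff_mon_epi)
  moreover have "mon (cyclic_sum d) (cyclic_sum e) \<noteq> {}"
    using group.iso_sym[OF g(2) assms(3)] unfolding is_iso_def by (auto simp: iso_iff_mon_epi)
  ultimately show "e j = d j" using mon_cyclic_sum_iff assms by (metis dvd_antisym)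
qed

section \<open>Group-partitions as arrays\<close>

text \<open>The argument may have any carrier type, so that concrete sums of cyclic groups, whose
  elements are functions, can name classes of \<open>nat monoid\<close>s.\<close>

definition iso_class :: "('a, 'b) monoid_scheme \<Rightarrow> nat monoid set" where
  "iso_class G = {H \<in> fin_ab_groups. H \<cong> G}"

lemma fin_ab_groupsD:
  assumes "G \<in> fin_ab_groups" shows "comm_group G" "group G" "finite (carrier G)"
  using assms unfolding fin_ab_groups_def by (auto intro: comm_group.axioms(2))

text \<open>The multiplication is carried over to an initial segment of the naturals along an
  enumeration of the carrier.\<close>

lemma iso_class_nonempty:
  assumes "comm_group G" "finite (carrier G)"
  obtains H where "H \<in> iso_class G"
proof -
  interpret comm_group G by fact
  obtain h where h: "bij_betw h (carrier G) {0..<card (carrier G)}"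
    using ex_bij_betw_finite_nat[OF assms(2)] by blast
  define g where "g = inv_into (carrier G) h"
  define H where "H = \<lparr>carrier = {0..<card (carrier G)}, mult = \<lambda>a b. h (g a \<otimes>\<^bsub>G\<^esub> g b), one = h \<one>\<^bsub>G\<^esub>\<rparr>"
  have gh: "g (h x) = x" if "x \<in> carrier G" for x
    using that h unfolding g_def bij_betw_def by simp
  have iso: "h \<in> iso G H"
    unfolding iso_def hom_def H_def using h gh by (auto simp: bij_betw_def)
  have "comm_group (H\<lparr>one := h \<one>\<^bsub>G\<^esub>\<rparr>)" by (rule iso_imp_img_comm_group[OF iso])
  hence "H \<in> fin_ab_groups" unfolding fin_ab_groups_def H_def by simp
  moreover have "H \<cong> G" using iso iso_sym is_isoI by blast
  ultimately show ?thesis using that unfolding iso_class_def by blast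
qed

lemma fin_ab_classes_eq: "fin_ab_classes = iso_class ` fin_ab_groups"
proof -
  have "fin_ab_iso_rel `` {G} = iso_class G" if "G \<in> fin_ab_groups" for G
    using that group.iso_sym fin_ab_groupsD(2) unfolding fin_ab_iso_rel_def iso_class_def by blast
  thus ?thesis unfolding fin_ab_classes_def quotient_def by auto
qed

lemma iso_class_cong:
  assumes "group G" "G \<cong> H" shows "iso_class G = iso_class H"
proof -
  have "K \<cong> G \<longleftrightarrow> K \<cong> H" for K :: "nat monoid"
    using iso_trans[of K G H] iso_trans[of K H G] assms(2) group.iso_sym[OF assms] by blast
  thus ?thesis unfolding iso_class_def by simp
qed

lemma iso_class_in_fin_ab_classes:
  assumes "comm_group G" "finite (carrier G)"
  shows "iso_class G \<in> fin_ab_classes"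
proof -
  obtain H where H: "H \<in> iso_class G" using iso_class_nonempty[OF assms] .
  hence HG: "H \<in> fin_ab_groups" "H \<cong> G" unfolding iso_class_def by auto
  thus ?thesis using iso_class_cong[OF fin_ab_groupsD(2)[OF HG(1)] HG(2)] unfolding fin_ab_classes_eq by (metis image_eqI)
qed

lemma iso_class_memD:
  assumes "C \<in> fin_ab_classes" "G \<in> C"
  shows "G \<in> fin_ab_groups" "C = iso_class G"
proof -
  obtain H :: "nat monoid" where H: "C = iso_class H" using assms unfolding fin_ab_classes_eq by blast
  hence G: "G \<in> fin_ab_groups" "G \<cong> H" using assms unfolding iso_class_def by auto
  show "G \<in> fin_ab_groups" by (rule G)
  show "C = iso_class G" unfolding H by (rule iso_class_cong[OF fin_ab_groupsD(2)[OF G(1)] G(2), symmetric])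
qed

definition chain_class :: "(nat \<Rightarrow> nat) \<Rightarrow> nat monoid set" where
  "chain_class d = iso_class (cyclic_sum d)"

lemma group_cyclic_sum: "group (cyclic_sum d)"
  using comm_group_cyclic_sum by (rule comm_group.axioms(2))

lemma chain_class_memD:
  assumes "G \<in> chain_class d" shows "G \<in> fin_ab_groups" "group G" "G \<cong> cyclic_sum d" "cyclic_sum d \<cong> G"
  using assms fin_ab_groupsD(2)[of G] group.iso_sym[of G] unfolding chain_class_def iso_class_def by auto

lemma chain_class_in_fin_ab_classes: "divisor_chain d \<Longrightarrow> chain_class d \<in> fin_ab_classes"
  unfolding chain_class_def by (rule iso_class_in_fin_ab_classes[OF comm_group_cyclic_sum finite_cyclic_sum])

lemma chain_class_nonempty:
  assumes "divisor_chain d" obtains G where "G \<in> chain_class d"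
  using iso_class_nonempty[OF comm_group_cyclic_sum finite_cyclic_sum[OF assms]] unfolding chain_class_def by blast

lemma fin_ab_classesE:
  assumes "C \<in> fin_ab_classes"
  obtains d where "divisor_chain d" "C = chain_class d"
proof -
  obtain G where G: "G \<in> fin_ab_groups" "C = iso_class G" using assms unfolding fin_ab_classes_eq by blast
  obtain d where "divisor_chain d" "G \<cong> cyclic_sum d"
    using comm_group_iso_cyclic_sum[OF fin_ab_groupsD(1,3)[OF G(1)]] by blast
  hence "divisor_chain d" "C = chain_class d"
    using iso_class_cong[OF fin_ab_groupsD(2)[OF G(1)], of "cyclic_sum d"] G(2) unfolding chain_class_def by simp_all
  thus ?thesis by (rule that)
qed

lemma chain_class_inj:
  assumes "divisor_chain d" "divisor_chain e" "chain_class d = chain_class e"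
  shows "d = e"
proof -
  obtain G where G: "G \<in> chain_class d" using chain_class_nonempty[OF assms(1)] .
  have "cyclic_sum d \<cong> cyclic_sum e"
    using iso_trans[OF chain_class_memD(4)[OF G] chain_class_memD(3)[OF G[unfolded assms(3)]]] .
  thus ?thesis by (rule cyclic_sum_iso_imp_eq[OF assms(1,2)])
qed

lemma trivial_class_chain_class:
  assumes "divisor_chain d" shows "trivial_class (chain_class d) \<longleftrightarrow> (\<forall>j. d j = 1)"
proof -
  have "trivial_group G \<longleftrightarrow> (\<forall>j. d j = 1)" if "G \<in> chain_class d" for G
    using isomorphic_group_triviality[OF chain_class_memD(3)[OF that] chain_class_memD(2)[OF that] group_cyclic_sum]
      trivial_cyclic_sum by blast
  thus ?thesis using chain_class_nonempty[OF assms] unfolding trivial_class_def by metis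
qed

text \<open>Isomorphisms transport monomorphisms between representatives to the standard groups and
  back; a subgroup isomorphic to \<open>H\<close> is the image of a monomorphism from
  \<open>H\<close>.\<close>

lemma embeds_in_class_chain_class:
  assumes e: "divisor_chain e" and d: "divisor_chain d"
  shows "embeds_in_class (chain_class e) (chain_class d) \<longleftrightarrow> (\<forall>j. e j dvd d j)"
proof
  assume "embeds_in_class (chain_class e) (chain_class d)"
  then obtain G H S where G: "G \<in> chain_class d" and H: "H \<in> chain_class e" and S: "subgroup S G"
    and "H \<cong> G\<lparr>carrier := S\<rparr>" unfolding embeds_in_class_def by blast
  then obtain a where "a \<in> iso H (G\<lparr>carrier := S\<rparr>)" unfolding is_iso_def by blast
  hence "a \<in> mon H G" using subgroup.subset[OF S] unfolding iso_iff mon_def hom_def by auto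
  hence "mon (cyclic_sum e) (cyclic_sum d) \<noteq> {}"
    using mon_iso_trans[OF chain_class_memD(2)[OF H] chain_class_memD(4)[OF H] chain_class_memD(3)[OF G]] by blast
  thus "\<forall>j. e j dvd d j" using mon_cyclic_sum_iff[OF e d] by blast
next
  assume "\<forall>j. e j dvd d j"
  hence m: "mon (cyclic_sum e) (cyclic_sum d) \<noteq> {}" using mon_cyclic_sum_iff[OF e d] by blast
  obtain G where G: "G \<in> chain_class d" using chain_class_nonempty[OF d] .
  obtain H where H: "H \<in> chain_class e" using chain_class_nonempty[OF e] .
  obtain f where f: "f \<in> mon H G"
    using mon_iso_trans[OF group_cyclic_sum chain_class_memD(3)[OF H] chain_class_memD(4)[OF G] m] by blast
  interpret group_hom H G f
    using f chain_class_memD(2) G H by (simp add: group_hom_def group_hom_axioms_def mon_def)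
  have i: "f \<in> iso H (G\<lparr>carrier := f ` carrier H\<rparr>)"
    using f unfolding iso_def bij_betw_def mon_def hom_def by auto
  show "embeds_in_class (chain_class e) (chain_class d)"
    unfolding embeds_in_class_def
    by (intro bexI[OF _ G] bexI[OF _ H] exI[of _ "f ` carrier H"] conjI img_is_subgroup is_isoI[OF i])
qed

section \<open>Direct sums of sequences of chains\<close>

lemma comm_group_sum_group:
  assumes "\<And>i. i \<in> I \<Longrightarrow> comm_group (G i)"
  shows "comm_group (sum_group I G)"
proof -
  have g: "\<And>i. i \<in> I \<Longrightarrow> group (G i)" using assms by (simp add: comm_group.axioms(2))
  show ?thesis
  proof (rule group.group_comm_groupI)
    show "group (sum_group I G)" using g by simp
    fix x y assume "x \<in> carrier (sum_group I G)" "y \<in> carrier (sum_group I G)"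
    thus "x \<otimes>\<^bsub>sum_group I G\<^esub> y = y \<otimes>\<^bsub>sum_group I G\<^esub> x"
      using assms by (auto simp: carrier_sum_group[OF g] fun_eq_iff restrict_def comm_group_def comm_monoid.m_comm PiE_iff)
  qed
qed

definition total_sum :: "(nat \<Rightarrow> nat \<Rightarrow> nat) \<Rightarrow> (nat \<Rightarrow> nat \<Rightarrow> int) monoid" where
  "total_sum D = sum_group UNIV (\<lambda>i. cyclic_sum (D i))"

lemma comm_group_total_sum: "comm_group (total_sum D)"
  unfolding total_sum_def by (rule comm_group_sum_group) (rule comm_group_cyclic_sum)

lemma total_sum_order:
  assumes D: "\<And>i. divisor_chain (D i)" and "D \<in> arrays L M"
  shows "finite (carrier (total_sum D))" "order (total_sum D) = (\<Prod>i<L. \<Prod>j<M. D i j)"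
proof -
  have 1: "L \<le> i \<or> M \<le> j \<Longrightarrow> D i j = 1" for i j using assms(2) unfolding arrays_def by blast
  have ord: "card (carrier (cyclic_sum (D i))) = (\<Prod>j<M. D i j)" for i
    unfolding order_def[symmetric] by (rule order_cyclic_sum[OF D]) (use 1 in blast)
  have one: "card (carrier (cyclic_sum (D i))) = 1" if "L \<le> i" for i using ord[of i] 1 that by simp
  have fin: "finite (carrier (cyclic_sum (D i)))" for i using finite_cyclic_sum[OF D] .
  have triv: "x = \<one>\<^bsub>cyclic_sum (D i)\<^esub>" if i: "L \<le> i" and x: "x \<in> carrier (cyclic_sum (D i))" for i x
  proof -
    obtain z where "carrier (cyclic_sum (D i)) = {z}" using one[OF i] by (metis card_1_singletonE)
    moreover have "\<one>\<^bsub>cyclic_sum (D i)\<^esub> \<in> carrier (cyclic_sum (D i))"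
      using group_cyclic_sum by (simp add: group.is_monoid monoid.one_closed)
    ultimately show ?thesis using x by auto
  qed
  \<comment> \<open>The summands from \<open>L\<close> on are trivial, so every element of the full
    product has finite support.\<close>
  have car: "carrier (total_sum D) = (\<Pi>\<^sub>E i\<in>UNIV. carrier (cyclic_sum (D i)))"
  proof -
    have "finite {i \<in> UNIV. x i \<noteq> \<one>\<^bsub>cyclic_sum (D i)\<^esub>}"
      if x: "x \<in> (\<Pi>\<^sub>E i\<in>UNIV. carrier (cyclic_sum (D i)))" for x
    proof (rule finite_subset)
      show "{i \<in> UNIV. x i \<noteq> \<one>\<^bsub>cyclic_sum (D i)\<^esub>} \<subseteq> {..<L}"
      proof
        fix i assume "i \<in> {i \<in> UNIV. x i \<noteq> \<one>\<^bsub>cyclic_sum (D i)\<^esub>}"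
        moreover have "x i \<in> carrier (cyclic_sum (D i))" using x by (rule PiE_mem) simp
        ultimately have "\<not> L \<le> i" using triv[of i "x i"] by blast
        thus "i \<in> {..<L}" by simp
      qed
    qed simp
    thus ?thesis unfolding total_sum_def carrier_sum_group[OF group_cyclic_sum] by blast
  qed
  show "finite (carrier (total_sum D))" "order (total_sum D) = (\<Prod>i<L. \<Prod>j<M. D i j)"
    using card_PiE_UNIV_nat[of L "\<lambda>i. carrier (cyclic_sum (D i))", OF one fin]
    unfolding order_def car ord by simp_all
qed

text \<open>Isomorphic summands have isomorphic sums, so the class of the sum is the same for every
  choice of the representatives \<open>X\<close>.\<close>

lemma is_direct_sum_chain_class:
  assumes D: "\<And>i. divisor_chain (D i)" "D \<in> arrays L M" and C: "C \<in> fin_ab_classes"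
  shows "is_direct_sum C (\<lambda>i. chain_class (D i)) \<longleftrightarrow> C = iso_class (total_sum D)"
proof -
  have iso: "sum_group UNIV X \<cong> total_sum D" "total_sum D \<cong> sum_group UNIV X"
    if "\<And>i. X i \<in> chain_class (D i)" for X
    unfolding total_sum_def
    by (rule iso_sum_groupI, rule chain_class_memD(3)[OF that], rule chain_class_memD(2)[OF that], rule group_cyclic_sum,
        rule iso_sum_groupI, rule chain_class_memD(4)[OF that], rule group_cyclic_sum, rule chain_class_memD(2)[OF that])
  show ?thesis
  proof
    assume "is_direct_sum C (\<lambda>i. chain_class (D i))"
    then obtain G X where G: "G \<in> C" "\<And>i. X i \<in> chain_class (D i)" "G \<cong> sum_group UNIV X"
      unfolding is_direct_sum_def by blast
    have "G \<cong> total_sum D" by (rule iso_trans[OF G(3) iso(1)[OF G(2)]])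
    from iso_class_cong[OF fin_ab_groupsD(2)[OF iso_class_memD(1)[OF C G(1)]] this]
    show "C = iso_class (total_sum D)" using iso_class_memD(2)[OF C G(1)] by simp
  next
    assume "C = iso_class (total_sum D)"
    then obtain G where G: "G \<in> C" "G \<cong> total_sum D"
      using iso_class_nonempty[OF comm_group_total_sum total_sum_order(1)[OF D]] unfolding iso_class_def by blast
    have "\<forall>i. \<exists>X. X \<in> chain_class (D i)" using chain_class_nonempty D(1) by metis
    then obtain X where X: "\<And>i. X i \<in> chain_class (D i)" by metis
    show "is_direct_sum C (\<lambda>i. chain_class (D i))" unfolding is_direct_sum_def
      by (intro bexI[OF _ G(1)] exI[of _ X] conjI allI X iso_trans[OF G(2) iso(2)[OF X]])
  qed
qed

text \<open>If \<open>d j \<noteq> 1\<close>, then all of \<open>d 0, ..., d j\<close> are at least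
  2 and the product is at least \<open>2 ^ Suc j\<close>. The order thus bounds the number of
  invariant factors.\<close>

lemma divisor_chain_bound:
  assumes d: "divisor_chain d" and L: "\<And>j. L \<le> j \<Longrightarrow> d j = 1"
  shows "d j \<noteq> 1 \<Longrightarrow> j < (\<Prod>j<L. d j)" "d j \<le> (\<Prod>j<L. d j)"
proof -
  note pos = divisor_chain_pos[OF d]
  have n0: "0 < (\<Prod>j<L. d j)" using pos by (intro prod_pos) simp
  show "d j \<le> (\<Prod>j<L. d j)"
  proof (cases "j < L")
    case True
    thus ?thesis using n0 by (intro dvd_imp_le dvd_prodI) auto
  next
    case False
    hence "d j = 1" using L by simp
    thus ?thesis using n0 by linarith
  qed
  show "j < (\<Prod>j<L. d j)" if "d j \<noteq> 1"
  proof -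
    have "j < L" using L that by (meson not_less)
    have "d j \<le> d i" if "i \<le> j" for i using divisor_chain_dvd[OF d that] pos[of i] by (simp add: dvd_imp_le)
    hence "2 \<le> d i" if "i \<le> j" for i using that pos[of j] \<open>d j \<noteq> 1\<close> by (metis One_nat_def Suc_1 Suc_leI le_trans less_one linorder_neqE_nat not_less)
    hence "(\<Prod>i\<in>{..j}. 2) \<le> (\<Prod>i\<in>{..j}. d i)" by (intro prod_mono) auto
    also have "\<dots> \<le> (\<Prod>i<L. d i)" using \<open>j < L\<close> by (intro dvd_imp_le[OF prod_dvd_prod_subset n0]) auto
    finally have "2 ^ Suc j \<le> (\<Prod>i<L. d i)" by simp
    moreover have "Suc j < 2 ^ Suc j" by (rule less_exp)
    ultimately show ?thesis by linarith
  qed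
qed

lemma prod_arrays_eq:
  assumes "D \<in> arrays a b" "D \<in> arrays a' b'"
  shows "(\<Prod>i<a. \<Prod>j<b. D i j) = (\<Prod>i<a'. \<Prod>j<b'. D i j)"
proof -
  have *: "(\<Prod>i<a. \<Prod>j<b. D i j) = (\<Prod>x\<in>{..<A} \<times> {..<B}. D (fst x) (snd x))"
    if "D \<in> arrays a b" "a \<le> A" "b \<le> B" for a b A B
  proof -
    have "D (fst x) (snd x) = 1" if "x \<notin> {..<a} \<times> {..<b}" for x
      using that \<open>D \<in> arrays a b\<close> unfolding arrays_def by (cases x) (auto simp: not_less)
    hence "(\<Prod>x\<in>{..<a} \<times> {..<b}. D (fst x) (snd x)) = (\<Prod>x\<in>{..<A} \<times> {..<B}. D (fst x) (snd x))"
      using \<open>a \<le> A\<close> \<open>b \<le> B\<close> by (intro prod.mono_neutral_left) auto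
    thus ?thesis by (simp add: prod.cartesian_product case_prod_beta)
  qed
  show ?thesis
    using *[OF assms(1), of "max a a'" "max b b'"] *[OF assms(2), of "max a a'" "max b b'"] by simp
qed

lemma plane_arrays_rows:
  assumes "D \<in> plane_arrays R C" shows "divisor_chain (D i)" "divisor_chain (\<lambda>i. D i j)"
  using assms unfolding plane_arrays_def arrays_def divisor_chain_def by blast+

text \<open>Rows and columns are both divisor chains, so the chain bound works in both directions.
  It does not involve \<open>L\<close> and \<open>M\<close>: arrays with product \<open>n\<close>
  have their nontrivial entries in one fixed box of side \<open>n\<close>.\<close>

lemma plane_arrays_bound:
  assumes D: "D \<in> plane_arrays L M"
  defines "n \<equiv> \<Prod>i<L. \<Prod>j<M. D i j"
  shows "D i j \<noteq> 1 \<Longrightarrow> i < n \<and> j < n" "D i j \<le> n" "0 < n"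
proof -
  have pos: "0 < D i j" for i j using D unfolding plane_arrays_def arrays_def by blast
  have 1: "L \<le> i \<Longrightarrow> D i j = 1" "M \<le> j \<Longrightarrow> D i j = 1" for i j
    using D unfolding plane_arrays_def arrays_def by blast+
  have rp: "0 < (\<Prod>j<M. D i j)" for i using pos by (intro prod_pos) simp
  show n0: "0 < n" unfolding n_def using rp by (intro prod_pos) simp
  have row: "(\<Prod>j<M. D i j) \<le> n"
  proof (cases "i < L")
    case True
    thus ?thesis using n0 unfolding n_def by (intro dvd_imp_le dvd_prodI) auto
  next
    case False
    thus ?thesis using 1(1)[of i] n0 by simp
  qed
  have Dr: "D i j \<le> (\<Prod>j<M. D i j)" for i
    by (rule divisor_chain_bound(2)[OF plane_arrays_rows(1)[OF D]]) (rule 1)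
  show "D i j \<le> n" using Dr[of i] row by simp
  have "(\<Prod>i<L. D i j) \<le> n" unfolding n_def using Dr by (intro prod_mono) simp
  moreover have "i < (\<Prod>i<L. D i j)" "j < (\<Prod>j<M. D i j)" if "D i j \<noteq> 1"
    using that 1
    by (intro divisor_chain_bound(1)[OF plane_arrays_rows(2)[OF D]] divisor_chain_bound(1)[OF plane_arrays_rows(1)[OF D]]; blast)+
  ultimately show "D i j \<noteq> 1 \<Longrightarrow> i < n \<and> j < n" using row by (meson less_le_trans)
qed

lemma finite_arrays_bounded: "finite {D \<in> arrays R C. \<forall>i j. D i j \<le> n}"
proof -
  let ?B = "{d. \<forall>j. (j \<in> {..<C} \<longrightarrow> d j \<in> {..n}) \<and> (j \<notin> {..<C} \<longrightarrow> d j = (1::nat))}"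
  have "finite ?B" by (rule finite_set_of_finite_funs) auto
  hence "finite {D. \<forall>i. (i \<in> {..<R} \<longrightarrow> D i \<in> ?B) \<and> (i \<notin> {..<R} \<longrightarrow> D i = (\<lambda>_. 1))}"
    by (intro finite_set_of_finite_funs) auto
  thus ?thesis by (rule rev_finite_subset) (auto simp: arrays_def)
qed

lemma finite_classes_of_order:
  assumes "0 < n" shows "finite (classes_of_order n)"
proof -
  let ?B = "{d. \<forall>j. (j \<in> {..<n} \<longrightarrow> d j \<in> {..n}) \<and> (j \<notin> {..<n} \<longrightarrow> d j = (1::nat))}"
  have "classes_of_order n \<subseteq> chain_class ` ?B"
  proof
    fix C assume "C \<in> classes_of_order n"
    then obtain G where C: "C \<in> fin_ab_classes" and G: "G \<in> C" "order G = n" unfolding classes_of_order_def by blast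
    obtain d where d: "divisor_chain d" "C = chain_class d" using fin_ab_classesE[OF C] .
    obtain L where L: "\<And>j. L \<le> j \<Longrightarrow> d j = 1" using d(1) unfolding divisor_chain_def by blast
    have "order G = order (cyclic_sum d)" using chain_class_memD(3)[of G d] G d by (simp add: iso_same_card order_def)
    hence n: "(\<Prod>j<L. d j) = n" using order_cyclic_sum[OF d(1) L] G by simp
    have "d j \<le> n" for j using divisor_chain_bound(2)[OF d(1) L] n by metis
    moreover have "d j = 1" if "n \<le> j" for j
      using divisor_chain_bound(1)[OF d(1) L] n that by (metis not_less)
    ultimately have "d \<in> ?B" by auto
    thus "C \<in> chain_class ` ?B" using d(2) by blast
  qed
  moreover have "finite ?B" by (rule finite_set_of_finite_funs) auto
  ultimately show ?thesis using finite_surj by blast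
qed

text \<open>\<open>min_exp\<close> plays two parts: \<open>min_exp n r\<close> is the number of rows
  provided for groups of order \<open>n\<close>, and \<open>min_exp m r\<close> is the number of
  cells of weight \<open>m\<close>. This equivalence handles finite and infinite \<open>r\<close>
  alike in both.\<close>

lemma less_min_exp_iff: "i < min_exp n r \<longleftrightarrow> i < n \<and> enat i < r"
proof (cases r)
  case (enat q)
  thus ?thesis unfolding min_exp_def by (auto simp: min_def)
qed (simp add: min_exp_def)

lemma enat_min_exp_le: "enat (min_exp n r) \<le> r"
  unfolding min_exp_def by (cases r) (simp_all add: min_def)

lemma arrays_product_group_partition:
  assumes D: "D \<in> plane_arrays R n" and R: "enat R \<le> r" and C: "C \<in> fin_ab_classes"
    and T: "C = iso_class (total_sum D)"
  shows "group_partition C (\<lambda>i. chain_class (D i)) \<and> enat (card {i. \<not> trivial_class (chain_class (D i))}) \<le> r"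
proof -
  note rows = plane_arrays_rows(1)[OF D]
  have A: "D \<in> arrays R n" using D unfolding plane_arrays_def by blast
  have "{i. \<not> trivial_class (chain_class (D i))} \<subseteq> {..<R}"
    using A unfolding trivial_class_chain_class[OF rows] arrays_def by (auto simp: not_less[symmetric])
  hence fin: "finite {i. \<not> trivial_class (chain_class (D i))}"
    and "card {i. \<not> trivial_class (chain_class (D i))} \<le> card {..<R}"
    by (auto intro: finite_subset) (metis card_lessThan card_mono finite_lessThan)
  hence "enat (card {i. \<not> trivial_class (chain_class (D i))}) \<le> r"
    using R by (metis card_lessThan enat_ord_simps(1) order_trans)
  moreover have "embeds_in_class (chain_class (D (Suc i))) (chain_class (D i))" for i
    using D unfolding embeds_in_class_chain_class[OF rows rows] plane_arrays_def by blast
  moreover have "is_direct_sum C (\<lambda>i. chain_class (D i))"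
    using is_direct_sum_chain_class[OF rows A C] T by blast
  ultimately show ?thesis
    unfolding group_partition_def using fin chain_class_in_fin_ab_classes[OF rows] by blast
qed

lemma group_partition_arrays:
  assumes P: "group_partition C P" "enat (card {i. \<not> trivial_class (P i)}) \<le> r"
    and C: "C \<in> classes_of_order n"
  obtains D where "D \<in> plane_arrays (min_exp n r) n" "(\<Prod>i<min_exp n r. \<Prod>j<n. D i j) = n"
    "P = (\<lambda>i. chain_class (D i))" "C = iso_class (total_sum D)"
proof -
  have cl: "C \<in> fin_ab_classes" and ex: "\<exists>G\<in>C. order G = n" using C unfolding classes_of_order_def by auto
  have "\<forall>i. \<exists>d. divisor_chain d \<and> P i = chain_class d"
    using P(1) fin_ab_classesE unfolding group_partition_def by metis
  then obtain D where D: "\<And>i. divisor_chain (D i)" "\<And>i. P i = chain_class (D i)" by metis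
  have PD: "P = (\<lambda>i. chain_class (D i))" using D(2) by blast
  have col: "D (Suc i) j dvd D i j" for i j
    using P(1) embeds_in_class_chain_class[OF D(1) D(1)] unfolding group_partition_def PD by blast
  have colm: "D i' j dvd D i j" if "i \<le> i'" for i i' j
    using that by (induction i' rule: dec_induct) (auto intro: dvd_trans col)
  have nt: "\<not> trivial_class (P i) \<longleftrightarrow> (\<exists>j. D i j \<noteq> 1)" for i
    unfolding D(2) using trivial_class_chain_class[OF D(1)] by blast
  have fin: "finite {i. \<not> trivial_class (P i)}" using P(1) unfolding group_partition_def by blast
  then obtain L where "{i. \<not> trivial_class (P i)} \<subseteq> {..<L}" using finite_nat_iff_bounded by blast
  hence L: "D i j = 1" if "L \<le> i" for i j using that nt by fastforce
  \<comment> \<open>Every row divides the first one entry by entry, so the length of the first row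
    serves for all.\<close>
  obtain M where "\<forall>j\<ge>M. D 0 j = 1" using D(1)[of 0] unfolding divisor_chain_def by blast
  hence M: "D i j = 1" if "M \<le> j" for i j using colm[of 0 i j] that by simp
  have pos: "0 < D i j" for i j using divisor_chain_pos[OF D(1)] .
  have A: "D \<in> arrays L M" unfolding arrays_def using L M pos by blast
  have pA: "D \<in> plane_arrays L M"
    unfolding plane_arrays_def using A col D(1) unfolding divisor_chain_def by blast
  have T: "C = iso_class (total_sum D)"
    using P(1) is_direct_sum_chain_class[OF D(1) A cl] unfolding group_partition_def PD by blast
  from ex obtain G where "G \<in> C" "order G = n" by blast
  hence "order (total_sum D) = n" unfolding T iso_class_def order_def using iso_same_card[of G "total_sum D"] by simp
  hence n: "(\<Prod>i<L. \<Prod>j<M. D i j) = n" using total_sum_order(2)[OF D(1) A] by simp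
  have bd: "i < n \<and> j < n" if "D i j \<noteq> 1" for i j using plane_arrays_bound(1)[OF pA that] unfolding n .
  have "i < min_exp n r" if "D i j \<noteq> 1" for i j
  proof -
    \<comment> \<open>The nontrivial rows form an initial segment, so a nontrivial row
      \<open>i\<close> accounts for at least \<open>Suc i\<close> nontrivial factors; this turns the
      bound on their number into a bound on the row index.\<close>
    have "\<not> trivial_class (P i')" if "i' \<le> i" for i'
      using colm[OF that, of j] \<open>D i j \<noteq> 1\<close> unfolding nt by (metis nat_dvd_1_iff_1)
    hence "card {..i} \<le> card {i. \<not> trivial_class (P i)}" by (intro card_mono[OF fin]) auto
    hence "enat (Suc i) \<le> r" using P(2) by (metis card_atMost enat_ord_simps(1) order_trans)
    hence "enat i < r" using Suc_ile_eq by blast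
    thus ?thesis using bd[OF that] unfolding less_min_exp_iff by blast
  qed
  hence "D i j = 1" if "min_exp n r \<le> i \<or> n \<le> j" for i j using that bd[of i j] by (meson not_less)
  hence A': "D \<in> arrays (min_exp n r) n" unfolding arrays_def using pos by blast
  show ?thesis
  proof (rule that[OF _ _ PD T])
    show "D \<in> plane_arrays (min_exp n r) n" using pA A' unfolding plane_arrays_def by blast
    show "(\<Prod>i<min_exp n r. \<Prod>j<n. D i j) = n" using prod_arrays_eq[OF A A'] n by simp
  qed
qed

text \<open>An array determines the class that it partitions, namely that of its total sum. The sum
  over the classes therefore counts all arrays, fibre by fibre.\<close>

theorem partition_sum_eq_card_plane_arrays:
  assumes n: "0 < n"
  shows "partition_sum r n =
    card {D \<in> plane_arrays (min_exp n r) n. (\<Prod>i<min_exp n r. \<Prod>j<n. D i j) = n}"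
proof -
  define S where "S = {D \<in> plane_arrays (min_exp n r) n. (\<Prod>i<min_exp n r. \<Prod>j<n. D i j) = n}"
  define F where "F C = {D \<in> S. iso_class (total_sum D) = C}" for C
  have finS: "finite S"
  proof (rule finite_subset[OF _ finite_arrays_bounded[of "min_exp n r" n n]], intro subsetI CollectI conjI allI)
    fix D i j assume D: "D \<in> S"
    thus "D \<in> arrays (min_exp n r) n" unfolding S_def plane_arrays_def by blast
    show "D i j \<le> n" using plane_arrays_bound(2)[of D "min_exp n r" n i j] D unfolding S_def by simp
  qed
  have rows: "divisor_chain (D i)" if "D \<in> S" for D i
    using that plane_arrays_rows(1) unfolding S_def by blast
  have cls: "iso_class (total_sum D) \<in> classes_of_order n" if D: "D \<in> S" for D
  proof -
    have A: "D \<in> arrays (min_exp n r) n" using D unfolding S_def plane_arrays_def by blast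
    note o = total_sum_order[OF rows[OF D] A]
    obtain H where "H \<in> iso_class (total_sum D)" using iso_class_nonempty[OF comm_group_total_sum o(1)] .
    moreover from this have "order H = n"
      using o(2) D iso_same_card[of H "total_sum D"] unfolding S_def iso_class_def order_def by simp
    ultimately show ?thesis
      using iso_class_in_fin_ab_classes[OF comm_group_total_sum o(1)] unfolding classes_of_order_def by blast
  qed
  have "group_partition_count r C = card (F C)" if C: "C \<in> classes_of_order n" for C
  proof -
    have "{P. group_partition C P \<and> enat (card {i. \<not> trivial_class (P i)}) \<le> r} = (\<lambda>D i. chain_class (D i)) ` F C"
    proof (intro Set.equalityI subsetI)
      fix P assume "P \<in> {P. group_partition C P \<and> enat (card {i. \<not> trivial_class (P i)}) \<le> r}"
      then obtain D where "D \<in> plane_arrays (min_exp n r) n" "(\<Prod>i<min_exp n r. \<Prod>j<n. D i j) = n"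
        "P = (\<lambda>i. chain_class (D i))" "C = iso_class (total_sum D)"
        using group_partition_arrays[OF _ _ C] by blast
      thus "P \<in> (\<lambda>D i. chain_class (D i)) ` F C" unfolding F_def S_def by blast
    next
      fix P assume "P \<in> (\<lambda>D i. chain_class (D i)) ` F C"
      then obtain D where D: "D \<in> plane_arrays (min_exp n r) n" "C = iso_class (total_sum D)"
        and P: "P = (\<lambda>i. chain_class (D i))" unfolding F_def S_def by blast
      show "P \<in> {P. group_partition C P \<and> enat (card {i. \<not> trivial_class (P i)}) \<le> r}"
        using arrays_product_group_partition[OF D(1) enat_min_exp_le _ D(2)] C
        unfolding P classes_of_order_def by blast
    qed
    moreover have "inj_on (\<lambda>D i. chain_class (D i)) (F C)"
    proof (rule inj_onI)
      fix D E assume D: "D \<in> F C" "E \<in> F C" and eq: "(\<lambda>i. chain_class (D i)) = (\<lambda>i. chain_class (E i))"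
      have "D i = E i" for i
        using D fun_cong[OF eq, of i] unfolding F_def by (intro chain_class_inj rows) auto
      thus "D = E" by blast
    qed
    ultimately show ?thesis unfolding group_partition_count_def by (simp add: card_image)
  qed
  hence "partition_sum r n = (\<Sum>C\<in>classes_of_order n. card (F C))" unfolding partition_sum_def by simp
  also have "\<dots> = card (\<Union>C\<in>classes_of_order n. F C)"
    using finite_classes_of_order[OF n] finS by (intro card_UN_disjoint[symmetric]) (auto simp: F_def)
  also have "(\<Union>C\<in>classes_of_order n. F C) = S" using cls unfolding F_def by blast
  finally show ?thesis unfolding S_def .
qed

theorem partition_sum_eq_card_arrays:
  assumes "0 < n"
  shows "partition_sum r n =
    card {g \<in> arrays (min_exp n r) n. (\<Prod>i<min_exp n r. \<Prod>j<n. g i j ^ (i + j + 1)) = n}"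
  unfolding partition_sum_eq_card_plane_arrays[OF assms] by (rule card_plane_arrays)

section \<open>Zeta products\<close>

lemma min_exp_le: "min_exp m r \<le> m"
  unfolding min_exp_def by (cases r) (auto simp: min_def)

lemma min_exp_1: "1 \<le> r \<Longrightarrow> min_exp 1 r = 1"
  unfolding min_exp_def by (cases r) (auto simp: min_def one_enat_def)

lemma riemann_zeta_sums:
  assumes "2 \<le> m"
  shows "(\<lambda>n. 1 / real (Suc n) ^ m) sums riemann_zeta (real m)"
proof -
  have "summable (\<lambda>n. inverse (real n ^ m))" by (rule inverse_power_summable[OF assms])
  hence "summable (\<lambda>n. inverse (real (Suc n) ^ m))" by (subst summable_Suc_iff)
  moreover have "riemann_zeta (real m) = (\<Sum>n. 1 / real (Suc n) ^ m)"
    unfolding riemann_zeta_def by (simp add: powr_realpow del: of_nat_Suc)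
  ultimately show ?thesis by (simp add: inverse_eq_divide summable_sums del: of_nat_Suc)
qed

text \<open>For \<open>n \<ge> 2\<close> one has
  \<open>1 / n ^ m \<le> (4 / 2 ^ m) * (1 / n ^ 2)\<close>, so 4 times the sum of
  \<open>1 / n ^ 2\<close> over \<open>n \<ge> 2\<close> serves as \<open>B\<close>.\<close>

lemma riemann_zeta_bounds:
  "\<exists>B\<ge>0. \<forall>m\<ge>2. 1 \<le> riemann_zeta (real m) \<and> riemann_zeta (real m) \<le> 1 + B / 2 ^ m"
proof -
  define s where "s = (\<Sum>n. 1 / real (Suc (Suc n)) ^ 2)"
  have sm: "summable (\<lambda>n. 1 / real (Suc (Suc n)) ^ m)" if "2 \<le> m" for m
    using sums_summable[OF riemann_zeta_sums[OF that]] by (subst (asm) summable_Suc_iff[symmetric])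
  have s0: "0 \<le> s" unfolding s_def by (intro suminf_nonneg sm) auto
  have "1 \<le> riemann_zeta (real m) \<and> riemann_zeta (real m) \<le> 1 + 4 * s / 2 ^ m" if m: "2 \<le> m" for m
  proof -
    have z: "riemann_zeta (real m) = 1 + (\<Sum>n. 1 / real (Suc (Suc n)) ^ m)"
      using suminf_split_head[OF sums_summable[OF riemann_zeta_sums[OF m]]]
        sums_unique[OF riemann_zeta_sums[OF m]] by simp
    have 0: "0 \<le> (\<Sum>n. 1 / real (Suc (Suc n)) ^ m)" by (intro suminf_nonneg sm m) auto
    have "1 / real (Suc (Suc n)) ^ m \<le> (4 / 2 ^ m) * (1 / real (Suc (Suc n)) ^ 2)" for n
    proof -
      obtain k where k: "m = k + 2" using m by (metis add.commute le_Suc_ex)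
      have "(2::real) ^ k \<le> real (Suc (Suc n)) ^ k" by (rule power_mono) auto
      hence "1 / real (Suc (Suc n)) ^ k \<le> 1 / 2 ^ k" by (intro frac_le) simp_all
      hence "1 / real (Suc (Suc n)) ^ k * (1 / real (Suc (Suc n)) ^ 2) \<le> 1 / 2 ^ k * (1 / real (Suc (Suc n)) ^ 2)"
        by (intro mult_right_mono) auto
      moreover have "1 / real (Suc (Suc n)) ^ m = 1 / real (Suc (Suc n)) ^ k * (1 / real (Suc (Suc n)) ^ 2)"
        unfolding k by (simp only: power_add) simp
      moreover have "4 / 2 ^ m = (1 / 2 ^ k :: real)" unfolding k by (simp add: power_add)
      ultimately show ?thesis by simp
    qed
    hence "(\<Sum>n. 1 / real (Suc (Suc n)) ^ m) \<le> (\<Sum>n. (4 / 2 ^ m) * (1 / real (Suc (Suc n)) ^ 2))"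
      by (intro suminf_le sm m summable_mult) auto
    also have "\<dots> = (4 / 2 ^ m) * s" unfolding s_def by (intro suminf_mult sm) simp
    finally show ?thesis using z 0 by simp
  qed
  thus ?thesis using s0 by (intro exI[of _ "4 * s"]) auto
qed

lemma summable_linear_geometric: "summable (\<lambda>n. real (Suc n) * (1 / 2) ^ n)"
  using geometric_deriv_sums[of "1 / 2 :: real"] by (auto simp: sums_iff)

text \<open>As \<open>min_exp m r \<le> m\<close>, the logarithm of the factor is at most
  \<open>m * B / 2 ^ m\<close>, which is summable. All factors are at least 1, so bounded partial
  products converge.\<close>

lemma convergent_prod_zeta_factor: "convergent_prod (\<lambda>i. zeta_factor r (i + 2))"
proof -
  obtain B where B0: "0 \<le> B" and lo: "\<And>m. 2 \<le> m \<Longrightarrow> 1 \<le> riemann_zeta (real m)"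
    and B: "\<And>m. 2 \<le> m \<Longrightarrow> riemann_zeta (real m) \<le> 1 + B / 2 ^ m" using riemann_zeta_bounds by blast
  have zf: "1 \<le> zeta_factor r m \<and> zeta_factor r m \<le> exp (real m * (B / 2 ^ m))" if m: "2 \<le> m" for m
  proof
    show "1 \<le> zeta_factor r m" unfolding zeta_factor_def using lo[OF m] by (rule one_le_power)
    have "zeta_factor r m \<le> riemann_zeta (real m) ^ m"
      unfolding zeta_factor_def by (rule power_increasing[OF min_exp_le lo[OF m]])
    also have "\<dots> \<le> (exp (B / 2 ^ m)) ^ m"
      using B[OF m] lo[OF m] exp_ge_add_one_self[of "B / 2 ^ m"] by (intro power_mono) linarith+
    also have "\<dots> = exp (real m * (B / 2 ^ m))" by (rule exp_of_nat_mult[symmetric])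
    finally show "zeta_factor r m \<le> exp (real m * (B / 2 ^ m))" .
  qed
  have "summable (\<lambda>m. real m * (B / 2 ^ m))"
  proof -
    have "summable (\<lambda>n. (B / 2) * (real (Suc n) * (1 / 2) ^ n))"
      by (rule summable_mult[OF summable_linear_geometric])
    hence "summable (\<lambda>n. real (Suc n) * (B / 2 ^ Suc n))" by (simp add: power_divide mult_ac)
    thus ?thesis by (subst (asm) summable_Suc_iff)
  qed
  hence s: "summable (\<lambda>i. real (i + 2) * (B / 2 ^ (i + 2)))" using summable_ignore_initial_segment by blast
  show ?thesis
  proof (rule convergent_prodI_nonneg_bounded)
    show "1 \<le> zeta_factor r (i + 2)" for i using zf[of "i + 2"] by simp
    fix n
    have "(\<Prod>i<n. zeta_factor r (i + 2)) \<le> (\<Prod>i<n. exp (real (i + 2) * (B / 2 ^ (i + 2))))"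
      by (intro prod_mono conjI zf[THEN conjunct2] order_trans[OF zero_le_one zf[THEN conjunct1]]) simp_all
    also have "\<dots> = exp (\<Sum>i<n. real (i + 2) * (B / 2 ^ (i + 2)))" by (rule exp_sum[symmetric]) simp
    also have "\<dots> \<le> exp (\<Sum>i. real (i + 2) * (B / 2 ^ (i + 2)))"
      using B0 s by (intro exp_le_cancel_iff[THEN iffD2] sum_le_suminf) auto
    finally show "(\<Prod>i<n. zeta_factor r (i + 2)) \<le> exp (\<Sum>i. real (i + 2) * (B / 2 ^ (i + 2)))" .
  qed
qed

text \<open>For each of the finitely many primes, Bernoulli's inequality gives
  \<open>1 - (1 - x) ^ k \<le> k * x\<close> with \<open>x \<le> (1 / 2) ^ m\<close> and
  \<open>k \<le> m\<close>, hence absolute convergence.\<close>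

lemma convergent_prod_local_factor: "convergent_prod (\<lambda>i. local_factor r j (i + 1))"
  unfolding local_factor_def
proof (rule convergent_prod_prod)
  fix p assume "p \<in> {p. prime p \<and> p dvd j}"
  hence p: "2 \<le> p" using prime_ge_2_nat by blast
  show "convergent_prod (\<lambda>i. (1 - 1 / real p ^ (i + 1)) ^ min_exp (i + 1) r)"
  proof (rule abs_convergent_prod_imp_convergent_prod, unfold abs_convergent_prod_conv_summable,
      rule summable_comparison_test'[OF summable_mult[OF summable_linear_geometric, of "1 / 2"], of 0])
    fix i :: nat
    define x where "x = 1 / real p ^ (i + 1)"
    define k where "k = min_exp (i + 1) r"
    have "(2::real) ^ (i + 1) \<le> real p ^ (i + 1)" using p by (intro power_mono) auto
    hence x2: "x \<le> (1 / 2) ^ (i + 1)" unfolding x_def power_one_over by (intro frac_le) simp_all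
    have x0: "0 \<le> x" unfolding x_def by simp
    have x1: "x \<le> 1" using x2 power_le_one[of "1 / 2 :: real" "i + 1"] by simp
    have up: "(1 - x) ^ k \<le> 1" using x0 x1 by (intro power_le_one) auto
    have "1 + real k * (- x) \<le> (1 + - x) ^ k" using x1 by (intro Bernoulli_inequality) simp
    hence "1 - (1 - x) ^ k \<le> real k * x" by simp
    also have "\<dots> \<le> real (Suc i) * (1 / 2) ^ (i + 1)"
      using min_exp_le[of "i + 1" r] x2 x0 unfolding k_def by (intro mult_mono) auto
    finally show "norm (norm ((1 - 1 / real p ^ (i + 1)) ^ min_exp (i + 1) r - 1)) \<le> 1 / 2 * (real (Suc i) * (1 / 2) ^ i)"
      using up unfolding x_def[symmetric] k_def[symmetric] by simp
  qed
qed

text \<open>A sieve step: among the numbers without prime factors in \<open>Q\<close>, the multiples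
  of a further prime \<open>p\<close> are \<open>p\<close> times such numbers and carry the fraction
  \<open>1 / p ^ m\<close> of the sum.\<close>

lemma has_sum_power_no_prime_dvd:
  assumes "finite Q" "\<And>p. p \<in> Q \<Longrightarrow> prime p" and m: "2 \<le> m"
  shows "((\<lambda>n. 1 / real n ^ m) has_sum (riemann_zeta (real m) * (\<Prod>p\<in>Q. 1 - 1 / real p ^ m)))
    {n. 0 < n \<and> (\<forall>p\<in>Q. \<not> p dvd n)}"
  using assms(1,2)
proof (induction Q rule: finite_induct)
  case empty
  have "((\<lambda>n. 1 / real (Suc n) ^ m) has_sum riemann_zeta (real m)) UNIV"
    by (rule sums_nonneg_imp_has_sum[OF riemann_zeta_sums[OF m]]) simp
  hence "((\<lambda>n. 1 / real n ^ m) has_sum riemann_zeta (real m)) (range Suc)"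
    by (subst has_sum_reindex) (auto simp: o_def)
  moreover have "range Suc = {n. 0 < n}" by (auto simp: image_iff gr0_conv_Suc)
  ultimately show ?case by simp
next
  case (insert p Q)
  let ?A = "{n. 0 < n \<and> (\<forall>p\<in>Q. \<not> p dvd n)}" and ?f = "\<lambda>n. 1 / real n ^ m"
  let ?s = "riemann_zeta (real m) * (\<Prod>p\<in>Q. 1 - 1 / real p ^ m)"
  have p: "prime p" using insert.prems by simp
  have p0: "0 < p" using p prime_gt_0_nat by blast
  have IH: "(?f has_sum ?s) ?A" using insert by simp
  have "((\<lambda>n. 1 / real p ^ m * ?f n) has_sum (1 / real p ^ m * ?s)) ?A"
    by (rule has_sum_cmult_right[OF IH])
  moreover have "?f \<circ> (\<lambda>n. p * n) = (\<lambda>n. 1 / real p ^ m * ?f n)" by (auto simp: power_mult_distrib)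
  ultimately have im: "(?f has_sum (1 / real p ^ m * ?s)) ((\<lambda>n. p * n) ` ?A)"
    using p0 by (subst has_sum_reindex) (auto simp: inj_on_def)
  have "\<not> q dvd p * n" if "q \<in> Q" "\<not> q dvd n" for q n
  proof -
    have "prime q" "q \<noteq> p" using that insert by auto
    thus ?thesis using p that by (metis prime_dvd_mult_iff primes_dvd_imp_eq)
  qed
  hence sub: "(\<lambda>n. p * n) ` ?A \<subseteq> ?A" using p0 by (intro image_subsetI CollectI conjI ballI) auto
  have "{n. 0 < n \<and> (\<forall>q\<in>insert p Q. \<not> q dvd n)} = ?A - (\<lambda>n. p * n) ` ?A"
  proof (rule Set.set_eqI, rule iffI)
    fix n assume "n \<in> {n. 0 < n \<and> (\<forall>q\<in>insert p Q. \<not> q dvd n)}"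
    thus "n \<in> ?A - (\<lambda>n. p * n) ` ?A" by auto
  next
    fix n assume n: "n \<in> ?A - (\<lambda>n. p * n) ` ?A"
    have "\<not> p dvd n"
    proof
      assume "p dvd n"
      then obtain k where k: "n = p * k" by blast
      hence "k \<in> ?A" using n by (auto intro: dvd_mult)
      thus False using n k by blast
    qed
    thus "n \<in> {n. 0 < n \<and> (\<forall>q\<in>insert p Q. \<not> q dvd n)}" using n by auto
  qed
  moreover have "(?f has_sum (?s - 1 / real p ^ m * ?s)) (?A - (\<lambda>n. p * n) ` ?A)"
    by (rule has_sum_Diff[OF IH im sub])
  moreover have "?s - 1 / real p ^ m * ?s = riemann_zeta (real m) * (\<Prod>p\<in>insert p Q. 1 - 1 / real p ^ m)"
    using insert.hyps by (simp add: algebra_simps)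
  ultimately show ?case by simp
qed

lemma has_sum_power_coprime:
  assumes "0 < j" "2 \<le> m"
  shows "((\<lambda>n. 1 / real n ^ m) has_sum (riemann_zeta (real m) * (\<Prod>p | prime p \<and> p dvd j. 1 - 1 / real p ^ m)))
    {n. 0 < n \<and> coprime n j}"
proof -
  have fin: "finite {p. prime p \<and> p dvd j}" 
    by (rule finite_subset[OF _ finite_divisors_nat[OF assms(1)]]) blast
  have eq: "{n. 0 < n \<and> coprime n j} = {n. 0 < n \<and> (\<forall>p\<in>{p. prime p \<and> p dvd j}. \<not> p dvd n)}"
  proof (intro Collect_cong conj_cong refl)
    fix n
    show "coprime n j \<longleftrightarrow> (\<forall>p\<in>{p. prime p \<and> p dvd j}. \<not> p dvd n)"
    proof (cases "coprime n j")
      case True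
      have "\<not> p dvd n" if "p \<in> {p. prime p \<and> p dvd j}" for p
        using that coprime_common_divisor[OF True, of p] not_prime_unit by blast
      thus ?thesis using True by blast
    next
      case False
      hence "gcd n j \<noteq> 1" by (simp add: coprime_iff_gcd_eq_1)
      then obtain p where "prime p" "p dvd gcd n j" using prime_factor_nat by blast
      thus ?thesis using False by (metis (mono_tags, lifting) gcd_dvd1 gcd_dvd2 dvd_trans mem_Collect_eq)
    qed
  qed
  show ?thesis unfolding eq by (rule has_sum_power_no_prime_dvd[OF fin _ assms(2)]) blast
qed

section \<open>Weighted factorizations\<close>

text \<open>The value 1 off \<open>I\<close> makes the set independent of cells of weight above \<open>n\<close>.\<close>

definition factorizations :: "(nat \<times> nat) set \<Rightarrow> nat \<Rightarrow> (nat \<times> nat \<Rightarrow> nat) set" where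
  "factorizations I n = {h. (\<forall>c. 0 < h c \<and> (c \<notin> I \<longrightarrow> h c = 1)) \<and> (\<Prod>c\<in>I. h c ^ fst c) = n}"

lemma factorizations_power_dvd:
  assumes "finite I" "h \<in> factorizations I n" "c \<in> I"
  shows "h c ^ fst c dvd n"
  using assms dvd_prodI[OF assms(1,3), of "\<lambda>c. h c ^ fst c"] unfolding factorizations_def by auto

lemma factorizations_pos:
  assumes "h \<in> factorizations I n" shows "0 < n"
proof -
  have "0 < (\<Prod>c\<in>I. h c ^ fst c)" using assms unfolding factorizations_def by (intro prod_pos) auto
  thus ?thesis using assms unfolding factorizations_def by auto
qed

lemma factorizations_dvd:
  assumes "finite I" "\<And>c. c \<in> I \<Longrightarrow> 1 \<le> fst c" "h \<in> factorizations I n"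
  shows "h c dvd n"
proof (cases "c \<in> I")
  case True
  have "h c dvd h c ^ fst c" using assms(2)[OF True] by (simp add: dvd_power)
  thus ?thesis using factorizations_power_dvd[OF assms(1,3) True] by (rule dvd_trans)
next
  case False
  hence "h c = 1" using assms(3) unfolding factorizations_def by blast
  thus ?thesis by simp
qed

lemma finite_factorizations:
  assumes "finite I" "\<And>c. c \<in> I \<Longrightarrow> 1 \<le> fst c"
  shows "finite (factorizations I n)"
proof -
  have "finite {h. \<forall>c. (c \<in> I \<longrightarrow> h c \<in> {..n}) \<and> (c \<notin> I \<longrightarrow> h c = 1)}"
    using assms(1) by (rule finite_set_of_finite_funs) simp
  moreover have "h c \<le> n" if "h \<in> factorizations I n" for h c
    using dvd_imp_le[OF factorizations_dvd[OF assms that] factorizations_pos[OF that]] .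
  ultimately show ?thesis by (rule_tac finite_subset) (auto simp: factorizations_def)
qed

lemma factorizations_mono:
  assumes "finite J" "I \<subseteq> J" shows "factorizations I n \<subseteq> factorizations J n"
proof
  fix h assume h: "h \<in> factorizations I n"
  have "(\<Prod>c\<in>I. h c ^ fst c) = (\<Prod>c\<in>J. h c ^ fst c)"
    using h assms unfolding factorizations_def by (intro prod.mono_neutral_left) auto
  thus "h \<in> factorizations J n" using h assms unfolding factorizations_def by auto
qed

text \<open>A value of at least 2 in a cell of weight above \<open>n\<close> would contribute at
  least \<open>2 ^ fst c\<close>, which exceeds \<open>n\<close>.\<close>

lemma factorizations_stable:
  assumes fin: "finite J" and sub: "I \<subseteq> J" and big: "\<And>c. c \<in> J - I \<Longrightarrow> n < fst c"
  shows "factorizations I n = factorizations J n"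
proof (intro Set.equalityI factorizations_mono[OF fin sub] subsetI)
  fix h assume h: "h \<in> factorizations J n"
  have "h c = 1" if c: "c \<in> J - I" for c
  proof (rule ccontr)
    assume "h c \<noteq> 1"
    moreover have "0 < h c" using h unfolding factorizations_def by blast
    ultimately have "2 \<le> h c" by linarith
    hence "2 ^ fst c \<le> h c ^ fst c" by (rule power_mono) simp
    also have "\<dots> \<le> n" using c by (intro dvd_imp_le[OF factorizations_power_dvd[OF fin h] factorizations_pos[OF h]]) blast
    also have "\<dots> < fst c" using big[OF c] .
    finally show False using less_exp[of "fst c"] by simp
  qed
  moreover from this have "(\<Prod>c\<in>I. h c ^ fst c) = (\<Prod>c\<in>J. h c ^ fst c)"
    using fin sub by (intro prod.mono_neutral_left) auto
  ultimately show "h \<in> factorizations I n" using h unfolding factorizations_def by auto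
qed

text \<open>A cell of weight 1 takes whatever remains: once the other cells factor a divisor
  \<open>d\<close> of \<open>n\<close>, its value must be \<open>n div d\<close>.\<close>

lemma card_factorizations_insert:
  assumes fin: "finite I" and w: "\<And>c. c \<in> I \<Longrightarrow> 1 \<le> fst c" and c: "c \<notin> I" "fst c = 1" and n: "0 < n"
  shows "card (factorizations (insert c I) n) = (\<Sum>d | d dvd n. card (factorizations I d))"
proof -
  have b: "bij_betw (\<lambda>h. (\<Prod>c\<in>I. h c ^ fst c, h(c := 1))) (factorizations (insert c I) n)
    (SIGMA d:{d. d dvd n}. factorizations I d)"
  proof (rule bij_betw_byWitness[where f' = "\<lambda>(d, h). h(c := n div d)"])
    have p: "(\<Prod>c'\<in>I. (h(c := x)) c' ^ fst c') = (\<Prod>c\<in>I. h c ^ fst c)" for h :: "nat \<times> nat \<Rightarrow> nat" and x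
      using c(1) by (intro prod.cong) auto
    have e: "h c * (\<Prod>c\<in>I. h c ^ fst c) = n" "0 < (\<Prod>c\<in>I. h c ^ fst c)" if "h \<in> factorizations (insert c I) n" for h
      using that c fin unfolding factorizations_def by (auto intro: prod_pos)
    show "\<forall>h\<in>factorizations (insert c I) n. (case (\<Prod>c\<in>I. h c ^ fst c, h(c := 1)) of (d, h) \<Rightarrow> h(c := n div d)) = h"
    proof
      fix h assume h: "h \<in> factorizations (insert c I) n"
      have "n div (\<Prod>c\<in>I. h c ^ fst c) = h c" using e[OF h] by (metis nonzero_mult_div_cancel_right less_numeral_extra(3))
      thus "(case (\<Prod>c\<in>I. h c ^ fst c, h(c := 1)) of (d, h) \<Rightarrow> h(c := n div d)) = h" by auto
    qed
    show "\<forall>q\<in>SIGMA d:{d. d dvd n}. factorizations I d.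
      (\<Prod>c'\<in>I. (case q of (d, h) \<Rightarrow> h(c := n div d)) c' ^ fst c', (case q of (d, h) \<Rightarrow> h(c := n div d))(c := 1)) = q"
      using c(1) by (auto simp: p factorizations_def fun_eq_iff simp del: fun_upd_apply) (auto simp: fun_upd_apply)
    show "(\<lambda>h. (\<Prod>c\<in>I. h c ^ fst c, h(c := 1))) ` factorizations (insert c I) n \<subseteq> (SIGMA d:{d. d dvd n}. factorizations I d)"
    proof (rule image_subsetI)
      fix h assume h: "h \<in> factorizations (insert c I) n"
      have "(\<Prod>c\<in>I. h c ^ fst c) dvd n" using e(1)[OF h] by (metis dvd_triv_right)
      moreover have "h(c := 1) \<in> factorizations I (\<Prod>c\<in>I. h c ^ fst c)"
        using h unfolding factorizations_def mem_Collect_eq p by auto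
      ultimately show "(\<Prod>c\<in>I. h c ^ fst c, h(c := 1)) \<in> (SIGMA d:{d. d dvd n}. factorizations I d)" by blast
    qed
    show "(\<lambda>(d, h). h(c := n div d)) ` (SIGMA d:{d. d dvd n}. factorizations I d) \<subseteq> factorizations (insert c I) n"
    proof (rule image_subsetI, clarify)
      fix d h assume d: "d dvd n" and h: "h \<in> factorizations I d"
      have "0 < n div d" using d n by (metis dvd_div_eq_0_iff neq0_conv)
      moreover have "(\<Prod>c'\<in>insert c I. (h(c := n div d)) c' ^ fst c') = (n div d) * d"
        using fin c h unfolding prod.insert[OF fin c(1)] p by (simp add: factorizations_def)
      ultimately show "h(c := n div d) \<in> factorizations (insert c I) n"
        using h d unfolding factorizations_def by auto
    qed
  qed
  have "card (factorizations (insert c I) n) = card (SIGMA d:{d. d dvd n}. factorizations I d)"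
    by (rule bij_betw_same_card[OF b])
  also have "\<dots> = (\<Sum>d | d dvd n. card (factorizations I d))"
    using n finite_factorizations[OF fin w] by (intro card_SigmaI) auto
  finally show ?thesis .
qed

section \<open>Array cells sorted by weight\<close>

text \<open>The cell \<open>(m, i)\<close> is the cell of row \<open>i\<close> and column \<open>m - 1 - i\<close>, which has weight \<open>m\<close>.\<close>

definition cells :: "enat \<Rightarrow> nat \<Rightarrow> nat \<Rightarrow> (nat \<times> nat) set" where
  "cells r a K = (SIGMA m:{a..K}. {..<min_exp m r})"

lemma finite_cells: "finite (cells r a K)"
  unfolding cells_def by simp

lemma mem_cells: "(m, i) \<in> cells r a K \<longleftrightarrow> a \<le> m \<and> m \<le> K \<and> i < m \<and> enat i < r"
  unfolding cells_def by (auto simp: less_min_exp_iff)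

lemma prod_cells: "(\<Prod>c\<in>cells r a K. f (fst c)) = (\<Prod>m\<in>{a..K}. f m ^ min_exp m r)"
  unfolding cells_def using prod.Sigma[of "{a..K}" "\<lambda>m. {..<min_exp m r}" "\<lambda>m _. f m"]
  by (simp add: case_prod_beta)

lemma arrays_support:
  assumes g: "g \<in> arrays R C" and n: "(\<Prod>i<R. \<Prod>j<C. g i j ^ (i + j + 1)) = n" and ne: "g i j \<noteq> 1"
  shows "i + j < n"
proof -
  have pos: "0 < g i j" for i j using g unfolding arrays_def by blast
  have "\<not> (R \<le> i \<or> C \<le> j)" using g ne unfolding arrays_def by blast
  hence ij: "i < R" "j < C" by auto
  have n0: "0 < n" unfolding n[symmetric] by (intro prod_pos ballI zero_less_power pos)
  have "g i j ^ (i + j + 1) dvd (\<Prod>j<C. g i j ^ (i + j + 1))"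
    using ij by (intro dvd_prodI[of _ _ "\<lambda>j. g i j ^ (i + j + 1)"]) auto
  also have "\<dots> dvd n" unfolding n[symmetric]
    using ij by (intro dvd_prodI[of _ _ "\<lambda>i. \<Prod>j<C. g i j ^ (i + j + 1)"]) auto
  finally have "g i j ^ (i + j + 1) \<le> n" using n0 by (rule dvd_imp_le)
  moreover have "2 \<le> g i j" using ne pos[of i j] by linarith
  hence "2 ^ (i + j + 1) \<le> g i j ^ (i + j + 1)" by (rule power_mono) simp
  ultimately show ?thesis using less_exp[of "i + j + 1"] by linarith
qed

lemma prod_diagonal_cells:
  fixes h :: "nat \<times> nat \<Rightarrow> nat"
  assumes "\<And>c. c \<notin> cells r 1 n \<Longrightarrow> h c = 1"
  shows "(\<Prod>i<min_exp n r. \<Prod>j<n. h (i + j + 1, i) ^ (i + j + 1)) = (\<Prod>c\<in>cells r 1 n. h c ^ fst c)"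
proof -
  let ?R = "{..<min_exp n r} \<times> {..<n}"
  let ?T = "{(i, j) \<in> ?R. i + j + 1 \<le> n}"
  let ?F = "\<lambda>(i, j). h (i + j + 1, i) ^ (i + j + 1)"
  have "(\<Prod>i<min_exp n r. \<Prod>j<n. h (i + j + 1, i) ^ (i + j + 1)) = prod ?F ?R"
    by (simp add: prod.cartesian_product)
  also have "\<dots> = prod ?F ?T"
  proof (rule prod.mono_neutral_right)
    show "\<forall>x\<in>?R - ?T. ?F x = 1"
    proof
      fix x assume x: "x \<in> ?R - ?T"
      obtain i j where ij: "x = (i, j)" by (cases x)
      have "(i + j + 1, i) \<notin> cells r 1 n" using x unfolding ij by (auto simp: mem_cells)
      from assms[OF this] show "?F x = 1" unfolding ij by simp
    qed
  qed auto
  also have "\<dots> = (\<Prod>c\<in>cells r 1 n. h c ^ fst c)"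
  proof (rule prod.reindex_bij_witness[where i = "\<lambda>(m, i). (i, m - 1 - i)" and j = "\<lambda>(i, j). (i + j + 1, i)"])
    show "(case c of (m, i) \<Rightarrow> (i, m - 1 - i)) \<in> ?T" if "c \<in> cells r 1 n" for c
      using that by (cases c) (auto simp: mem_cells less_min_exp_iff)
    show "(case x of (i, j) \<Rightarrow> (i + j + 1, i)) \<in> cells r 1 n" if "x \<in> ?T" for x
      using that by (cases x) (auto simp: mem_cells less_min_exp_iff)
    show "(case case c of (m, i) \<Rightarrow> (i, m - 1 - i) of (i, j) \<Rightarrow> (i + j + 1, i)) = c" if "c \<in> cells r 1 n" for c
      using that by (cases c) (auto simp: mem_cells)
  qed (auto simp: case_prod_beta)
  finally show ?thesis .
qed

text \<open>The cells of weight at most \<open>n\<close> form the triangle \<open>i + j < n\<close>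
  of the box; by \<open>arrays_support\<close> the entries of the array outside this triangle are
  1.\<close>

lemma card_arrays_eq_card_factorizations:
  "card {g \<in> arrays (min_exp n r) n. (\<Prod>i<min_exp n r. \<Prod>j<n. g i j ^ (i + j + 1)) = n}
    = card (factorizations (cells r 1 n) n)" (is "card ?A = _")
proof (rule bij_betw_same_card[OF bij_betw_byWitness[where f' = "\<lambda>h i j. h (i + j + 1, i)"]])
  let ?f = "\<lambda>g (m, i). if (m, i) \<in> cells r 1 n then g i (m - 1 - i) else (1::nat)"
  have inv_f: "(\<lambda>i j. ?f g (i + j + 1, i)) = g" if g: "g \<in> ?A" for g
  proof (intro ext)
    fix i j
    show "?f g (i + j + 1, i) = g i j"
    proof (cases "(i + j + 1, i) \<in> cells r 1 n")
      case False
      have "g i j = 1"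
      proof (rule ccontr)
        assume ne: "g i j \<noteq> 1"
        have "i + j < n" using arrays_support[of g "min_exp n r" n n i j] g ne by blast
        moreover have "\<not> min_exp n r \<le> i" using g ne unfolding arrays_def by blast
        ultimately show False using False less_min_exp_iff[of i n r] by (simp add: mem_cells)
      qed
      thus ?thesis using False by simp
    qed simp
  qed
  thus "\<forall>g\<in>?A. (\<lambda>i j. ?f g (i + j + 1, i)) = g" by blast
  show "?f ` ?A \<subseteq> factorizations (cells r 1 n) n"
  proof (rule image_subsetI)
    fix g assume g: "g \<in> ?A"
    have off: "?f g c = 1" if "c \<notin> cells r 1 n" for c using that by (cases c) auto
    have "(\<Prod>c\<in>cells r 1 n. ?f g c ^ fst c) = (\<Prod>i<min_exp n r. \<Prod>j<n. ?f g (i + j + 1, i) ^ (i + j + 1))"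
      by (rule prod_diagonal_cells[symmetric]) (rule off)
    also have "\<dots> = n" using g fun_cong[OF fun_cong[OF inv_f[OF g]]] by simp
    finally have "(\<Prod>c\<in>cells r 1 n. ?f g c ^ fst c) = n" .
    moreover have "0 < ?f g c" for c using g unfolding arrays_def by (cases c) auto
    ultimately show "?f g \<in> factorizations (cells r 1 n) n" using off unfolding factorizations_def by blast
  qed
  show "\<forall>h\<in>factorizations (cells r 1 n) n. ?f (\<lambda>i j. h (i + j + 1, i)) = h"
  proof (intro ballI ext)
    fix h c assume "h \<in> factorizations (cells r 1 n) n"
    thus "?f (\<lambda>i j. h (i + j + 1, i)) c = h c"
      by (cases c) (auto simp: factorizations_def mem_cells)
  qed
  show "(\<lambda>h i j. h (i + j + 1, i)) ` factorizations (cells r 1 n) n \<subseteq> ?A"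
  proof (rule image_subsetI)
    fix h assume h: "h \<in> factorizations (cells r 1 n) n"
    hence off: "h c = 1" if "c \<notin> cells r 1 n" for c using that unfolding factorizations_def by blast
    have "(i + j + 1, i) \<notin> cells r 1 n" if "min_exp n r \<le> i \<or> n \<le> j" for i j
      using that less_min_exp_iff[of i n r] by (auto simp: mem_cells)
    hence "(\<lambda>i j. h (i + j + 1, i)) \<in> arrays (min_exp n r) n"
      using off h unfolding arrays_def factorizations_def by blast
    moreover have "(\<Prod>i<min_exp n r. \<Prod>j<n. h (i + j + 1, i) ^ (i + j + 1)) = n"
      using prod_diagonal_cells[of r n h] off h unfolding factorizations_def by simp
    ultimately show "(\<lambda>i j. h (i + j + 1, i)) \<in> ?A" by blast
  qed
qed

text \<open>The coefficients \<open>b\<close> of the divisor sum. Cutting off at weight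
  \<open>n\<close> keeps the index set finite and, by \<open>factorizations_stable\<close>, loses no
  factorization of \<open>n\<close>.\<close>

definition cofactor_count :: "enat \<Rightarrow> nat \<Rightarrow> nat" where
  "cofactor_count r n = card (factorizations (cells r 2 n) n)"

lemma card_factorizations_cells:
  assumes "n \<le> K" shows "card (factorizations (cells r 2 K) n) = cofactor_count r n"
  unfolding cofactor_count_def
  using assms by (intro arg_cong[where f = card] factorizations_stable[symmetric] finite_cells) (auto simp: mem_cells)

lemma card_factorizations_cells_le: "card (factorizations (cells r 2 K) n) \<le> cofactor_count r n"
proof (cases "n \<le> K")
  case True
  thus ?thesis by (simp add: card_factorizations_cells)
next
  case False
  thus ?thesis unfolding cofactor_count_def
    by (intro card_mono finite_factorizations factorizations_mono finite_cells) (auto simp: mem_cells)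
qed

theorem partition_sum_eq_sum_cofactor_count:
  assumes r: "1 \<le> r" and n: "0 < n"
  shows "partition_sum r n = (\<Sum>d | d dvd n. cofactor_count r d)"
proof -
  have r0: "0 < r" using r by (cases r) (auto simp: one_enat_def zero_enat_def)
  \<comment> \<open>Weight 1 occurs only in row 0, column 0, and row 0 is available because
    \<open>1 \<le> r\<close>.\<close>
  have "cells r 1 n = insert (1, 0) (cells r 2 n)"
    using n r0 by (auto simp: mem_cells zero_enat_def[symmetric])
  moreover have "card (factorizations (insert (1, 0) (cells r 2 n)) n) = (\<Sum>d | d dvd n. card (factorizations (cells r 2 n) d))"
    by (rule card_factorizations_insert[OF finite_cells _ _ _ n]) (auto simp: mem_cells)
  ultimately have "partition_sum r n = (\<Sum>d | d dvd n. card (factorizations (cells r 2 n) d))"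
    using partition_sum_eq_card_arrays[OF n] card_arrays_eq_card_factorizations by simp
  also have "\<dots> = (\<Sum>d | d dvd n. cofactor_count r d)"
    using n by (intro sum.cong card_factorizations_cells) (auto dest: dvd_imp_le)
  finally show ?thesis .
qed

section \<open>Dirichlet series of the cofactor counts\<close>

lemma has_sum_pos_ge_1:
  assumes "((\<lambda>n. 1 / real n ^ m) has_sum s) {n. 0 < n \<and> coprime n j}"
  shows "1 \<le> s"
proof -
  have "((\<lambda>n. 1 / real n ^ m) has_sum 1) {1}" by (rule has_sum_finiteI) auto
  thus ?thesis by (rule has_sum_mono_neutral[OF _ assms]) auto
qed

text \<open>All weights are positive, so each value divides the weighted product, and the product is
  coprime to \<open>j\<close> exactly if all values are. The conversion only exchanges the default
  off \<open>I\<close>: \<open>undefined\<close> for tuples, 1 for factorizations.\<close>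

lemma bij_betw_PiE_factorizations:
  assumes fin: "finite I" and w: "\<And>c. c \<in> I \<Longrightarrow> 1 \<le> fst c"
  shows "bij_betw (\<lambda>g. (\<Prod>c\<in>I. g c ^ fst c, \<lambda>c. if c \<in> I then g c else 1))
    (\<Pi>\<^sub>E c\<in>I. {n. 0 < n \<and> coprime n j}) (SIGMA n:{n. 0 < n \<and> coprime n j}. factorizations I n)"
proof (rule bij_betw_byWitness[where f' = "\<lambda>(n, h). restrict h I"])
  have p: "(\<Prod>c\<in>I. (if c \<in> I then g c else 1) ^ fst c) = (\<Prod>c\<in>I. g c ^ fst c)" for g :: "nat \<times> nat \<Rightarrow> nat"
    by (intro prod.cong) auto
  show "\<forall>g\<in>\<Pi>\<^sub>E c\<in>I. {n. 0 < n \<and> coprime n j}.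
      (case (\<Prod>c\<in>I. g c ^ fst c, \<lambda>c. if c \<in> I then g c else 1) of (n, h) \<Rightarrow> restrict h I) = g"
    by (auto simp: PiE_def extensional_def fun_eq_iff)
  show "(\<lambda>g. (\<Prod>c\<in>I. g c ^ fst c, \<lambda>c. if c \<in> I then g c else 1)) ` (\<Pi>\<^sub>E c\<in>I. {n. 0 < n \<and> coprime n j})
      \<subseteq> (SIGMA n:{n. 0 < n \<and> coprime n j}. factorizations I n)"
  proof (rule image_subsetI)
    fix g assume g: "g \<in> (\<Pi>\<^sub>E c\<in>I. {n. 0 < n \<and> coprime n j})"
    have gc: "0 < g c" "coprime (g c) j" if "c \<in> I" for c using PiE_mem[OF g that] by auto
    have "0 < (\<Prod>c\<in>I. g c ^ fst c)" by (intro prod_pos ballI zero_less_power gc)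
    moreover have "coprime (\<Prod>c\<in>I. g c ^ fst c) j" by (intro prod_coprime_left) (simp add: gc)
    moreover have "(\<lambda>c. if c \<in> I then g c else 1) \<in> factorizations I (\<Prod>c\<in>I. g c ^ fst c)"
      unfolding factorizations_def using p gc by simp
    ultimately show "(\<Prod>c\<in>I. g c ^ fst c, \<lambda>c. if c \<in> I then g c else 1) \<in> (SIGMA n:{n. 0 < n \<and> coprime n j}. factorizations I n)"
      by blast
  qed
  have h: "(\<lambda>c. if c \<in> I then (restrict h I) c else 1) = h" "(\<Prod>c\<in>I. (restrict h I) c ^ fst c) = n"
    if "h \<in> factorizations I n" for h n
    using that unfolding factorizations_def by (auto simp: fun_eq_iff simp del: split_paired_All)
  thus "\<forall>q\<in>SIGMA n:{n. 0 < n \<and> coprime n j}. factorizations I n.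
      (\<Prod>c\<in>I. (case q of (n, h) \<Rightarrow> restrict h I) c ^ fst c, \<lambda>c. if c \<in> I then (case q of (n, h) \<Rightarrow> restrict h I) c else 1) = q"
    by auto
  show "(\<lambda>(n, h). restrict h I) ` (SIGMA n:{n. 0 < n \<and> coprime n j}. factorizations I n)
      \<subseteq> (\<Pi>\<^sub>E c\<in>I. {n. 0 < n \<and> coprime n j})"
  proof (rule image_subsetI)
    fix q assume "q \<in> (SIGMA n:{n. 0 < n \<and> coprime n j}. factorizations I n)"
    then obtain n h where q: "q = (n, h)" and n: "coprime n j" and h: "h \<in> factorizations I n" by blast
    have "0 < h c" for c using h unfolding factorizations_def by blast
    moreover have "h c dvd n" for c using w by (rule factorizations_dvd[OF fin _ h])
    hence "coprime (h c) j" for c using n by (rule coprime_divisors[OF _ dvd_refl])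
    ultimately show "(case q of (n, h) \<Rightarrow> restrict h I) \<in> (\<Pi>\<^sub>E c\<in>I. {n. 0 < n \<and> coprime n j})" unfolding q by simp
  qed
qed

text \<open>Multiply out the series of all cells and group the tuples by their weighted product
  \<open>n\<close>; each contributes \<open>1 / n\<close>.\<close>

lemma has_sum_card_factorizations:
  assumes fin: "finite I" and w: "\<And>c. c \<in> I \<Longrightarrow> 1 \<le> fst c"
    and z: "\<And>c. c \<in> I \<Longrightarrow> ((\<lambda>n. 1 / real n ^ fst c) has_sum z (fst c)) {n. 0 < n \<and> coprime n j}"
  shows "((\<lambda>n. real (card (factorizations I n)) / real n) has_sum (\<Prod>c\<in>I. z (fst c))) {n. 0 < n \<and> coprime n j}"
proof -
  let ?N = "{n. 0 < n \<and> coprime n j}"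
  have b: "bij_betw (\<lambda>g. (\<Prod>c\<in>I. g c ^ fst c, \<lambda>c. if c \<in> I then g c else 1)) (\<Pi>\<^sub>E c\<in>I. ?N)
      (SIGMA n:?N. factorizations I n)"
    using w by (rule bij_betw_PiE_factorizations[OF fin])
  have "(\<lambda>n. 1 / real n ^ fst c) abs_summable_on ?N" if "c \<in> I" for c
    using z[OF that] unfolding summable_on_def by auto
  hence "infsum (\<lambda>g. \<Prod>c\<in>I. 1 / real (g c) ^ fst c) (\<Pi>\<^sub>E c\<in>I. ?N) = (\<Prod>c\<in>I. infsum (\<lambda>n. 1 / real n ^ fst c) ?N)"
    by (rule infsum_prod_PiE_abs[OF fin])
  also have "\<dots> = (\<Prod>c\<in>I. z (fst c))" using z by (intro prod.cong refl infsumI)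
  finally have inf: "infsum (\<lambda>g. \<Prod>c\<in>I. 1 / real (g c) ^ fst c) (\<Pi>\<^sub>E c\<in>I. ?N) = (\<Prod>c\<in>I. z (fst c))" .
  \<comment> \<open>A family that is not summable has \<open>infsum\<close> 0 by convention, so a
    positive value proves summability.\<close>
  have "0 < (\<Prod>c\<in>I. z (fst c))"
    using has_sum_pos_ge_1[OF z] by (intro prod_pos ballI) (rule less_le_trans[OF zero_less_one])
  hence "(\<lambda>g. \<Prod>c\<in>I. 1 / real (g c) ^ fst c) summable_on (\<Pi>\<^sub>E c\<in>I. ?N)"
    using inf infsum_not_exists by fastforce
  hence "((\<lambda>g. \<Prod>c\<in>I. 1 / real (g c) ^ fst c) has_sum (\<Prod>c\<in>I. z (fst c))) (\<Pi>\<^sub>E c\<in>I. ?N)"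
    using inf by (simp add: has_sum_iff)
  hence "((\<lambda>g. (\<lambda>(n, h). 1 / real n) (\<Prod>c\<in>I. g c ^ fst c, \<lambda>c. if c \<in> I then g c else 1))
      has_sum (\<Prod>c\<in>I. z (fst c))) (\<Pi>\<^sub>E c\<in>I. ?N)"
    by (simp add: prod_dividef)
  hence "((\<lambda>(n, h). 1 / real n) has_sum (\<Prod>c\<in>I. z (fst c))) (SIGMA n:?N. factorizations I n)"
    using has_sum_reindex_bij_betw[OF b, where f = "\<lambda>(n, h). 1 / real n"] by blast
  thus ?thesis
  proof (rule has_sum_SigmaD)
    fix n
    show "((\<lambda>h. case (n, h) of (n, h) \<Rightarrow> 1 / real n) has_sum real (card (factorizations I n)) / real n) (factorizations I n)"
      by (rule has_sum_finiteI[OF finite_factorizations[OF fin w]]) auto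
  qed
qed

lemma local_factor_altdef:
  "local_factor r j m = (\<Prod>p | prime p \<and> p dvd j. 1 - 1 / real p ^ m) ^ min_exp m r"
  unfolding local_factor_def by (rule prod_power_distrib[symmetric])

text \<open>Restricting to the weights 2 to \<open>n + 2\<close> gives the partial product
  \<open>Z n\<close> exactly. The restricted counts are correct for arguments up to
  \<open>n + 2\<close> and never too large, so the sum of \<open>\<beta>\<close> is bounded above by
  the limit of \<open>Z\<close> and below by each \<open>Z n\<close>.\<close>

lemma cofactor_count_sums:
  assumes j: "0 < j"
  shows "(\<lambda>d. if 0 < d \<and> coprime d j then real (cofactor_count r d) / real d else 0) sums
    ((\<Prod>i. zeta_factor r (i + 2)) * (\<Prod>i. local_factor r j (i + 2)))"
proof -
  let ?N = "{n. 0 < n \<and> coprime n j}"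
  define z where "z m = riemann_zeta (real m) * (\<Prod>p | prime p \<and> p dvd j. 1 - 1 / real p ^ m)" for m
  define \<beta> where "\<beta> d = (if 0 < d \<and> coprime d j then real (cofactor_count r d) / real d else 0)" for d
  define \<beta>K where "\<beta>K K d = (if 0 < d \<and> coprime d j then real (card (factorizations (cells r 2 K) d)) / real d else 0)" for K d
  define Z where "Z n = (\<Prod>i\<le>n. zeta_factor r (i + 2) * local_factor r j (i + 2))" for n
  define L where "L = (\<Prod>i. zeta_factor r (i + 2)) * (\<Prod>i. local_factor r j (i + 2))"
  have zs: "((\<lambda>n. 1 / real n ^ m) has_sum z m) ?N" if "2 \<le> m" for m
    unfolding z_def by (rule has_sum_power_coprime[OF j that])
  have sumsK: "\<beta>K (n + 2) sums Z n" for n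
  proof -
    have "((\<lambda>d. real (card (factorizations (cells r 2 (n + 2)) d)) / real d) has_sum (\<Prod>c\<in>cells r 2 (n + 2). z (fst c))) ?N"
      by (rule has_sum_card_factorizations[OF finite_cells]) (auto simp: mem_cells intro: zs)
    also have "(\<Prod>c\<in>cells r 2 (n + 2). z (fst c)) = (\<Prod>m\<in>{2..n + 2}. z m ^ min_exp m r)" by (rule prod_cells)
    also have "\<dots> = (\<Prod>i\<in>{0..n}. z (i + 2) ^ min_exp (i + 2) r)" 
      by (rule prod.reindex_bij_witness[where i = "\<lambda>i. i + 2" and j = "\<lambda>m. m - 2"])
        (auto simp del: add_2_eq_Suc')
    also have "\<dots> = Z n"
      unfolding Z_def atMost_atLeast0 z_def zeta_factor_def local_factor_altdef power_mult_distrib ..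
    finally have "((\<lambda>d. real (card (factorizations (cells r 2 (n + 2)) d)) / real d) has_sum Z n) ?N" .
    hence "(\<beta>K (n + 2) has_sum Z n) UNIV"
      by (rule has_sum_cong_neutral[THEN iffD1, rotated -1]) (auto simp: \<beta>K_def)
    thus ?thesis by (rule has_sum_imp_sums)
  qed
  have conv_l: "convergent_prod (\<lambda>i. local_factor r j (i + 2))"
    using convergent_prod_iff_shift[of "\<lambda>i. local_factor r j (i + 1)" 1] convergent_prod_local_factor by simp
  have conv: "convergent_prod (\<lambda>i. zeta_factor r (i + 2) * local_factor r j (i + 2))"
    by (rule convergent_prod_mult[OF convergent_prod_zeta_factor conv_l])
  have L: "L = (\<Prod>i. zeta_factor r (i + 2) * local_factor r j (i + 2))"
    unfolding L_def by (rule prodinf_mult[OF convergent_prod_zeta_factor conv_l])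
  have lim: "Z \<longlonglongrightarrow> L" unfolding Z_def L by (rule convergent_prod_LIMSEQ[OF conv])
  have "1 \<le> zeta_factor r (i + 2) * local_factor r j (i + 2)" for i
  proof -
    have "zeta_factor r (i + 2) * local_factor r j (i + 2) = z (i + 2) ^ min_exp (i + 2) r"
      unfolding z_def zeta_factor_def local_factor_altdef power_mult_distrib ..
    thus ?thesis using has_sum_pos_ge_1[OF zs[of "i + 2"]] by simp
  qed
  note ge1 = this
  have "incseq Z"
  proof (rule incseq_SucI)
    fix n
    have "0 \<le> Z n" unfolding Z_def using ge1 by (intro prod_nonneg ballI) (rule order_trans[OF zero_le_one])
    hence "Z n * 1 \<le> Z n * (zeta_factor r (Suc n + 2) * local_factor r j (Suc n + 2))"
      by (rule mult_left_mono[OF ge1])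
    thus "Z n \<le> Z (Suc n)" unfolding Z_def by simp
  qed
  hence ZL: "Z n \<le> L" for n by (rule incseq_le[OF _ lim])
  have nonneg: "0 \<le> \<beta> d" for d unfolding \<beta>_def by simp
  have partial: "(\<Sum>d<n. \<beta> d) \<le> L" for n
  proof -
    have "(\<Sum>d<n. \<beta> d) = (\<Sum>d<n. \<beta>K (n + 2) d)"
      by (intro sum.cong refl) (auto simp: \<beta>_def \<beta>K_def card_factorizations_cells)
    also have "\<dots> \<le> suminf (\<beta>K (n + 2))"
      by (intro sum_le_suminf sums_summable[OF sumsK]) (auto simp: \<beta>K_def)
    also have "\<dots> \<le> L" unfolding sums_unique[OF sumsK[of n], symmetric] by (rule ZL)
    finally show ?thesis .
  qed
  have sm: "summable \<beta>" by (rule summableI_nonneg_bounded[OF nonneg partial])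
  have "Z n \<le> suminf \<beta>" for n
    unfolding sums_unique[OF sumsK[of n]]
    by (intro suminf_le sums_summable[OF sumsK] sm) (auto simp: \<beta>_def \<beta>K_def card_factorizations_cells_le divide_right_mono)
  hence "L \<le> suminf \<beta>" by (intro LIMSEQ_le_const2[OF lim]) auto
  moreover have "suminf \<beta> \<le> L" by (rule suminf_le_const[OF sm partial])
  ultimately have "\<beta> sums L" using sm by (simp add: sums_iff)
  thus ?thesis unfolding \<beta>_def L_def .
qed

text \<open>Since \<open>min_exp 1 r = 1\<close>, the local factor with \<open>m = 1\<close> is
  \<phi>(j)/j by Euler's product formula. It turns the denominator \<phi>(j) into
  \<open>j\<close>.\<close>

lemma progression_const_eq:
  assumes r: "1 \<le> r" and j: "0 < j"
  shows "progression_const r j / real (totient j)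
    = ((\<Prod>i. zeta_factor r (i + 2)) * (\<Prod>i. local_factor r j (i + 2))) / real j"
proof -
  have e: "{p. prime p \<and> p dvd j} = prime_factors j" using j by (auto simp: prime_factors_dvd)
  have t: "local_factor r j 1 = real (totient j) / real j"
    unfolding local_factor_altdef min_exp_1[OF r] e using j totient_formula2[of j] by simp
  have t0: "0 < real (totient j)" using j by simp
  have "local_factor r j (0 + 1) \<noteq> 0" using t t0 j by simp
  hence "(\<Prod>i. local_factor r j (i + 1)) = local_factor r j 1 * (\<Prod>i. local_factor r j (i + 2))"
    using prodinf_split_head[OF convergent_prod_local_factor[of r j]] by (simp add: field_simps)
  thus ?thesis unfolding progression_const_def t using t0 j by (simp add: field_simps)
qed

lemma progression_const_1: "progression_const r 1 = zeta_const r"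
proof -
  have "local_factor r 1 m = 1" for m unfolding local_factor_def by (rule prod.neutral) auto
  thus ?thesis unfolding progression_const_def zeta_const_def by simp
qed

section \<open>Divisor sums in arithmetic progressions\<close>

text \<open>The map \<open>e div j\<close> is injective on a residue class, so it suffices to
  enclose its image between two intervals.\<close>

lemma card_residue_bounds:
  fixes j c Y :: nat
  assumes c: "c < j"
  shows "real (card {e. 0 < e \<and> e \<le> Y \<and> e mod j = c}) \<le> real Y / real j + 1"
    and "real Y / real j - 2 \<le> real (card {e. 0 < e \<and> e \<le> Y \<and> e mod j = c})"
proof -
  let ?A = "{e. 0 < e \<and> e \<le> Y \<and> e mod j = c}"
  have fin: "finite ?A" by (rule finite_subset[of _ "{..Y}"]) auto
  have inj: "inj_on (\<lambda>e. e div j) ?A"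
    by (rule inj_onI) (metis (mono_tags, lifting) div_mult_mod_eq mem_Collect_eq)
  have j0: "0 < real j" using c by simp
  have q1: "real (Y div j) \<le> real Y / real j" by (rule of_nat_div_le_of_nat)
  have q2: "real Y / real j - 1 \<le> real (Y div j)"
  proof -
    have "real Y = real (Y div j) * real j + real (Y mod j)" by (metis div_mult_mod_eq of_nat_add of_nat_mult)
    also have "\<dots> \<le> real (Y div j) * real j + real j" using c by (simp add: less_imp_le)
    finally show ?thesis using j0 by (simp add: field_simps)
  qed
  have "card ?A = card ((\<lambda>e. e div j) ` ?A)" by (rule card_image[OF inj, symmetric])
  also have "\<dots> \<le> card {..Y div j}" by (intro card_mono) (auto intro: div_le_mono)
  finally show "real (card ?A) \<le> real Y / real j + 1" using q1 by simp
  \<comment> \<open>Quotient 0 is left out because for \<open>c = 0\<close> it belongs to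
    \<open>e = 0\<close>, and the quotient \<open>Y div j\<close> because its element may exceed
    \<open>Y\<close>.\<close>
  have "{1..<Y div j} \<subseteq> (\<lambda>e. e div j) ` ?A"
  proof
    fix q assume q: "q \<in> {1..<Y div j}"
    have "q * j + c < Suc q * j" using c by simp
    also have "\<dots> \<le> (Y div j) * j" using q by (intro mult_right_mono) auto
    also have "\<dots> \<le> Y" by simp
    finally have "q * j + c \<le> Y" by simp
    moreover have "0 < q * j" using q c by simp
    ultimately have m: "q * j + c \<in> ?A" and e: "q = (q * j + c) div j" using c by auto
    show "q \<in> (\<lambda>e. e div j) ` ?A" by (rule image_eqI[where x = "q * j + c"]) (rule e, rule m)
  qed
  hence "card {1..<Y div j} \<le> card ((\<lambda>e. e div j) ` ?A)" using fin by (intro card_mono) auto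
  hence "Y div j - 1 \<le> card ?A" using card_image[OF inj] by simp
  thus "real Y / real j - 2 \<le> real (card ?A)" using q2 by linarith
qed

definition multiples_count :: "nat \<Rightarrow> nat \<Rightarrow> nat \<Rightarrow> real \<Rightarrow> nat" where
  "multiples_count j k d x = card {e. 0 < e \<and> real (d * e) \<le> x \<and> [d * e = k] (mod j)}"

text \<open>Being uniform in \<open>x\<close>, this bound provides the majorant for the passage to
  the limit.\<close>

lemma multiples_count_le:
  assumes "0 < d" "0 \<le> x" shows "real (multiples_count j k d x) * real d \<le> x"
    and "finite {e. 0 < e \<and> real (d * e) \<le> x \<and> [d * e = k] (mod j)}"
proof -
  have sub: "{e. 0 < e \<and> real (d * e) \<le> x \<and> [d * e = k] (mod j)} \<subseteq> {0<..nat \<lfloor>x / real d\<rfloor>}"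
  proof
    fix e assume "e \<in> {e. 0 < e \<and> real (d * e) \<le> x \<and> [d * e = k] (mod j)}"
    hence "0 < e" "real e \<le> x / real d" using assms by (auto simp: field_simps)
    thus "e \<in> {0<..nat \<lfloor>x / real d\<rfloor>}" using le_nat_floor by auto
  qed
  thus "finite {e. 0 < e \<and> real (d * e) \<le> x \<and> [d * e = k] (mod j)}" by (rule finite_subset) simp
  have "multiples_count j k d x \<le> nat \<lfloor>x / real d\<rfloor>"
    unfolding multiples_count_def using card_mono[OF _ sub] by simp
  hence "real (multiples_count j k d x) \<le> real (nat \<lfloor>x / real d\<rfloor>)" by simp
  also have "\<dots> \<le> x / real d" using assms by simp
  finally show "real (multiples_count j k d x) * real d \<le> x" using assms by (simp add: field_simps)
qed

text \<open>As \<open>d\<close> is invertible modulo \<open>j\<close>, the condition on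
  \<open>d * e\<close> is a single residue class for \<open>e\<close>. The error 3 is composed of 2
  from counting that class and 1 from rounding \<open>x / d\<close> to an integer.\<close>

lemma multiples_count_approx:
  assumes d: "0 < d" "coprime d j" and j: "0 < j" and x: "0 \<le> x"
  shows "\<bar>real (multiples_count j k d x) - x / (real d * real j)\<bar> \<le> 3"
proof -
  obtain d' where d': "[d * d' = Suc 0] (mod j)" using cong_solve_coprime_nat[OF d(2)] by blast
  define c where "c = (d' * k) mod j"
  have c: "c < j" unfolding c_def using j by simp
  have "[d * c = 1 * k] (mod j)"
  proof -
    have "[d * c = d * (d' * k)] (mod j)" unfolding c_def by (intro cong_scalar_left) (simp add: cong_def)
    also have "d * (d' * k) = (d * d') * k" by simp
    also have "[(d * d') * k = 1 * k] (mod j)" using d' by (intro cong_scalar_right) simp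
    finally show ?thesis .
  qed
  hence dc: "[d * c = k] (mod j)" by simp
  have iff: "[d * e = k] (mod j) \<longleftrightarrow> e mod j = c" for e
  proof -
    have "[d * e = k] (mod j) \<longleftrightarrow> [d * e = d * c] (mod j)" using dc by (metis cong_sym cong_trans)
    also have "\<dots> \<longleftrightarrow> [e = c] (mod j)" by (rule cong_mult_lcancel_nat[OF d(2)])
    also have "\<dots> \<longleftrightarrow> e mod j = c" using c by (simp add: cong_def)
    finally show ?thesis .
  qed
  define Y where "Y = nat \<lfloor>x / real d\<rfloor>"
  have xd: "0 \<le> x / real d" using x by simp
  have le: "real (d * e) \<le> x \<longleftrightarrow> e \<le> Y" for e
  proof -
    have "real (d * e) \<le> x \<longleftrightarrow> real e \<le> x / real d" using d by (simp add: field_simps)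
    also have "\<dots> \<longleftrightarrow> e \<le> Y" unfolding Y_def using xd by (simp add: le_nat_iff le_floor_iff)
    finally show ?thesis .
  qed
  have eq: "multiples_count j k d x = card {e. 0 < e \<and> e \<le> Y \<and> e mod j = c}"
    unfolding multiples_count_def le iff ..
  have Y1: "real Y \<le> x / real d" and Y2: "x / real d - 1 \<le> real Y" unfolding Y_def using xd by linarith+
  have j1: "1 \<le> real j" using j by simp
  have "real Y / real j \<le> x / (real d * real j)"
    using divide_right_mono[OF Y1, of "real j"] by simp
  moreover have "x / (real d * real j) - 1 \<le> real Y / real j"
  proof -
    have "(x / real d - 1) / real j \<le> real Y / real j" by (rule divide_right_mono[OF Y2]) simp
    moreover have "1 / real j \<le> 1" using j1 by simp
    ultimately show ?thesis by (simp add: diff_divide_distrib)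
  qed
  ultimately show ?thesis using card_residue_bounds[OF c, of Y] unfolding eq by linarith
qed

lemma multiples_count_tendsto:
  assumes d: "0 < d" "coprime d j" and j: "0 < j"
  shows "((\<lambda>x. real d * real (multiples_count j k d x) / x) \<longlongrightarrow> 1 / real j) at_top"
proof (rule tendstoI)
  fix e :: real assume e: "0 < e"
  have "eventually (\<lambda>x. max 1 (3 * real d / e + 1) \<le> x) at_top" by (rule eventually_ge_at_top)
  thus "eventually (\<lambda>x. dist (real d * real (multiples_count j k d x) / x) (1 / real j) < e) at_top"
  proof eventually_elim
    case (elim x)
    hence x: "0 < x" "3 * real d / e < x" by linarith+
    have "real d * real (multiples_count j k d x) / x - 1 / real j =
        real d / x * (real (multiples_count j k d x) - x / (real d * real j))"
      using x d j by (simp add: field_simps)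
    hence "\<bar>real d * real (multiples_count j k d x) / x - 1 / real j\<bar> =
        real d / x * \<bar>real (multiples_count j k d x) - x / (real d * real j)\<bar>"
      using x by (simp add: abs_mult)
    also have "\<dots> \<le> real d / x * 3"
      using multiples_count_approx[OF d j less_imp_le[OF x(1)]] x by (intro mult_left_mono) auto
    also have "\<dots> < e" using x e by (simp add: field_simps)
    finally show ?case by (simp add: dist_real_def)
  qed
qed

lemma sum_divisor_sum:
  fixes b :: "nat \<Rightarrow> real"
  assumes x: "0 \<le> x"
  shows "(\<Sum>n | 0 < n \<and> real n \<le> x \<and> [n = k] (mod j). \<Sum>d | d dvd n. b d)
    = (\<Sum>d\<in>{0<..nat \<lfloor>x\<rfloor>}. b d * real (multiples_count j k d x))"
proof -
  let ?A = "{n. 0 < n \<and> real n \<le> x \<and> [n = k] (mod j)}"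
  let ?E = "\<lambda>d. {e. 0 < e \<and> real (d * e) \<le> x \<and> [d * e = k] (mod j)}"
  have fl: "real n \<le> x \<longleftrightarrow> n \<le> nat \<lfloor>x\<rfloor>" for n using x by (simp add: le_nat_iff le_floor_iff)
  have fin: "finite ?A" by (rule finite_subset[of _ "{..nat \<lfloor>x\<rfloor>}"]) (auto simp: fl)
  have "(\<Sum>n\<in>?A. \<Sum>d | d dvd n. b d) = (\<Sum>(n, d)\<in>(SIGMA n:?A. {d. d dvd n}). b d)"
    using fin by (intro sum.Sigma) auto
  also have "\<dots> = (\<Sum>(d, e)\<in>(SIGMA d:{0<..nat \<lfloor>x\<rfloor>}. ?E d). b d)"
  proof (rule sum.reindex_bij_witness[where i = "\<lambda>(d, e). (d * e, d)" and j = "\<lambda>(n, d). (d, n div d)"])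
    fix p assume "p \<in> (SIGMA n:?A. {d. d dvd n})"
    then obtain n d where p: "p = (n, d)" "0 < n" "real n \<le> x" "[n = k] (mod j)" "d dvd n" by auto
    obtain e where e: "n = d * e" using p(5) by blast
    have "0 < d" "0 < e" using p e by (auto intro: Nat.gr0I)
    moreover have "d \<le> n" using p by (intro dvd_imp_le)
    moreover have "n \<le> nat \<lfloor>x\<rfloor>" using p(3) fl by blast
    moreover from calculation have "d \<le> nat \<lfloor>x\<rfloor>" by linarith
    ultimately show "(case case p of (n, d) \<Rightarrow> (d, n div d) of (d, e) \<Rightarrow> (d * e, d)) = p"
      "(case p of (n, d) \<Rightarrow> (d, n div d)) \<in> (SIGMA d:{0<..nat \<lfloor>x\<rfloor>}. ?E d)"
      using p e by auto
    show "(case case p of (n, d) \<Rightarrow> (d, n div d) of (d, e) \<Rightarrow> b d) = (case p of (n, d) \<Rightarrow> b d)"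
      unfolding p by simp
  next
    fix q assume "q \<in> (SIGMA d:{0<..nat \<lfloor>x\<rfloor>}. ?E d)"
    then obtain d e where q: "q = (d, e)" "0 < d" "0 < e" "real (d * e) \<le> x" "[d * e = k] (mod j)" by auto
    thus "(case case q of (d, e) \<Rightarrow> (d * e, d) of (n, d) \<Rightarrow> (d, n div d)) = q"
      "(case q of (d, e) \<Rightarrow> (d * e, d)) \<in> (SIGMA n:?A. {d. d dvd n})" by auto
  qed
  also have "\<dots> = (\<Sum>d\<in>{0<..nat \<lfloor>x\<rfloor>}. \<Sum>e\<in>?E d. b d)"
    by (rule sum.Sigma[symmetric]) (use multiples_count_le(2)[OF _ x] in auto)
  also have "\<dots> = (\<Sum>d\<in>{0<..nat \<lfloor>x\<rfloor>}. b d * real (multiples_count j k d x))"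
    unfolding multiples_count_def by (simp add: mult.commute)
  finally show ?thesis .
qed

text \<open>After exchanging the sums, Tannery's theorem applies to the terms \<open>a d x\<close>
  with majorant \<open>\<beta>\<close>. A divisor not coprime to \<open>j\<close> has no multiple in
  a class prime to \<open>j\<close>, so the value 0 of \<open>\<beta>\<close> there is the right
  one.\<close>

theorem divisor_sum_progression_tendsto:
  fixes b :: "nat \<Rightarrow> real"
  assumes b: "\<And>d. 0 \<le> b d" and j: "0 < j" and k: "coprime j k"
    and Z: "(\<lambda>d. if 0 < d \<and> coprime d j then b d / real d else 0) sums Z"
  shows "((\<lambda>x. (\<Sum>n | 0 < n \<and> real n \<le> x \<and> [n = k] (mod j). \<Sum>d | d dvd n. b d) / x) \<longlongrightarrow> Z / real j) at_top"
proof -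
  define \<beta> where "\<beta> d = (if 0 < d \<and> coprime d j then b d / real d else 0)" for d
  define a where "a d x = \<beta> d * (real d * real (multiples_count j k d x) / x)" for d x
  have \<beta>0: "0 \<le> \<beta> d" for d unfolding \<beta>_def using b by simp
  have \<beta>s: "\<beta> sums Z" using Z unfolding \<beta>_def .
  have lim: "(a d \<longlongrightarrow> \<beta> d / real j) at_top" for d
  proof (cases "0 < d \<and> coprime d j")
    case True
    thus ?thesis unfolding a_def
      using tendsto_mult_left[OF multiples_count_tendsto[of d j k], of "\<beta> d"] j by simp
  next
    case False
    thus ?thesis unfolding a_def \<beta>_def by auto
  qed
  have bound: "norm (a d x) \<le> \<beta> d" if x: "0 < x" for d x
  proof (cases "0 < d")
    case True
    have "real d * real (multiples_count j k d x) / x \<le> 1"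
      using multiples_count_le(1)[OF True less_imp_le[OF x], of j k] x by (simp add: mult.commute)
    hence "\<beta> d * (real d * real (multiples_count j k d x) / x) \<le> \<beta> d * 1" by (rule mult_left_mono) (rule \<beta>0)
    moreover have "0 \<le> a d x" unfolding a_def using \<beta>0 x by simp
    ultimately show ?thesis unfolding a_def by simp
  qed (simp add: a_def \<beta>_def)
  have ev: "eventually (\<lambda>(d, x). norm (a d x) \<le> \<beta> d) (at_top \<times>\<^sub>F at_top)"
  proof -
    have "eventually (\<lambda>(d::nat, x::real). 0 < x) (at_top \<times>\<^sub>F at_top)"
      by (subst eventually_prod2) (auto intro: eventually_gt_at_top)
    thus ?thesis by (rule eventually_mono) (auto intro: bound[unfolded real_norm_def])
  qed
  have "(\<Sum>d. \<beta> d / real j) = Z / real j"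
    by (rule sums_unique[OF sums_divide[OF \<beta>s, of "real j"], symmetric])
  hence L: "((\<lambda>x. suminf (\<lambda>d. a d x)) \<longlongrightarrow> Z / real j) at_top"
    using tannerys_theorem[OF lim ev sums_summable[OF \<beta>s]] by simp
  have "eventually (\<lambda>x. suminf (\<lambda>d. a d x)
      = (\<Sum>n | 0 < n \<and> real n \<le> x \<and> [n = k] (mod j). \<Sum>d | d dvd n. b d) / x) at_top"
    using eventually_gt_at_top[of "0::real"]
  proof eventually_elim
    case (elim x)
    have out: "a d x = 0" if d: "d \<notin> {0<..nat \<lfloor>x\<rfloor>}" for d
    proof (cases "d = 0")
      case False
      hence big: "x < real d" using d elim by (simp add: not_le floor_less_iff nat_less_iff) 
      have "\<not> real (d * e) \<le> x" if "0 < e" for e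
      proof -
        have "real d * 1 \<le> real d * real e" using that by (intro mult_left_mono) auto
        thus ?thesis using big by simp
      qed
      hence "{e. 0 < e \<and> real (d * e) \<le> x \<and> [d * e = k] (mod j)} = {}" by blast
      hence "multiples_count j k d x = 0" unfolding multiples_count_def by (simp only: card.empty)
      thus ?thesis unfolding a_def by simp
    qed (simp add: a_def)
    have val: "a d x = b d * real (multiples_count j k d x) / x" if d: "d \<in> {0<..nat \<lfloor>x\<rfloor>}" for d
    proof (cases "coprime d j")
      case True
      thus ?thesis using d unfolding a_def \<beta>_def by simp
    next
      case False
      have "\<not> [d * e = k] (mod j)" for e
      proof
        assume "[d * e = k] (mod j)"
        hence "coprime (d * e) j" using k by (metis cong_imp_coprime cong_sym coprime_commute)
        thus False using False by simp
      qed
      hence "multiples_count j k d x = 0" unfolding multiples_count_def by simp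
      thus ?thesis using False unfolding a_def \<beta>_def by simp
    qed
    have "suminf (\<lambda>d. a d x) = (\<Sum>d\<in>{0<..nat \<lfloor>x\<rfloor>}. a d x)" by (rule suminf_finite) (auto intro: out)
    also have "\<dots> = (\<Sum>d\<in>{0<..nat \<lfloor>x\<rfloor>}. b d * real (multiples_count j k d x)) / x"
      unfolding sum_divide_distrib by (rule sum.cong[OF refl val])
    finally show ?case using sum_divisor_sum[of x b k j] elim by simp
  qed
  thus ?thesis by (rule Lim_transform_eventually[OF L])
qed

theorem progression_asymptotics:
  assumes r: "1 \<le> r" and j: "0 < j" and k: "coprime j k"
  shows "(\<lambda>x::real. (\<Sum>n | 0 < n \<and> real n \<le> x \<and> [n = k] (mod j). real (partition_sum r n))
      - progression_const r j / real (totient j) * x) \<in> o[at_top](\<lambda>x. x)"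
proof (rule smalloI_tendsto)
  define C where "C = progression_const r j / real (totient j)"
  let ?S = "\<lambda>x::real. \<Sum>n | 0 < n \<and> real n \<le> x \<and> [n = k] (mod j). real (partition_sum r n)"
  have S: "?S x = (\<Sum>n | 0 < n \<and> real n \<le> x \<and> [n = k] (mod j). \<Sum>d | d dvd n. real (cofactor_count r d))" for x
    by (rule sum.cong[OF refl]) (simp add: partition_sum_eq_sum_cofactor_count[OF r])
  have "((\<lambda>x. ?S x / x) \<longlongrightarrow> C) at_top"
    unfolding S C_def progression_const_eq[OF r j]
    by (rule divisor_sum_progression_tendsto[OF _ j k cofactor_count_sums[OF j]]) simp
  hence L: "((\<lambda>x. ?S x / x - C) \<longlongrightarrow> 0) at_top" by (rule LIM_zero)
  have "eventually (\<lambda>x. ?S x / x - C = (?S x - C * x) / x) at_top"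
    using eventually_gt_at_top[of "0::real"] by eventually_elim (simp add: diff_divide_distrib)
  thus "((\<lambda>x. (?S x - C * x) / x) \<longlongrightarrow> 0) at_top" by (rule Lim_transform_eventually[OF L])
  show "eventually (\<lambda>x::real. x \<noteq> 0) at_top" 
    using eventually_gt_at_top[of "0::real"] by eventually_elim simp
qed

theorem theorem4p3:
  fixes r :: enat
  assumes "r \<ge> 1"
  shows "convergent_prod (\<lambda>i. zeta_factor r (i + 2)) \<and>
    (\<lambda>x::real. (\<Sum>n | 0 < n \<and> real n \<le> x. real (partition_sum r n)) - zeta_const r * x)
      \<in> o[at_top](\<lambda>x. x) \<and>
    (\<forall>j k :: nat. 0 < j \<and> 0 < k \<and> coprime j k \<longrightarrow>
      convergent_prod (\<lambda>i. local_factor r j (i + 1)) \<and>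
      (\<lambda>x::real. (\<Sum>n | 0 < n \<and> real n \<le> x \<and> [n = k] (mod j). real (partition_sum r n))
          - progression_const r j / real (totient j) * x)
        \<in> o[at_top](\<lambda>x. x))"
proof (intro conjI allI impI)
  show "convergent_prod (\<lambda>i. zeta_factor r (i + 2))" by (rule convergent_prod_zeta_factor)
  \<comment> \<open>The unrestricted sum is the case \<open>j = k = 1\<close>: the congruence is
    void and all local factors are 1.\<close>
  have "[n = 1] (mod 1)" for n :: nat by (simp add: cong_def)
  thus "(\<lambda>x::real. (\<Sum>n | 0 < n \<and> real n \<le> x. real (partition_sum r n)) - zeta_const r * x) \<in> o[at_top](\<lambda>x. x)"
    using progression_asymptotics[OF assms, of 1 1] by (simp add: progression_const_1[simplified])
next
  fix j k :: nat assume jk: "0 < j \<and> 0 < k \<and> coprime j k"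
  show "convergent_prod (\<lambda>i. local_factor r j (i + 1))" by (rule convergent_prod_local_factor)
  show "(\<lambda>x::real. (\<Sum>n | 0 < n \<and> real n \<le> x \<and> [n = k] (mod j). real (partition_sum r n))
          - progression_const r j / real (totient j) * x) \<in> o[at_top](\<lambda>x. x)"
    using progression_asymptotics[OF assms] jk by blast
qed

end
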